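(* Let $0<\alpha<2$, $n>\alpha$ and $1<p\le\frac{n+\alpha}{n-\alpha}$. Let $u\in\mathcal{L}_\alpha\cap C^{1,1}_{loc}(\mathbb{R}^n_+)\cap C_{loc}(\overline{\mathbb{R}^n_+})$ be a nonnegative solution to $$\begin{cases}(-\Delta)^{\alpha/2}u(x)=u^p(x), & x\in\mathbb{R}^n_+,\\ u\equiv 0, & x\in(\mathbb{R}^n_+)^c.\end{cases}$$ Then $u\equiv 0$ in $\mathbb{R}^n_+$.
   Context: $\mathbb{R}^n_+=\{x=(x_1,\dots,x_n)\in\mathbb{R}^n: x_n>0\}$ and $(\mathbb{R}^n_+)^c$ is its complement in $\mathbb{R}^n$. $C_{loc}(\overline{\mathbb{R}^n_+})$ denotes continuity on the closed half space. The fractional Laplacian is $(-\Delta)^{\alpha/2}u(x)=C_{n,\alpha}\,\mathrm{P.V.}\int_{\mathbb{R}^n}\frac{u(x)-u(z)}{|x-z|^{n+\alpha}}\,dz$, where $\mathrm{P.V.}$ is the Cauchy principal value and $C_{n,\alpha}>0$ is a normalization constant. The space $\mathcal{L}_\alpha$ is the set of $u:\mathbb{R}^n\to\mathbb{R}$ with $\int_{\mathbb{R}^n}\frac{|u(x)|}{1+|x|^{n+\alpha}}\,dx<\infty$. The equation holds pointwise. *)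

theory Defs
  imports "HOL-Analysis.Analysis"
begin

text \<open>
  \<open>\<real>\<^sup>n\<close> is \<^typ>\<open>real ^ 'n\<close> with \<open>n = CARD('n)\<close>. A finite index type carries no order, so the
  distinguished (``last'') coordinate is an arbitrary index \<open>k\<close>.
\<close>

definition half_space :: "'n::finite \<Rightarrow> (real ^ 'n) set" where
  "half_space k = {x. x $ k > 0}"

definition L_space :: "real \<Rightarrow> (real ^ 'n::finite \<Rightarrow> real) set" where
  "L_space \<alpha> = {u. u \<in> borel_measurable lebesgue \<and>
     integrable lebesgue (\<lambda>x. \<bar>u x\<bar> / (1 + norm x powr (real CARD('n) + \<alpha>)))}"

definition C11_loc :: "'a::euclidean_space set \<Rightarrow> ('a \<Rightarrow> real) set" where
  "C11_loc S = {u. \<exists>g. (\<forall>x\<in>S. GDERIV u x :> g x) \<and>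
     (\<forall>K. compact K \<and> K \<subseteq> S \<longrightarrow> (\<exists>L. L-lipschitz_on K g))}"

text \<open>
  The Cauchy principal value is a relation rather than a total function, so that it includes the
  existence of the truncated integrals and of their limit.
\<close>

definition has_pv_integral :: "('a::euclidean_space \<Rightarrow> real) \<Rightarrow> 'a \<Rightarrow> real \<Rightarrow> bool" where
  "has_pv_integral f x I \<longleftrightarrow>
     (\<forall>\<epsilon>>0. set_integrable lebesgue (- ball x \<epsilon>) f) \<and>
     ((\<lambda>\<epsilon>. LINT z:- ball x \<epsilon>|lebesgue. f z) \<longlongrightarrow> I) (at_right 0)"

text \<open>
  \<open>has_frac_laplacian C \<alpha> u x v\<close>: the fractional Laplacian \<open>(-\<Delta>)\<^bsup>\<alpha>/2\<^esup> u(x)\<close>, with normalization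
  constant \<open>C\<close>, exists at the point \<open>x\<close> and has the value \<open>v\<close>.
\<close>

definition has_frac_laplacian ::
    "real \<Rightarrow> real \<Rightarrow> (real ^ 'n::finite \<Rightarrow> real) \<Rightarrow> real ^ 'n \<Rightarrow> real \<Rightarrow> bool" where
  "has_frac_laplacian C \<alpha> u x v \<longleftrightarrow>
     (\<exists>I. has_pv_integral (\<lambda>z. (u x - u z) / norm (x - z) powr (real CARD('n) + \<alpha>)) x I \<and>
          v = C * I)"

end

theory Submission
  imports Defs
begin

text \<open>
  If \<open>u\<close> vanishes at a point of the half space \<open>H\<close>, the equation at that point forces \<open>u = 0\<close>.
  Otherwise compare \<open>u\<close> with its Kelvin transforms \<open>u\<^sub>r\<close> in spheres of radius \<open>r\<close> centred in the
  interior of the complement of \<open>H\<close>. Small spheres do not meet \<open>H\<close>, so \<open>u\<^sub>r \<le> u\<close> outside them. Because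
  \<open>p \<le> (n + \<alpha>) / (n - \<alpha>)\<close>, at a negative minimum \<open>x\<close> of \<open>u - u\<^sub>r\<close> the equations for \<open>u\<close> and \<open>u\<^sub>r\<close> give
  \<open>s\<^bsup>-\<alpha>\<^esup> \<le> B (r / |x|)\<^bsup>2\<alpha>\<^esup>\<close> for every \<open>s\<close> comparable to \<open>|x|\<close>, to \<open>|x| - r\<close>, or to the distance of \<open>x\<close>
  from the boundary of \<open>H\<close>. Hence such minima stay in a compact part of \<open>H\<close> off the sphere, and
  since \<open>u\<^sub>r \<noteq> u\<close> (the centre is not in the closure of \<open>H\<close>) the radius can be increased without bound.
  Letting the spheres degenerate to hyperplanes, \<open>u x \<le> u y\<close> whenever \<open>y\<close> is further from the boundary
  than \<open>x\<close>. So \<open>u\<close> is bounded below away from the boundary, and touching it from below by a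
  paraboloid at scale \<open>R\<close> gives \<open>u \<ge> c R\<^bsup>\<alpha>\<^esup>\<close> at distance \<open>2 R\<close>, which contradicts \<open>u \<in> L\<^sub>\<alpha>\<close>.
\<close>

subsection \<open>Inversions and Lebesgue measure\<close>

text \<open>The equation is only pointwise, a limit of integrals truncated by balls, and an
  inversion does not keep balls concentric. So the truncations around \<open>x\<close> are replaced
  by \<open>inversion_nbhd\<close>, the inverse images of balls around the image of
  \<open>x\<close>, and limits at minima are taken along these. Outside the sphere the Kelvin
  transform reads \<open>u\<close> only inside a bounded ball. It therefore tends to 0 at infinity
  without any decay of \<open>u\<close>, and negative minima of the difference are attained. Centres
  outside the closed half space H also provide test regions: points outside both the sphere and H
  are reflected outside H, so the difference vanishes there. The exponent
  \<open>2 * \<alpha>\<close> is \<open>(n + \<alpha> - p * (n - \<alpha>)) + (n - \<alpha>) * (p -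
  1)\<close>: the first summand is the weight in the equation of the Kelvin transform, the second
  comes from linearising the power. Growth of order \<alpha> is exactly borderline for the weight of
  \<open>L_space\<close>: every dyadic scale contributes at least a fixed amount to the
  integral.\<close>

definition inversion :: "real \<Rightarrow> 'a::euclidean_space \<Rightarrow> 'a" where
  "inversion r y = (r\<^sup>2 / (norm y)\<^sup>2) *\<^sub>R y"

lemma inversion_0 [simp]: "inversion r 0 = 0"
  by (simp add: inversion_def)

lemma norm_inversion: "norm (inversion r y) = r\<^sup>2 / norm y"
  by (cases "y = 0") (simp_all add: inversion_def power2_eq_square)

lemma inversion_eq_0_iff [simp]: "r \<noteq> 0 \<Longrightarrow> inversion r y = 0 \<longleftrightarrow> y = 0"
  by (simp add: inversion_def)

lemma inversion_inversion [simp]: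
  assumes "r \<noteq> 0" shows "inversion r (inversion r y) = y"
proof (cases "y = 0")
  case False
  then show ?thesis
    using assms by (subst inversion_def, subst norm_inversion)
      (simp add: inversion_def power_divide field_simps power2_eq_square)
qed simp

lemma norm_inversion_diff:
  assumes "x \<noteq> 0" "y \<noteq> 0"
  shows "norm (inversion r x - inversion r y) = r\<^sup>2 * norm (x - y) / (norm x * norm y)"
proof -
  have nz: "norm x \<noteq> 0" "norm y \<noteq> 0" using assms by auto
  have field: "(s / a)\<^sup>2 + (s / b)\<^sup>2 - 2 * (s\<^sup>2 / (a\<^sup>2 * b\<^sup>2) * t) = s\<^sup>2 / (a\<^sup>2 * b\<^sup>2) * (b\<^sup>2 + a\<^sup>2 - 2 * t)"
    if "a \<noteq> 0" "b \<noteq> 0" for a b s t :: real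
    using that by (simp add: field_simps)
  have "(norm (inversion r x - inversion r y))\<^sup>2 =
      (norm (inversion r x))\<^sup>2 + (norm (inversion r y))\<^sup>2 - 2 * (inversion r x \<bullet> inversion r y)"
    by (simp add: power2_norm_eq_inner algebra_simps inner_commute)
  also have "inversion r x \<bullet> inversion r y = (r\<^sup>2)\<^sup>2 / ((norm x)\<^sup>2 * (norm y)\<^sup>2) * (x \<bullet> y)"
    by (simp add: inversion_def power2_eq_square mult_ac)
  also have "(norm (inversion r x))\<^sup>2 + (norm (inversion r y))\<^sup>2
      - 2 * ((r\<^sup>2)\<^sup>2 / ((norm x)\<^sup>2 * (norm y)\<^sup>2) * (x \<bullet> y))
      = (r\<^sup>2)\<^sup>2 / ((norm x)\<^sup>2 * (norm y)\<^sup>2) * ((norm y)\<^sup>2 + (norm x)\<^sup>2 - 2 * (x \<bullet> y))"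
    using field[OF nz] by (simp only: norm_inversion)
  also have "(norm y)\<^sup>2 + (norm x)\<^sup>2 - 2 * (x \<bullet> y) = (norm (x - y))\<^sup>2"
    by (simp add: power2_norm_eq_inner algebra_simps inner_commute)
  also have "(r\<^sup>2)\<^sup>2 / ((norm x)\<^sup>2 * (norm y)\<^sup>2) * (norm (x - y))\<^sup>2
      = (r\<^sup>2 * norm (x - y) / (norm x * norm y))\<^sup>2"
    by (simp add: power_divide power_mult_distrib)
  finally show ?thesis
    by (rule power2_eq_imp_eq) auto
qed

lemma borel_measurable_inversion [measurable]: "inversion r \<in> borel_measurable borel"
  unfolding inversion_def by measurable

text \<open>Vitali: disjoint balls fill \<open>S\<close> up to a null set. A ball of radius \<rho>
  is mapped into a ball of radius \<open>L * \<rho>\<close>, so volumes grow at most by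
  \<open>L ^ DIM('a)\<close>, and the image of the leftover set is null. The superset
  \<open>Z\<close> appears because the image itself need not be known to be measurable here.\<close>

lemma Lipschitz_image_open_cover:
  fixes f :: "'a::euclidean_space \<Rightarrow> 'a"
  assumes S: "open S" and L: "0 \<le> L"
    and lip: "\<And>x y. x \<in> S \<Longrightarrow> y \<in> S \<Longrightarrow> norm (f x - f y) \<le> L * norm (x - y)"
  obtains Z where "Z \<in> sets lebesgue" "f ` S \<subseteq> Z"
    "emeasure lebesgue Z \<le> ennreal (L ^ DIM('a)) * emeasure lborel S"
proof -
  define K where "K = {p::'a \<times> real. 0 < snd p \<and> ball (fst p) (snd p) \<subseteq> S}"
  have 1: "\<exists>i. i \<in> K \<and> x \<in> ball (fst i) (snd i) \<and> snd i < d" if "x \<in> S" "0 < d" for x d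
  proof -
    obtain e where e: "e > 0" "ball x e \<subseteq> S" using S \<open>x \<in> S\<close> openE by blast
    have "ball x (min e (d/2)) \<subseteq> S" using e by auto
    then show ?thesis using e that
      by (intro exI[of _ "(x, min e (d/2))"]) (auto simp: K_def)
  qed
  obtain C where C: "countable C" "C \<subseteq> K"
     "pairwise (\<lambda>i j. disjnt (ball (fst i) (snd i)) (ball (fst j) (snd j))) C"
     "negligible(S - (\<Union>i \<in> C. ball (fst i) (snd i)))"
    using Vitali_covering_theorem_balls[of S K fst snd, OF 1] by blast
  define I where "I = to_nat_on C ` C"
  define p where "p i = (if i \<in> I then from_nat_into C i else (0, 0))" for i
  have p_in: "p i \<in> C" if "i \<in> I" for i
    using that C(1) by (auto simp: p_def I_def)
  have p_inj: "p i \<noteq> p j" if "i \<in> I" "j \<in> I" "i \<noteq> j" for i j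
    using that C(1) by (auto simp: p_def I_def)
  have p_surj: "\<exists>i. p i = c" if "c \<in> C" for c
    using that C(1) by (intro exI[of _ "to_nat_on C c"]) (auto simp: p_def I_def)
  have p_nonneg: "0 \<le> snd (p i)" for i
    using p_in[of i] C(2) by (cases "i \<in> I") (auto simp: K_def p_def)
  define B where "B i = ball (fst (p i)) (snd (p i))" for i
  define D where "D i = cball (f (fst (p i))) (L * snd (p i))" for i
  have B_sub: "B i \<subseteq> S" for i
    using p_in[of i] C(2) by (cases "i \<in> I") (auto simp: K_def p_def B_def)
  have disj: "disjoint_family B"
  proof (unfold disjoint_family_on_def, intro ballI impI)
    fix i j :: nat assume "i \<noteq> j"
    show "B i \<inter> B j = {}"
    proof (cases "i \<in> I \<and> j \<in> I")
      case True
      then show ?thesis using C(3) p_in p_inj[of i j] \<open>i \<noteq> j\<close>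
        unfolding pairwise_def disjnt_def B_def by blast
    next
      case False
      then show ?thesis by (auto simp: B_def p_def)
    qed
  qed
  have UB: "(\<Union>i. B i) = (\<Union>i \<in> C. ball (fst i) (snd i))"
  proof
    show "(\<Union>i. B i) \<subseteq> (\<Union>i\<in>C. ball (fst i) (snd i))"
    proof
      fix z assume "z \<in> (\<Union>i. B i)"
      then obtain i where i: "z \<in> B i" by auto
      then have "i \<in> I" by (auto simp: B_def p_def split: if_splits)
      then show "z \<in> (\<Union>i\<in>C. ball (fst i) (snd i))"
        using p_in[of i] i by (auto simp: B_def)
    qed
    show "(\<Union>i\<in>C. ball (fst i) (snd i)) \<subseteq> (\<Union>i. B i)"
    proof
      fix z assume "z \<in> (\<Union>i\<in>C. ball (fst i) (snd i))"
      then obtain c where c: "c \<in> C" "z \<in> ball (fst c) (snd c)" by blast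
      then show "z \<in> (\<Union>i. B i)" using p_surj[OF c(1)] unfolding B_def by blast
    qed
  qed
  define N where "N = f ` (S - (\<Union>i. B i))"
  have N: "negligible N"
    unfolding N_def
  proof (rule negligible_locally_Lipschitz_image)
    show "negligible (S - (\<Union>i. B i))" using C(4) UB by simp
    show "\<exists>T Ba. open T \<and> x \<in> T \<and> (\<forall>y\<in>(S - (\<Union>i. B i)) \<inter> T. norm (f y - f x) \<le> Ba * norm (y - x))"
      if "x \<in> S - (\<Union>i. B i)" for x
      using that S by (intro exI[of _ S] exI[of _ L] conjI ballI lip) auto
  qed simp
  show ?thesis
  proof
    show "N \<union> (\<Union>i. D i) \<in> sets lebesgue"
      using N by (auto simp: D_def negligible_iff_null_sets)
    show "f ` S \<subseteq> N \<union> (\<Union>i. D i)"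
    proof
      fix z assume "z \<in> f ` S"
      then obtain x where x: "x \<in> S" "z = f x" by auto
      show "z \<in> N \<union> (\<Union>i. D i)"
      proof (cases "x \<in> (\<Union>i. B i)")
        case True
        then obtain i where i: "x \<in> B i" by auto
        then have "0 < snd (p i)" unfolding B_def by (metis ball_eq_empty empty_iff not_le)
        then have "fst (p i) \<in> B i" by (auto simp: B_def)
        then have "norm (f (fst (p i)) - f x) \<le> L * norm (fst (p i) - x)"
          using lip B_sub x by blast
        also have "\<dots> \<le> L * snd (p i)"
          using i L by (intro mult_left_mono) (auto simp: B_def dist_norm)
        finally have "f x \<in> D i" by (simp add: D_def dist_norm)
        then show ?thesis using x by auto
      qed (use x in \<open>auto simp: N_def\<close>)
    qed
    have "emeasure lebesgue (N \<union> (\<Union>i. D i)) \<le> emeasure lebesgue (\<Union>i. D i)"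
      using N by (subst Un_commute, subst emeasure_Un_null_set)
        (auto simp: D_def negligible_iff_null_sets)
    also have "\<dots> \<le> (\<Sum>i. emeasure lebesgue (D i))"
      by (intro emeasure_subadditive_countably) (auto simp: D_def)
    also have "\<dots> = (\<Sum>i. ennreal (L ^ DIM('a)) * emeasure lborel (B i))"
      using p_nonneg L
      by (intro suminf_cong) (simp add: D_def B_def emeasure_cball emeasure_ball power_mult_distrib
          ennreal_mult[symmetric] mult_ac)
    also have "\<dots> = ennreal (L ^ DIM('a)) * emeasure lborel (\<Union>i. B i)"
      using disj by (subst suminf_emeasure[symmetric]) (auto simp: B_def)
    also have "\<dots> \<le> ennreal (L ^ DIM('a)) * emeasure lborel S"
      using B_sub S by (intro mult_left_mono emeasure_mono) auto
    finally show "emeasure lebesgue (N \<union> (\<Union>i. D i)) \<le> ennreal (L ^ DIM('a)) * emeasure lborel S" .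
  qed
qed

text \<open>Outer regularity replaces \<open>A\<close> by an open set of almost the same measure, to
  which the covering applies.\<close>

lemma emeasure_Lipschitz_image_le:
  fixes f :: "'a::euclidean_space \<Rightarrow> 'a"
  assumes S: "open S" and L: "0 \<le> L"
    and lip: "\<And>x y. x \<in> S \<Longrightarrow> y \<in> S \<Longrightarrow> norm (f x - f y) \<le> L * norm (x - y)"
    and A: "A \<in> sets borel" "A \<subseteq> S" "f ` A \<in> sets borel"
  shows "emeasure lborel (f ` A) \<le> ennreal (L ^ DIM('a)) * emeasure lborel A"
proof -
  have *: "emeasure lborel (f ` A) \<le> ennreal (L ^ DIM('a)) * (emeasure lborel A + ennreal e)"
    if e: "e > 0" for e
  proof -
    obtain U where U: "open U" "A \<subseteq> U" "emeasure lborel (U - A) < e"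
      using outer_regular_lborel[OF A(1) e] by blast
    have op: "open (U \<inter> S)" using U S by auto
    obtain Z where Z: "Z \<in> sets lebesgue" "f ` (U \<inter> S) \<subseteq> Z"
      "emeasure lebesgue Z \<le> ennreal (L ^ DIM('a)) * emeasure lborel (U \<inter> S)"
      using Lipschitz_image_open_cover[of "U \<inter> S" L f, OF op L] lip by blast
    have "emeasure lborel (f ` A) = emeasure lebesgue (f ` A)" using A by simp
    also have "\<dots> \<le> emeasure lebesgue Z"
      using Z A U by (intro emeasure_mono) auto
    also have "\<dots> \<le> ennreal (L ^ DIM('a)) * emeasure lborel (U \<inter> S)" by fact
    also have "emeasure lborel (U \<inter> S) \<le> emeasure lborel (A \<union> (U - A))"
      using A U by (intro emeasure_mono) auto
    also have "\<dots> \<le> emeasure lborel A + emeasure lborel (U - A)"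
      using A U by (intro emeasure_subadditive) auto
    also have "\<dots> \<le> emeasure lborel A + ennreal e"
      using U by (intro add_left_mono) auto
    finally show ?thesis by (simp add: mult_left_mono)
  qed
  show ?thesis
  proof (cases "emeasure lborel A = \<infinity> \<and> L ^ DIM('a) > 0")
    case True
    then have "L > 0" using L by (cases "L = 0") (auto simp: power_0_left)
    with True show ?thesis by (simp add: ennreal_mult_top)
  next
    case False
    then have fin: "ennreal (L ^ DIM('a)) * emeasure lborel A < \<infinity>"
      using zero_le_power[OF L, of "DIM('a)"]
      by (cases "L ^ DIM('a) = 0") (auto simp: ennreal_mult_less_top less_top)
    show ?thesis
    proof (rule ennreal_le_epsilon)
      fix e :: real assume e: "e > 0"
      \<comment> \<open>The summand 1 in the denominator keeps the quotient meaningful when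
        \<open>L\<close> is 0.\<close>
      have "emeasure lborel (f ` A)
          \<le> ennreal (L ^ DIM('a)) * (emeasure lborel A + ennreal (e / (L ^ DIM('a) + 1)))"
        using L e by (intro *) (simp add: add_nonneg_pos)
      also have "\<dots> = ennreal (L ^ DIM('a)) * emeasure lborel A
            + ennreal (L ^ DIM('a) * (e / (L ^ DIM('a) + 1)))"
        using L e by (simp add: distrib_left ennreal_mult'[symmetric])
      also have "\<dots> \<le> ennreal (L ^ DIM('a)) * emeasure lborel A + ennreal e"
      proof (intro add_left_mono ennreal_leI)
        have "0 \<le> L ^ DIM('a)" using L by simp
        then show "L ^ DIM('a) * (e / (L ^ DIM('a) + 1)) \<le> e"
          using e by (simp add: pos_divide_le_eq algebra_simps)
      qed
      finally show "emeasure lborel (f ` A) \<le> ennreal (L ^ DIM('a)) * emeasure lborel A + ennreal e" .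
    qed
  qed
qed

text \<open>
  The change-of-variables theorem of the library needs a well-ordered index type. For inversions it is
  enough that on the annulus \<open>t\<^bsup>k\<^esup> \<le> |y| < t\<^bsup>k+1\<^esup>\<close> the Lipschitz constant approximates the local
  dilation factor \<open>r\<^sup>2 / |y|\<^sup>2\<close> up to a power of \<open>t\<close>, and to let \<open>t \<rightarrow> 1\<close>.
\<close>

lemma emeasure_inversion_le:
  fixes A :: "'a::euclidean_space set"
  assumes r: "r > 0" and A: "A \<in> sets borel"
  shows "emeasure lborel (inversion r -` A) \<le>
    (\<integral>\<^sup>+y. ennreal ((r / norm y) ^ (2 * DIM('a))) * indicator A y \<partial>lborel)"
proof -
  define J where "J = (\<lambda>y::'a. ennreal ((r / norm y) ^ (2 * DIM('a))))"
  have Jm [measurable]: "J \<in> borel_measurable borel" unfolding J_def by measurable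
  define M where "M = distr lborel borel (inversion r :: 'a \<Rightarrow> 'a)"
  define N where "N = density lborel J"
  have sM: "sets M = sets borel" "sets N = sets borel" by (simp_all add: M_def N_def)
  have Me: "emeasure M B = emeasure lborel (inversion r -` B)" if "B \<in> sets borel" for B
    using that by (simp add: M_def emeasure_distr)
  have vimage: "inversion r -` B = inversion r ` B" for B :: "'a set"
  proof -
    have "z \<in> inversion r ` B" if "inversion r z \<in> B" for z
      using that r by (intro image_eqI[of _ _ "inversion r z"]) auto
    then show ?thesis using r by auto
  qed
  have bound: "emeasure M A \<le> ennreal (t ^ (4 * DIM('a))) * emeasure N A" if t: "t > 1" for t
  proof -
    define S where "S k = {y::'a. t powi k \<le> norm y \<and> norm y < t powi (k + 1)}" for k :: int
    have S [measurable]: "S k \<in> sets borel" for k unfolding S_def by measurable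
    have pw: "t powi k > 0" for k using t by simp
    have pw_mono: "t powi i \<le> t powi j" if "i \<le> j" for i j using t that by (intro power_int_increasing) auto
    have disj: "disjoint_family (\<lambda>k. A \<inter> S k)"
    proof (unfold disjoint_family_on_def, intro ballI impI)
      fix i j :: int assume "i \<noteq> j"
      have less: "S i \<inter> S j = {}" if "i < j" for i j
        using pw_mono[of "i + 1" j] that by (auto simp: S_def)
      then show "(A \<inter> S i) \<inter> (A \<inter> S j) = {}" using less[of i j] less[of j i] \<open>i \<noteq> j\<close> by (cases i j rule: linorder_cases) auto
    qed
    have cover: "\<exists>k. y \<in> S k" if "y \<noteq> 0" for y
    proof
      have y: "norm y = t powr (log t (norm y))" using t that by simp
      have pi: "t powi m = t powr real_of_int m" for m using t by (simp add: powr_real_of_int')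
      show "y \<in> S \<lfloor>log t (norm y)\<rfloor>"
        unfolding S_def mem_Collect_eq pi using t floor_correct[of "log t (norm y)"]
          y powr_le_cancel_iff[OF t, of "real_of_int \<lfloor>log t (norm y)\<rfloor>" "log t (norm y)"]
          powr_less_cancel_iff[OF t, of "log t (norm y)" "real_of_int (\<lfloor>log t (norm y)\<rfloor> + 1)"]
        by simp
    qed
    have piece: "emeasure M (A \<inter> S k) \<le> ennreal (t ^ (4 * DIM('a))) * emeasure N (A \<inter> S k)" for k
    proof -
      \<comment> \<open>The covering needs an open domain, so the inner radius is lowered by one
        factor \<open>t\<close>. Together with the width of the annulus this costs
        \<open>t ^ 4\<close> per dimension.\<close>
      define T where "T = {y::'a. t powi (k - 1) < norm y}"
      define L where "L = r\<^sup>2 / (t powi (k - 1))\<^sup>2"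
      have T: "open T" unfolding T_def by (intro open_Collect_less continuous_intros)
      have L: "0 \<le> L" by (simp add: L_def)
      have "t powi (k - 1) < t powi k" using t by (intro power_int_strict_increasing) auto
      then have sub: "A \<inter> S k \<subseteq> T" by (auto simp: S_def T_def)
      have lip: "norm (inversion r x - inversion r y) \<le> L * norm (x - y)" if "x \<in> T" "y \<in> T" for x y
      proof -
        have ge: "t powi (k - 1) < norm x" "t powi (k - 1) < norm y" using that by (auto simp: T_def)
        have nz: "x \<noteq> 0" "y \<noteq> 0" using ge pw[of "k - 1"] by auto
        have "(t powi (k - 1))\<^sup>2 \<le> norm x * norm y"
          unfolding power2_eq_square using ge pw[of "k - 1"] by (intro mult_mono) auto
        then have "r\<^sup>2 / (norm x * norm y) \<le> L"
          unfolding L_def using pw[of "k - 1"] nz t by (intro divide_left_mono mult_pos_pos) auto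
        then have "r\<^sup>2 / (norm x * norm y) * norm (x - y) \<le> L * norm (x - y)"
          by (intro mult_right_mono) auto
        then show ?thesis using norm_inversion_diff[OF nz, of r] by simp
      qed
      have meas: "inversion r ` (A \<inter> S k) \<in> sets borel"
        using measurable_sets[OF borel_measurable_inversion[of r], of "A \<inter> S k"] A S
        by (simp flip: vimage)
      have "emeasure M (A \<inter> S k) = emeasure lborel (inversion r ` (A \<inter> S k))"
        using A by (simp add: Me flip: vimage)
      also have "\<dots> \<le> ennreal (L ^ DIM('a)) * emeasure lborel (A \<inter> S k)"
        using A S sub meas by (intro emeasure_Lipschitz_image_le[OF T L lip]) auto
      also have "L ^ DIM('a) = t ^ (4 * DIM('a)) * (r / t powi (k + 1)) ^ (2 * DIM('a))"
      proof -
        have "t powi (k + 1) = t ^ 2 * t powi (k - 1)"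
          using t power_int_add[of t 2 "k - 1"] by (simp add: add.commute)
        then have "L = (t\<^sup>2)\<^sup>2 * (r / t powi (k + 1))\<^sup>2"
          using t by (simp add: L_def power_divide power_mult_distrib)
        also have "(t\<^sup>2)\<^sup>2 = t ^ 4" by simp
        finally have "L = t ^ 4 * (r / t powi (k + 1))\<^sup>2" .
        then show ?thesis by (simp add: power_mult_distrib power_mult)
      qed
      also have "ennreal (t ^ (4 * DIM('a)) * (r / t powi (k + 1)) ^ (2 * DIM('a))) * emeasure lborel (A \<inter> S k)
        = ennreal (t ^ (4 * DIM('a))) * (ennreal ((r / t powi (k + 1)) ^ (2 * DIM('a))) * emeasure lborel (A \<inter> S k))"
        using t r by (simp add: ennreal_mult mult.assoc)
      also have "\<dots> \<le> ennreal (t ^ (4 * DIM('a))) * emeasure N (A \<inter> S k)"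
      proof (intro mult_left_mono)
        have "ennreal ((r / t powi (k + 1)) ^ (2 * DIM('a))) * emeasure lborel (A \<inter> S k)
          = (\<integral>\<^sup>+y. ennreal ((r / t powi (k + 1)) ^ (2 * DIM('a))) * indicator (A \<inter> S k) y \<partial>lborel)"
          using A by (simp add: nn_integral_cmult_indicator)
        also have "\<dots> \<le> (\<integral>\<^sup>+y. J y * indicator (A \<inter> S k) y \<partial>lborel)"
        proof (intro nn_integral_mono)
          fix y :: 'a
          show "ennreal ((r / t powi (k + 1)) ^ (2 * DIM('a))) * indicator (A \<inter> S k) y \<le> J y * indicator (A \<inter> S k) y"
          proof (cases "y \<in> A \<inter> S k")
            case True
            then have "t powi k \<le> norm y" "norm y \<le> t powi (k + 1)" by (auto simp: S_def)
            then have "(r / t powi (k + 1)) ^ (2 * DIM('a)) \<le> (r / norm y) ^ (2 * DIM('a))"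
              using r pw[of k] pw[of "k+1"] by (intro power_mono divide_left_mono mult_pos_pos) auto
            then show ?thesis using True by (simp add: J_def ennreal_leI)
          qed auto
        qed
        also have "\<dots> = emeasure N (A \<inter> S k)"
          using A by (simp add: N_def emeasure_density)
        finally show "ennreal ((r / t powi (k + 1)) ^ (2 * DIM('a))) * emeasure lborel (A \<inter> S k) \<le> emeasure N (A \<inter> S k)" .
      qed auto
      finally show ?thesis .
    qed
    have null: "emeasure M {0} = 0"
    proof -
      have "inversion r -` {0::'a} = {0}" using r by auto
      then show ?thesis by (simp add: Me)
    qed
    have "emeasure M A \<le> emeasure M ((\<Union>k. A \<inter> S k) \<union> {0})"
      using cover A by (intro emeasure_mono) (auto simp: sM)
    also have "\<dots> = emeasure M (\<Union>k. A \<inter> S k)"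
      using null A by (intro emeasure_Un_null_set) (auto simp: null_sets_def sM)
    also have "\<dots> = (\<integral>\<^sup>+k. emeasure M (A \<inter> S k) \<partial>count_space UNIV)"
      using disj A by (intro emeasure_UN_countable) (auto simp: sM)
    also have "\<dots> \<le> (\<integral>\<^sup>+k. ennreal (t ^ (4 * DIM('a))) * emeasure N (A \<inter> S k) \<partial>count_space UNIV)"
      by (intro nn_integral_mono piece)
    also have "\<dots> = ennreal (t ^ (4 * DIM('a))) * emeasure N (\<Union>k. A \<inter> S k)"
      using disj A by (subst emeasure_UN_countable) (auto simp: sM nn_integral_cmult)
    also have "\<dots> \<le> ennreal (t ^ (4 * DIM('a))) * emeasure N A"
      using A by (intro mult_left_mono emeasure_mono) (auto simp: sM)
    finally show ?thesis .
  qed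
  have "emeasure M A \<le> emeasure N A"
  proof (cases "emeasure N A = \<infinity>")
    case False
    then have "((\<lambda>t. emeasure N A * ennreal (t ^ (4 * DIM('a)))) \<longlongrightarrow> emeasure N A * ennreal (1 ^ (4 * DIM('a)))) (at_right (1::real))"
      by (intro ennreal_tendsto_cmult tendsto_ennrealI tendsto_intros) (auto simp: less_top)
    then have "emeasure M A \<le> emeasure N A * ennreal (1 ^ (4 * DIM('a)))"
    proof (rule tendsto_lowerbound)
      show "\<forall>\<^sub>F t in at_right (1::real). emeasure M A \<le> emeasure N A * ennreal (t ^ (4 * DIM('a)))"
        using eventually_at_right_less[of "1::real"] by eventually_elim (use bound in \<open>simp add: mult.commute\<close>)
    qed simp
    then show ?thesis by simp
  qed simp
  then show ?thesis using A by (simp add: Me N_def emeasure_density J_def)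
qed

text \<open>Coverings give only one inequality. The other one follows because the inversion is an
  involution and the Jacobians at \<open>y\<close> and at its image multiply to 1: the same
  inequality is applied once to \<open>f\<close> composed with the inversion and once to
  \<open>f\<close> divided by the Jacobian.\<close>

lemma nn_integral_inversion:
  fixes f :: "'a::euclidean_space \<Rightarrow> ennreal"
  assumes r: "r > 0" and f [measurable]: "f \<in> borel_measurable borel"
  shows "(\<integral>\<^sup>+y. f (inversion r y) * ennreal ((r / norm y) ^ (2 * DIM('a))) \<partial>lborel) = (\<integral>\<^sup>+y. f y \<partial>lborel)"
proof -
  define J where "J = (\<lambda>y::'a. ennreal ((r / norm y) ^ (2 * DIM('a))))"
  have Jm [measurable]: "J \<in> borel_measurable borel" unfolding J_def by measurable
  have le: "(\<integral>\<^sup>+y. g (inversion r y) \<partial>lborel) \<le> (\<integral>\<^sup>+y. g y * J y \<partial>lborel)"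
    if g [measurable]: "g \<in> borel_measurable borel" for g :: "'a \<Rightarrow> ennreal"
  proof -
    have "(\<integral>\<^sup>+y. g (inversion r y) \<partial>lborel) = (\<integral>\<^sup>+y. g y \<partial>distr lborel borel (inversion r))"
      by (subst nn_integral_distr) auto
    also have "\<dots> \<le> (\<integral>\<^sup>+y. g y \<partial>density lborel J)"
    proof (rule nn_integral_mono_measure)
      show "distr lborel borel (inversion r) \<le> density lborel J"
        using emeasure_inversion_le[OF r]
        by (subst le_measure) (auto simp: emeasure_distr emeasure_density J_def)
    qed simp
    also have "\<dots> = (\<integral>\<^sup>+y. g y * J y \<partial>lborel)"
      by (subst nn_integral_density) (auto simp: mult.commute)
    finally show ?thesis .
  qed
  have JJ: "J (inversion r y) * J y = 1" if "y \<noteq> 0" for y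
    using r that unfolding J_def norm_inversion
    by (subst ennreal_mult[symmetric]) (auto simp: power2_eq_square field_simps simp flip: power_mult_distrib)
  have ae: "AE y in lborel. y \<noteq> (0::'a)" by (rule AE_lborel_singleton)
  have "(\<integral>\<^sup>+y. f (inversion r y) * J y \<partial>lborel)
     = (\<integral>\<^sup>+y. f (inversion r y) * J (inversion r (inversion r y)) \<partial>lborel)"
    using r by simp
  also have "\<dots> \<le> (\<integral>\<^sup>+y. f y * J (inversion r y) * J y \<partial>lborel)"
    by (rule le) measurable
  also have "\<dots> = (\<integral>\<^sup>+y. f y \<partial>lborel)"
    using ae by (intro nn_integral_cong_AE) (auto simp: mult.assoc JJ elim!: eventually_mono)
  finally have 1: "(\<integral>\<^sup>+y. f (inversion r y) * J y \<partial>lborel) \<le> (\<integral>\<^sup>+y. f y \<partial>lborel)" .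
  have "(\<integral>\<^sup>+y. f y \<partial>lborel) = (\<integral>\<^sup>+y. f (inversion r (inversion r y)) \<partial>lborel)"
    using r by simp
  also have "\<dots> \<le> (\<integral>\<^sup>+y. f (inversion r y) * J y \<partial>lborel)"
    by (rule le) measurable
  finally show ?thesis using 1 by (simp add: J_def)
qed

lemma lborel_eq_distr_inversion:
  assumes r: "r > 0"
  shows "(lborel :: 'a::euclidean_space measure) =
    distr (density lborel (\<lambda>y. ennreal ((r / norm y) ^ (2 * DIM('a))))) borel (inversion r)" (is "_ = ?D")
proof (rule measure_eqI)
  fix A :: "'a set" assume "A \<in> sets lborel"
  then have A: "A \<in> sets borel" by simp
  have "emeasure ?D A = (\<integral>\<^sup>+y. indicator A (inversion r y) * ennreal ((r / norm y) ^ (2 * DIM('a))) \<partial>lborel)"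
    using A measurable_sets[OF borel_measurable_inversion[of r] A]
    by (simp add: emeasure_distr emeasure_density indicator_vimage mult.commute)
  also have "\<dots> = emeasure lborel A"
    using A by (subst nn_integral_inversion[OF r]) auto
  finally show "emeasure lborel A = emeasure ?D A" by simp
qed simp

lemma
  fixes f :: "'a::euclidean_space \<Rightarrow> real"
  assumes r: "r > 0" and f [measurable]: "f \<in> borel_measurable borel"
  shows integrable_inversion_iff:
      "integrable lborel (\<lambda>y. f (inversion r y) * (r / norm y) ^ (2 * DIM('a))) \<longleftrightarrow> integrable lborel f"
    and integral_inversion:
      "(LINT y|lborel. f (inversion r y) * (r / norm y) ^ (2 * DIM('a))) = (LINT y|lborel. f y)"
proof -
  let ?J = "\<lambda>y::'a. (r / norm y) ^ (2 * DIM('a))"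
  have Jm: "?J \<in> borel_measurable lborel" by measurable
  have J0: "AE y in lborel. 0 \<le> ?J y" using r by simp
  have "integrable lborel f \<longleftrightarrow> integrable (distr (density lborel (\<lambda>y. ennreal (?J y))) borel (inversion r)) f"
    using lborel_eq_distr_inversion[OF r, where 'a='a] by simp
  also have "\<dots> \<longleftrightarrow> integrable (density lborel (\<lambda>y. ennreal (?J y))) (\<lambda>y. f (inversion r y))"
    by (rule integrable_distr_eq) auto
  also have "\<dots> \<longleftrightarrow> integrable lborel (\<lambda>y. ?J y *\<^sub>R f (inversion r y))"
    using J0 by (intro integrable_density) auto
  finally show "integrable lborel (\<lambda>y. f (inversion r y) * ?J y) \<longleftrightarrow> integrable lborel f"
    by (simp add: mult.commute)
  have "(LINT y|lborel. f y) = (LINT y|distr (density lborel (\<lambda>y. ennreal (?J y))) borel (inversion r). f y)"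
    using lborel_eq_distr_inversion[OF r, where 'a='a] by simp
  also have "\<dots> = (LINT y|density lborel (\<lambda>y. ennreal (?J y)). f (inversion r y))"
    by (rule integral_distr) auto
  also have "\<dots> = (LINT y|lborel. ?J y *\<^sub>R f (inversion r y))"
    using J0 by (intro integral_density) auto
  finally show "(LINT y|lborel. f (inversion r y) * ?J y) = (LINT y|lborel. f y)"
    by (simp add: mult.commute)
qed

subsection \<open>The kernel of the fractional Laplacian\<close>

lemma dyadic_scale_exists:
  fixes s :: real assumes "1 \<le> s"
  obtains k :: nat where "2 ^ k \<le> s" "s < 2 ^ Suc k"
proof -
  obtain m where m: "s < 2 ^ m" using real_arch_pow[of 2 s] by auto
  define j where "j = (LEAST m. s < (2::real) ^ m)"
  have j: "s < 2 ^ j" unfolding j_def using m by (rule LeastI)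
  have "j \<noteq> 0" using j assms by (intro notI) simp
  then obtain k where k: "j = Suc k" using not0_implies_Suc by blast
  have "\<not> s < 2 ^ k" using k not_less_Least[of k "\<lambda>m. s < (2::real) ^ m"] by (auto simp: j_def)
  then show ?thesis using that[of k] j k by simp
qed

lemma ennreal_le_suminf: "f k \<le> (\<Sum>k. f k :: ennreal)"
  using sum_le_suminf[of f "{k}"] by simp

text \<open>Common form of the two kernel bounds below: domination by weighted balls around
  \<open>x\<close> whose weight times volume is a geometric sequence.\<close>

lemma nn_integral_le_geometric:
  fixes x :: "'a::euclidean_space" and f :: "'a \<Rightarrow> ennreal"
  assumes le: "\<And>z. f z \<le> (\<Sum>k. ennreal (c k) * indicator (ball x (\<rho> k)) z)"
    and nonneg: "\<And>k. 0 \<le> c k" "\<And>k. 0 \<le> \<rho> k"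
    and eq: "\<And>k. c k * \<rho> k ^ DIM('a) = B * q ^ k" and q: "0 \<le> q" "q < 1"
  shows "(\<integral>\<^sup>+z. f z \<partial>lborel) \<le> ennreal (unit_ball_vol DIM('a) * B / (1 - q))"
proof -
  have B: "0 \<le> B" using eq[of 0] nonneg[of 0] by simp (metis nonneg mult_nonneg_nonneg zero_le_power)
  have "(\<integral>\<^sup>+z. f z \<partial>lborel) \<le> (\<integral>\<^sup>+z. (\<Sum>k. ennreal (c k) * indicator (ball x (\<rho> k)) z) \<partial>lborel)"
    by (intro nn_integral_mono le)
  also have "\<dots> = (\<Sum>k. (\<integral>\<^sup>+z. ennreal (c k) * indicator (ball x (\<rho> k)) z \<partial>lborel))"
  proof (intro nn_integral_suminf)
    fix k
    have [measurable]: "ball x (\<rho> k) \<in> sets lborel" by simp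
    show "(\<lambda>z. ennreal (c k) * indicator (ball x (\<rho> k)) z) \<in> borel_measurable lborel" by measurable
  qed
  also have "\<dots> = (\<Sum>k. ennreal (unit_ball_vol DIM('a) * B * q ^ k))"
  proof (intro suminf_cong)
    fix k
    have "(\<integral>\<^sup>+z. ennreal (c k) * indicator (ball x (\<rho> k)) z \<partial>lborel)
        = ennreal (c k) * ennreal (unit_ball_vol DIM('a) * \<rho> k ^ DIM('a))"
      using nonneg by (simp add: nn_integral_cmult_indicator emeasure_ball)
    also have "\<dots> = ennreal (unit_ball_vol DIM('a) * (c k * \<rho> k ^ DIM('a)))"
      using nonneg by (simp add: ennreal_mult[symmetric] mult_ac)
    finally show "(\<integral>\<^sup>+z. ennreal (c k) * indicator (ball x (\<rho> k)) z \<partial>lborel)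
        = ennreal (unit_ball_vol DIM('a) * B * q ^ k)" by (simp add: eq mult.assoc)
  qed
  also have "\<dots> = ennreal (unit_ball_vol DIM('a) * B * (1 / (1 - q)))"
    using q B by (intro suminf_ennreal_eq sums_mult geometric_sums) auto
  finally show ?thesis by simp
qed

text \<open>On the shell between radii \<open>2 ^ k * R\<close> and \<open>2 ^ Suc k * R\<close> the
  kernel is at most its value at the inner radius. Kernel times volume is then a multiple of
  \<open>(2 ^ k * R) powr (- \<alpha>)\<close>, which is summable since \<alpha> is
  positive.\<close>

lemma nn_integral_kernel_tail:
  fixes \<alpha> :: real
  assumes \<alpha>: "0 < \<alpha>"
  shows "\<exists>A::real. 0 \<le> A \<and> (\<forall>(x::'a::euclidean_space) R. 0 < R \<longrightarrow>
      (\<integral>\<^sup>+z. ennreal (1 / norm (x - z) powr (DIM('a) + \<alpha>)) * indicator (- ball x R) z \<partial>lborel)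
        \<le> ennreal (A * R powr (- \<alpha>)))"
proof -
  define q where "q = 2 powr (- \<alpha>)"
  define A where "A = unit_ball_vol DIM('a) * 2 ^ DIM('a) / (1 - q)"
  have q: "0 \<le> q" "q < 1" using \<alpha> by (auto simp: q_def powr_less_one)
  have A: "0 \<le> A" using q by (auto simp: A_def)
  define N where "N = real DIM('a) + \<alpha>"
  have N: "0 < N" using \<alpha> by (simp add: N_def)
  have main: "(\<integral>\<^sup>+z. ennreal (1 / norm (x - z) powr N) * indicator (- ball x R) z \<partial>lborel)
     \<le> ennreal (unit_ball_vol DIM('a) * (2 ^ DIM('a) * R powr (- \<alpha>)) / (1 - q))" if R: "0 < R" for x :: 'a and R
  proof (rule nn_integral_le_geometric)
    fix z
    show "ennreal (1 / norm (x - z) powr N) * indicator (- ball x R) z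
      \<le> (\<Sum>k. ennreal ((2 ^ k * R) powr (- N)) * indicator (ball x (2 ^ Suc k * R)) z)"
    proof (cases "z \<in> - ball x R")
      case True
      then have "1 \<le> norm (x - z) / R" using R by (simp add: dist_norm)
      then obtain k :: nat where "2 ^ k \<le> norm (x - z) / R" "norm (x - z) / R < 2 ^ Suc k"
        by (rule dyadic_scale_exists)
      then have k: "2 ^ k * R \<le> norm (x - z)" "norm (x - z) < 2 ^ Suc k * R"
        using R by (simp_all add: pos_le_divide_eq pos_divide_less_eq)
      have pos: "0 < 2 ^ k * R" using R by simp
      have "1 / norm (x - z) powr N \<le> 1 / (2 ^ k * R) powr N"
        using k(1) pos N by (intro divide_left_mono powr_mono2 mult_pos_pos) (auto intro: less_le_trans)
      also have "\<dots> = (2 ^ k * R) powr (- N)" by (simp add: powr_minus_divide)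
      finally have "ennreal (1 / norm (x - z) powr N) * indicator (- ball x R) z
        \<le> ennreal ((2 ^ k * R) powr (- N)) * indicator (ball x (2 ^ Suc k * R)) z"
        using k(2) True by (simp add: dist_norm ennreal_leI)
      also have "\<dots> \<le> (\<Sum>k. ennreal ((2 ^ k * R) powr (- N)) * indicator (ball x (2 ^ Suc k * R)) z)"
        by (rule ennreal_le_suminf)
      finally show ?thesis .
    qed auto
  next
    fix k
    show "(2 ^ k * R) powr (- N) * (2 ^ Suc k * R) ^ DIM('a) = 2 ^ DIM('a) * R powr (- \<alpha>) * q ^ k"
    proof -
      have pos: "0 < 2 ^ k * R" using R by simp
      have "(2 ^ Suc k * R) ^ DIM('a) = 2 ^ DIM('a) * (2 ^ k * R) powr DIM('a)"
        using pos by (simp add: powr_realpow power_mult_distrib[symmetric] mult_ac)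
      then have "(2 ^ k * R) powr (- N) * (2 ^ Suc k * R) ^ DIM('a) = 2 ^ DIM('a) * (2 ^ k * R) powr (- \<alpha>)"
        by (simp add: N_def powr_add[symmetric] mult.left_commute)
      also have "(2 ^ k * R) powr (- \<alpha>) = R powr (- \<alpha>) * q ^ k"
        using R by (simp add: q_def powr_mult powr_powr powr_realpow[symmetric] mult.commute)
      finally show ?thesis by simp
    qed
  qed (use R q in auto)
  show ?thesis
    using A main by (intro exI[of _ A]) (simp add: N_def A_def mult_ac)
qed

text \<open>The same with shells shrinking towards \<open>x\<close>. The quadratic factor, the size
  of a second-order remainder, makes the ratio \<open>2 powr (\<alpha> - 2)\<close>, which is below
  1 exactly because \<alpha> < 2.\<close>

lemma nn_integral_kernel_core:
  fixes \<alpha> :: real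
  assumes \<alpha>: "0 < \<alpha>" "\<alpha> < 2"
  shows "\<exists>A::real. 0 \<le> A \<and> (\<forall>(x::'a::euclidean_space) R. 0 < R \<longrightarrow>
      (\<integral>\<^sup>+z. ennreal ((norm (x - z))\<^sup>2 / norm (x - z) powr (DIM('a) + \<alpha>)) * indicator (ball x R) z \<partial>lborel)
        \<le> ennreal (A * R powr (2 - \<alpha>)))"
proof -
  define N where "N = real DIM('a) + \<alpha>"
  have N: "0 < N" using \<alpha> by (simp add: N_def)
  define q where "q = 2 powr (\<alpha> - 2)"
  define A where "A = unit_ball_vol DIM('a) * (2 ^ DIM('a) * 2 powr N) / (1 - q)"
  have q: "0 \<le> q" "q < 1" unfolding q_def using \<alpha> by (simp, intro powr_less_one) simp_all
  have A: "0 \<le> A" using q by (auto simp: A_def)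
  have main: "(\<integral>\<^sup>+z. ennreal ((norm (x - z))\<^sup>2 / norm (x - z) powr N) * indicator (ball x R) z \<partial>lborel)
     \<le> ennreal (unit_ball_vol DIM('a) * (2 ^ DIM('a) * 2 powr N * R powr (2 - \<alpha>)) / (1 - q))" if R: "0 < R" for x :: 'a and R
  proof -
    define t where "t = (\<lambda>k::nat. R / 2 ^ k)"
    have t: "0 < t k" for k using R by (simp add: t_def)
    show ?thesis
    proof (rule nn_integral_le_geometric)
      fix z
      \<comment> \<open>The radius is \<open>2 * t k\<close>, not \<open>t k\<close>: the balls are
        open and the distance \<open>t k\<close> itself occurs in the shell of index
        \<open>k\<close>.\<close>
      show "ennreal ((norm (x - z))\<^sup>2 / norm (x - z) powr N) * indicator (ball x R) z
        \<le> (\<Sum>k. ennreal ((t k)\<^sup>2 * (t k / 2) powr (- N)) * indicator (ball x (2 * t k)) z)"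
      proof (cases "z \<in> ball x R \<and> z \<noteq> x")
        case True
        then have nz: "0 < norm (x - z)" by auto
        have "1 \<le> R / norm (x - z)" using True nz by (simp add: dist_norm)
        then obtain k :: nat where "2 ^ k \<le> R / norm (x - z)" "R / norm (x - z) < 2 ^ Suc k"
          by (rule dyadic_scale_exists)
        then have k: "norm (x - z) \<le> t k" "t k / 2 < norm (x - z)"
          using R nz by (simp_all add: t_def field_simps)
        have "(norm (x - z))\<^sup>2 / norm (x - z) powr N \<le> (t k)\<^sup>2 / (t k / 2) powr N"
          using k nz t[of k] N by (intro frac_le power_mono powr_mono2) auto
        also have "\<dots> = (t k)\<^sup>2 * (t k / 2) powr (- N)" by (simp only: powr_minus divide_inverse)
        finally have "ennreal ((norm (x - z))\<^sup>2 / norm (x - z) powr N) * indicator (ball x R) z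
          \<le> ennreal ((t k)\<^sup>2 * (t k / 2) powr (- N)) * indicator (ball x (2 * t k)) z"
          using k(1) t[of k] True by (simp add: dist_norm ennreal_leI)
        also have "\<dots> \<le> (\<Sum>k. ennreal ((t k)\<^sup>2 * (t k / 2) powr (- N)) * indicator (ball x (2 * t k)) z)"
          by (rule ennreal_le_suminf)
        finally show ?thesis .
      qed auto
    next
      fix k
      show "(t k)\<^sup>2 * (t k / 2) powr (- N) * (2 * t k) ^ DIM('a) = 2 ^ DIM('a) * 2 powr N * R powr (2 - \<alpha>) * q ^ k"
      proof -
        have "(t k)\<^sup>2 * (t k / 2) powr (- N) * (2 * t k) ^ DIM('a)
          = 2 ^ DIM('a) * 2 powr N * (t k powr 2 * t k powr (- N) * t k powr DIM('a))"
        proof -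
          have "(t k / 2) powr (- N) = t k powr (- N) * 2 powr N"
            using t[of k] by (simp add: powr_divide powr_minus_divide)
          moreover have "(2 * t k) ^ DIM('a) = 2 ^ DIM('a) * t k powr DIM('a)"
            using t[of k] by (simp add: power_mult_distrib powr_realpow)
          moreover have "(t k)\<^sup>2 = t k powr 2" using t[of k] by simp
          ultimately show ?thesis by (simp only: mult_ac)
        qed
        also have "t k powr 2 * t k powr (- N) * t k powr DIM('a) = t k powr (2 - \<alpha>)"
          by (simp add: powr_add[symmetric] N_def)
        also have "t k powr (2 - \<alpha>) = R powr (2 - \<alpha>) * q ^ k"
        proof -
          have "(2 ^ k) powr (2 - \<alpha>) = (2::real) powr (k * (2 - \<alpha>))"
            by (simp add: powr_realpow[symmetric] powr_powr)
          moreover have "q ^ k = 2 powr (- (k * (2 - \<alpha>)))"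
            by (simp add: q_def powr_realpow[symmetric] powr_powr algebra_simps)
          ultimately show ?thesis
            using R by (simp add: t_def powr_divide powr_minus_divide)
        qed
        finally show ?thesis by (simp add: mult_ac)
      qed
    qed (use t q in \<open>auto simp: less_imp_le\<close>)
  qed
  show ?thesis
    using A main by (intro exI[of _ A]) (simp add: N_def A_def mult_ac)
qed

lemma set_integrable_kernel:
  fixes x :: "'a::euclidean_space" and \<alpha> R :: real
  assumes "0 < \<alpha>" "0 < R"
  shows "set_integrable lborel (- ball x R) (\<lambda>z. 1 / norm (x - z) powr (DIM('a) + \<alpha>))"
proof -
  let ?K = "\<lambda>z. 1 / norm (x - z) powr (DIM('a) + \<alpha>)"
  from nn_integral_kernel_tail[OF assms(1), where 'a='a]
  obtain A where "0 \<le> A \<and> (\<forall>(x::'a) R. 0 < R \<longrightarrow>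
      (\<integral>\<^sup>+z. ennreal (1 / norm (x - z) powr (DIM('a) + \<alpha>)) * indicator (- ball x R) z \<partial>lborel)
        \<le> ennreal (A * R powr (- \<alpha>)))" ..
  with assms(2) have A: "(\<integral>\<^sup>+z. ennreal (?K z) * indicator (- ball x R) z \<partial>lborel) \<le> ennreal (A * R powr (- \<alpha>))"
    by simp
  have m: "- ball x R \<in> sets borel" by simp
  have "(\<integral>\<^sup>+z. ennreal (norm (indicator (- ball x R) z *\<^sub>R ?K z)) \<partial>lborel)
    = (\<integral>\<^sup>+z. ennreal (?K z) * indicator (- ball x R) z \<partial>lborel)"
    by (intro nn_integral_cong) (simp add: indicator_def)
  also have "\<dots> < \<infinity>" using A by (rule le_less_trans) simp
  finally have fin: "(\<integral>\<^sup>+z. ennreal (norm (indicator (- ball x R) z *\<^sub>R ?K z)) \<partial>lborel) < \<infinity>" .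
  have "(\<lambda>z. indicator (- ball x R) z *\<^sub>R ?K z) \<in> borel_measurable lborel"
    using m by measurable
  then show ?thesis unfolding set_integrable_def using fin by (rule integrableI_bounded)
qed

text \<open>An Apollonian ball: the ratio of the distances to \<open>x\<close> and to 0 is below
  \<open>\<epsilon> / norm x\<close>. It contains \<open>x\<close> off centre, and an inversion of
  any radius maps it, apart from 0, to a ball centred at the image of \<open>x\<close>
  (\<open>inversion_in_ball_iff\<close>).\<close>

definition inversion_nbhd :: "'a::euclidean_space \<Rightarrow> real \<Rightarrow> 'a set" where
  "inversion_nbhd x \<epsilon> = {y. norm (x - y) * norm x < \<epsilon> * norm y}"

lemma inversion_nbhd_borel [measurable]: "inversion_nbhd x \<epsilon> \<in> sets borel"
  unfolding inversion_nbhd_def by measurable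

text \<open>The triangle inequality for \<open>norm y\<close> on either side. Both radii are
  \<epsilon> up to an error of order \<epsilon>^2, which is what makes the change of truncation
  harmless.\<close>

lemma inversion_nbhd_bounds:
  fixes x :: "'a::euclidean_space"
  assumes \<epsilon>: "0 < \<epsilon>" "\<epsilon> \<le> norm x / 2"
  shows "inversion_nbhd x \<epsilon> \<subseteq> ball x (norm x * \<epsilon> / (norm x - \<epsilon>))"
    and "ball x (norm x * \<epsilon> / (norm x + \<epsilon>)) \<subseteq> inversion_nbhd x \<epsilon>"
proof -
  have \<rho>: "0 < norm x" "\<epsilon> < norm x" using \<epsilon> by auto
  show "inversion_nbhd x \<epsilon> \<subseteq> ball x (norm x * \<epsilon> / (norm x - \<epsilon>))"
  proof
    fix y assume "y \<in> inversion_nbhd x \<epsilon>"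
    then have "norm (x - y) * norm x < \<epsilon> * norm y" by (simp add: inversion_nbhd_def)
    also have "\<dots> \<le> \<epsilon> * (norm x + norm (x - y))"
      using \<epsilon> norm_triangle_ineq4[of x "x - y"] by (intro mult_left_mono) auto
    finally have "norm (x - y) * (norm x - \<epsilon>) < norm x * \<epsilon>" by (simp add: algebra_simps)
    then show "y \<in> ball x (norm x * \<epsilon> / (norm x - \<epsilon>))"
      using \<rho> by (simp add: dist_norm pos_less_divide_eq)
  qed
  show "ball x (norm x * \<epsilon> / (norm x + \<epsilon>)) \<subseteq> inversion_nbhd x \<epsilon>"
  proof
    fix y assume "y \<in> ball x (norm x * \<epsilon> / (norm x + \<epsilon>))"
    then have "norm (x - y) * (norm x + \<epsilon>) < norm x * \<epsilon>"
      using \<rho> \<epsilon> by (simp add: dist_norm pos_less_divide_eq)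
    then have "norm (x - y) * norm x < \<epsilon> * (norm x - norm (x - y))" by (simp add: algebra_simps)
    also have "\<dots> \<le> \<epsilon> * norm y"
      using \<epsilon> norm_triangle_ineq2[of x "x - y"] by (intro mult_left_mono) auto
    finally show "y \<in> inversion_nbhd x \<epsilon>" by (simp add: inversion_nbhd_def)
  qed
qed

text \<open>
  Balls and inverted balls differ by a shell of relative thickness \<open>\<epsilon>\<close>, on which the integrand is
  \<open>O(\<epsilon>\<^bsup>1-n-\<alpha>\<^esup>)\<close>; hence both truncations give the same principal value when \<open>\<alpha> < 2\<close>.
\<close>

lemma integral_inversion_nbhd_minus_ball:
  fixes x :: "'a::euclidean_space" and F :: "'a \<Rightarrow> real" and \<alpha> d L :: real
  assumes \<alpha>: "0 < \<alpha>" "\<alpha> < 2" and x: "x \<noteq> 0"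
    and F [measurable]: "F \<in> borel_measurable borel"
    and int: "\<And>\<epsilon>. 0 < \<epsilon> \<Longrightarrow> set_integrable lborel (- ball x \<epsilon>) F"
    and d: "0 < d" and L: "0 \<le> L"
      "\<And>z. norm (x - z) < d \<Longrightarrow> \<bar>F z\<bar> \<le> L * norm (x - z) / norm (x - z) powr (DIM('a) + \<alpha>)"
  shows "((\<lambda>\<epsilon>. (LINT z:- inversion_nbhd x \<epsilon>|lborel. F z) - (LINT z:- ball x \<epsilon>|lborel. F z)) \<longlongrightarrow> 0) (at_right 0)"
proof -
  define \<rho> where "\<rho> = norm x"
  have \<rho>: "0 < \<rho>" using x by (simp add: \<rho>_def)
  define n where "n = DIM('a)"
  have n: "0 < n" by (simp add: n_def)
  define N where "N = real n + \<alpha>"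
  define V where "V = unit_ball_vol (real n)"
  have V: "0 \<le> V" by (simp add: V_def)
  define c where "c = L * V * (2 * 2 powr N * real n * 2 ^ (n - 1) * (3 / \<rho>))"
  have bound: "\<bar>(LINT z:- inversion_nbhd x \<epsilon>|lborel. F z) - (LINT z:- ball x \<epsilon>|lborel. F z)\<bar> \<le> c * \<epsilon> powr (2 - \<alpha>)"
    if \<epsilon>: "0 < \<epsilon>" "\<epsilon> < \<rho> / 2" "\<epsilon> < d / 2" for \<epsilon>
  proof -
    define r1 where "r1 = \<rho> * \<epsilon> / (\<rho> + \<epsilon>)"
    define r2 where "r2 = \<rho> * \<epsilon> / (\<rho> - \<epsilon>)"
    have r1: "\<epsilon> / 2 \<le> r1" "r1 \<le> \<epsilon>" "0 < r1" using \<epsilon> \<rho> by (auto simp: r1_def field_simps)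
    have r2: "r2 \<le> 2 * \<epsilon>" "\<epsilon> \<le> r2" "0 < r2" using \<epsilon> \<rho> by (auto simp: r2_def field_simps)
    have sub: "inversion_nbhd x \<epsilon> \<subseteq> ball x r2" "ball x r1 \<subseteq> inversion_nbhd x \<epsilon>"
      using inversion_nbhd_bounds[of \<epsilon> x] \<epsilon> by (auto simp: r1_def r2_def \<rho>_def)
    have diff: "r2 - r1 \<le> 3 / \<rho> * \<epsilon>\<^sup>2"
    proof -
      have "r2 - r1 = \<rho> * \<epsilon> * ((\<rho> + \<epsilon>) - (\<rho> - \<epsilon>)) / ((\<rho> - \<epsilon>) * (\<rho> + \<epsilon>))"
        using \<epsilon> \<rho> by (simp add: r1_def r2_def divide_simps) (simp add: algebra_simps)
      also have "\<dots> = 2 * \<rho> * \<epsilon>\<^sup>2 / (\<rho>\<^sup>2 - \<epsilon>\<^sup>2)" by (simp add: power2_eq_square algebra_simps)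
      \<comment> \<open>\<epsilon> < \<rho>/2 leaves at least 3/4 of \<rho>^2 in the denominator;
        the smaller 2/3 gives the simple constant 3/\<rho>.\<close>
      also have "\<dots> \<le> 2 * \<rho> * \<epsilon>\<^sup>2 / (\<rho>\<^sup>2 * (2 / 3))"
      proof (intro divide_left_mono mult_pos_pos)
        have "\<epsilon>\<^sup>2 \<le> (\<rho> / 2)\<^sup>2" using \<epsilon> by (intro power_mono) auto
        moreover have "(\<rho> / 2)\<^sup>2 = \<rho>\<^sup>2 / 4" by (simp add: power_divide)
        moreover have "0 \<le> \<epsilon>\<^sup>2" by simp
        ultimately show "\<rho>\<^sup>2 * (2 / 3) \<le> \<rho>\<^sup>2 - \<epsilon>\<^sup>2" by linarith
        moreover have "0 < \<rho>\<^sup>2" using \<rho> by simp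
        ultimately show "0 < \<rho>\<^sup>2 - \<epsilon>\<^sup>2" by linarith
      qed (use \<epsilon> \<rho> in auto)
      also have "\<dots> = 3 / \<rho> * \<epsilon>\<^sup>2" using \<rho> by (simp add: power2_eq_square)
      finally show ?thesis .
    qed
    have pw: "r2 ^ n - r1 ^ n \<le> real n * (2 * \<epsilon>) ^ (n - 1) * (3 / \<rho> * \<epsilon>\<^sup>2)"
    proof -
      have "r2 ^ n - r1 ^ n = (r2 - r1) * (\<Sum>i<n. r2 ^ i * r1 ^ (n - Suc i))"
        using diff_power_eq_sum[of r2 "n - 1" r1] n by (simp add: lessThan_Suc_atMost)
      also have "\<dots> \<le> (3 / \<rho> * \<epsilon>\<^sup>2) * (\<Sum>i<n. (2 * \<epsilon>) ^ (n - 1))"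
      proof (intro mult_mono diff sum_mono)
        fix i assume "i \<in> {..<n}"
        then have "r2 ^ i * r1 ^ (n - Suc i) \<le> (2 * \<epsilon>) ^ i * (2 * \<epsilon>) ^ (n - Suc i)"
          using r1 r2 \<epsilon> by (intro mult_mono power_mono) auto
        also have "\<dots> = (2 * \<epsilon>) ^ (n - 1)"
          using \<open>i \<in> {..<n}\<close> by (simp only: power_add[symmetric]) simp
        finally show "r2 ^ i * r1 ^ (n - Suc i) \<le> (2 * \<epsilon>) ^ (n - 1)" .
      qed (use r1 r2 \<epsilon> \<rho> in \<open>auto intro!: sum_nonneg\<close>)
      finally show ?thesis by (simp add: mult_ac)
    qed
    define M where "M = L * (2 * \<epsilon>) * (\<epsilon> / 2) powr (- N)"
    have M: "\<bar>F z\<bar> \<le> M" if "z \<in> ball x r2 - ball x r1" for z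
    proof -
      have z: "r1 \<le> norm (x - z)" "norm (x - z) < r2" using that by (auto simp: dist_norm)
      have "norm (x - z) < d" using z r2 \<epsilon> by auto
      then have "\<bar>F z\<bar> \<le> L * (norm (x - z) / norm (x - z) powr N)"
        using L(2)[of z] by (simp add: N_def n_def)
      also have "\<dots> \<le> L * (2 * \<epsilon> / (\<epsilon> / 2) powr N)"
        using z r1 r2 \<epsilon> \<alpha> L(1) by (intro mult_left_mono frac_le powr_mono2) (auto simp: N_def)
      also have "\<dots> = M" by (simp add: M_def powr_minus_divide)
      finally show ?thesis .
    qed
    let ?S = "ball x r2 - ball x r1"
    have i1: "integrable lborel (\<lambda>z. indicator (- inversion_nbhd x \<epsilon>) z *\<^sub>R F z)"
      unfolding set_integrable_def[symmetric]
      by (rule set_integrable_subset[OF int[OF r1(3)]]) (use sub in auto)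
    have i2: "integrable lborel (\<lambda>z. indicator (- ball x \<epsilon>) z *\<^sub>R F z)"
      using int[OF \<epsilon>(1)] by (simp add: set_integrable_def)
    have iS: "integrable lborel (\<lambda>z. M * indicator ?S z)"
    proof (intro integrable_mult_right integrable_real_indicator)
      have "emeasure lborel ?S \<le> emeasure lborel (ball x r2)" by (intro emeasure_mono) auto
      also have "\<dots> < \<infinity>" using r2 by (simp add: emeasure_ball)
      finally show "emeasure lborel ?S < \<infinity>" .
    qed auto
    have "\<bar>(LINT z:- inversion_nbhd x \<epsilon>|lborel. F z) - (LINT z:- ball x \<epsilon>|lborel. F z)\<bar>
      = \<bar>LINT z|lborel. indicator (- inversion_nbhd x \<epsilon>) z *\<^sub>R F z - indicator (- ball x \<epsilon>) z *\<^sub>R F z\<bar>"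
      unfolding set_lebesgue_integral_def using i1 i2 by simp
    also have "\<dots> \<le> (LINT z|lborel. \<bar>indicator (- inversion_nbhd x \<epsilon>) z *\<^sub>R F z - indicator (- ball x \<epsilon>) z *\<^sub>R F z\<bar>)"
      by (rule integral_abs_bound)
    also have "\<dots> \<le> (LINT z|lborel. M * indicator ?S z)"
    proof (intro integral_mono integrable_abs Bochner_Integration.integrable_diff i1 i2 iS)
      fix z
      have "ball x \<epsilon> \<subseteq> ball x r2" "ball x r1 \<subseteq> ball x \<epsilon>" using r1 r2 by auto
      then have "z \<in> ?S" if "(z \<in> inversion_nbhd x \<epsilon>) \<noteq> (z \<in> ball x \<epsilon>)" using that sub by blast
      then show "\<bar>indicator (- inversion_nbhd x \<epsilon>) z *\<^sub>R F z - indicator (- ball x \<epsilon>) z *\<^sub>R F z\<bar> \<le> M * indicator ?S z"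
        using M[of z] L \<epsilon> by (cases "z \<in> inversion_nbhd x \<epsilon>"; cases "z \<in> ball x \<epsilon>") (auto simp: M_def)
    qed
    also have "\<dots> = M * measure lborel ?S"
      by simp
    also have "measure lborel ?S = V * (r2 ^ n - r1 ^ n)"
    proof -
      have "measure lborel ?S = measure lborel (ball x r2) - measure lborel (ball x r1)"
      proof (rule measure_Diff)
        show "emeasure lborel (ball x r2) \<noteq> \<infinity>" using r2 by (simp add: emeasure_ball)
        show "ball x r1 \<subseteq> ball x r2" using r1 r2 by auto
      qed auto
      then show ?thesis using r1 r2 by (simp add: content_ball V_def n_def algebra_simps)
    qed
    also have "M * (V * (r2 ^ n - r1 ^ n)) \<le> M * (V * (real n * (2 * \<epsilon>) ^ (n - 1) * (3 / \<rho> * \<epsilon>\<^sup>2)))"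
      using pw V L \<epsilon> by (intro mult_left_mono) (auto simp: M_def)
    also have "\<dots> = c * (\<epsilon> powr (- N) * (\<epsilon> * \<epsilon> ^ (n - 1) * \<epsilon>\<^sup>2))"
      using \<epsilon> by (simp add: M_def c_def powr_divide powr_minus power_mult_distrib field_simps)
    also have "\<epsilon> * \<epsilon> ^ (n - 1) * \<epsilon>\<^sup>2 = \<epsilon> powr (real n + 2)"
      using \<epsilon> n by (simp add: powr_add powr_realpow power_eq_if)
    also have "\<epsilon> powr (- N) * \<epsilon> powr (real n + 2) = \<epsilon> powr (2 - \<alpha>)"
      by (simp add: powr_add[symmetric] N_def)
    finally show ?thesis .
  qed
  show ?thesis
  proof (rule Lim_null_comparison)
    have "0 < min (\<rho> / 2) (d / 2)" using \<rho> d by simp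
    then show "\<forall>\<^sub>F \<epsilon> in at_right 0. norm ((LINT z:- inversion_nbhd x \<epsilon>|lborel. F z) - (LINT z:- ball x \<epsilon>|lborel. F z)) \<le> c * \<epsilon> powr (2 - \<alpha>)"
      unfolding eventually_at_right_field using bound by (intro exI[of _ "min (\<rho> / 2) (d / 2)"]) auto
    have "((\<lambda>\<epsilon>. c * \<epsilon> powr (2 - \<alpha>)) \<longlongrightarrow> c * 0) (at_right 0)"
      using \<alpha> eventually_at_right_less[of "0::real"]
      by (intro tendsto_intros tendsto_zero_powrI[where b = "2 - \<alpha>"]) (auto elim!: eventually_mono)
    then show "((\<lambda>\<epsilon>. c * \<epsilon> powr (2 - \<alpha>)) \<longlongrightarrow> 0) (at_right 0)" by simp
  qed
qed

subsection \<open>Kelvin transform and principal values\<close>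

definition riesz_kernel :: "real \<Rightarrow> 'a::euclidean_space \<Rightarrow> 'a \<Rightarrow> real" where
  "riesz_kernel \<alpha> x z = 1 / norm (x - z) powr (real DIM('a) + \<alpha>)"

definition kelvin :: "real \<Rightarrow> real \<Rightarrow> ('a::euclidean_space \<Rightarrow> real) \<Rightarrow> 'a \<Rightarrow> real" where
  "kelvin \<alpha> r u y = (r / norm y) powr (real DIM('a) - \<alpha>) * u (inversion r y)"

text \<open>Image measures and densities are handled on \<open>lborel\<close>. For Borel functions
  this agrees with \<open>has_pv_integral\<close>, see
  \<open>has_pv_integral_iff_lborel\<close>.\<close>

definition pv_lborel :: "('a::euclidean_space \<Rightarrow> real) \<Rightarrow> 'a \<Rightarrow> real \<Rightarrow> bool" where
  "pv_lborel f x I \<longleftrightarrow> (\<forall>\<epsilon>>0. set_integrable lborel (- ball x \<epsilon>) f) \<and>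
     ((\<lambda>\<epsilon>. LINT z:- ball x \<epsilon>|lborel. f z) \<longlongrightarrow> I) (at_right 0)"

lemma riesz_kernel_nonneg [simp]: "0 \<le> riesz_kernel \<alpha> x z"
  by (simp add: riesz_kernel_def)

lemma riesz_kernel_pos: "x \<noteq> z \<Longrightarrow> 0 < riesz_kernel \<alpha> x z"
  by (simp add: riesz_kernel_def)

lemma borel_measurable_riesz_kernel [measurable]: "riesz_kernel \<alpha> x \<in> borel_measurable borel"
  unfolding riesz_kernel_def by measurable

lemma borel_measurable_kelvin [measurable]:
  assumes [measurable]: "u \<in> borel_measurable borel"
  shows "kelvin \<alpha> r u \<in> borel_measurable borel"
  unfolding kelvin_def by measurable

text \<open>Conformal covariance, from \<open>norm_inversion_diff\<close>. The kernel contributes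
  the exponent -(n + \<alpha>) of \<open>r / norm y\<close> and the Jacobian 2 n; their sum n -
  \<alpha> is the exponent of the Kelvin transform.\<close>

lemma riesz_kernel_inversion:
  fixes x y :: "'a::euclidean_space"
  assumes xy: "x \<noteq> 0" "y \<noteq> 0" and r: "0 < r" and \<alpha>: "0 < \<alpha>"
  shows "riesz_kernel \<alpha> (inversion r x) (inversion r y) * (r / norm y) ^ (2 * DIM('a))
    = (norm x / r) powr (real DIM('a) + \<alpha>) * (r / norm y) powr (real DIM('a) - \<alpha>) * riesz_kernel \<alpha> x y"
proof (cases "x = y")
  case True
  have "0 < real DIM('a) + \<alpha>" using \<alpha> by (simp add: add_nonneg_pos)
  then show ?thesis by (simp add: True riesz_kernel_def)
next
  case False
  define N where "N = real DIM('a) + \<alpha>"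
  define X Y D where "X = norm x" and "Y = norm y" and "D = norm (x - y)"
  have pos: "0 < X" "0 < Y" "0 < D" using xy False by (auto simp: X_def Y_def D_def)
  have "riesz_kernel \<alpha> (inversion r x) (inversion r y) = (X * Y / (r\<^sup>2 * D)) powr N"
    using pos r by (simp add: riesz_kernel_def norm_inversion_diff[OF xy] X_def Y_def D_def N_def
        powr_divide powr_mult)
  also have "X * Y / (r\<^sup>2 * D) = X / r * (Y / r) * (1 / D)"
    by (simp add: power2_eq_square)
  also have "\<dots> powr N = (X / r) powr N * (Y / r) powr N * (1 / D) powr N"
    by (simp only: powr_mult)
  also have "(Y / r) powr N = (r / Y) powr (- N)"
    using pos r by (simp add: powr_minus_divide powr_divide)
  finally have k: "riesz_kernel \<alpha> (inversion r x) (inversion r y) = (X / r) powr N * (r / Y) powr (- N) * (1 / D) powr N" .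
  have "(r / norm y) ^ (2 * DIM('a)) = (r / Y) powr (2 * DIM('a))"
    using pos r by (simp add: Y_def powr_realpow[symmetric])
  then have "riesz_kernel \<alpha> (inversion r x) (inversion r y) * (r / norm y) ^ (2 * DIM('a))
    = (X / r) powr N * (r / Y) powr (- N) * (1 / D) powr N * (r / Y) powr (2 * DIM('a))"
    by (simp only: k)
  also have "(X / r) powr N * (r / Y) powr (- N) * (1 / D) powr N * (r / Y) powr (2 * DIM('a))
    = (X / r) powr N * ((r / Y) powr (- N) * (r / Y) powr (2 * DIM('a))) * (1 / D) powr N"
    by (simp only: mult_ac)
  also have "(r / Y) powr (- N) * (r / Y) powr (2 * DIM('a)) = (r / Y) powr (real DIM('a) - \<alpha>)"
    by (simp add: powr_add[symmetric] N_def)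
  also have "(1 / D) powr N = riesz_kernel \<alpha> x y"
    using pos by (simp add: riesz_kernel_def D_def N_def powr_divide)
  finally show ?thesis by (simp add: X_def Y_def N_def)
qed

lemma inversion_in_ball_iff:
  fixes x y :: "'a::euclidean_space"
  assumes xy: "x \<noteq> 0" "y \<noteq> 0" and r: "0 < r"
  shows "inversion r y \<in> ball (inversion r x) (r\<^sup>2 / (norm x)\<^sup>2 * \<epsilon>) \<longleftrightarrow> y \<in> inversion_nbhd x \<epsilon>"
proof -
  have pos: "0 < norm x" "0 < norm y" "0 < r\<^sup>2" using assms by auto
  have "inversion r y \<in> ball (inversion r x) (r\<^sup>2 / (norm x)\<^sup>2 * \<epsilon>)
    \<longleftrightarrow> r\<^sup>2 * (norm (x - y) / (norm x * norm y)) < r\<^sup>2 * (\<epsilon> / (norm x)\<^sup>2)"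
    by (simp add: dist_norm norm_inversion_diff[OF xy])
  also have "\<dots> \<longleftrightarrow> norm (x - y) / (norm x * norm y) < \<epsilon> / (norm x)\<^sup>2"
    using pos(3) by (simp only: mult_less_cancel_left_pos)
  also have "\<dots> \<longleftrightarrow> norm (x - y) * norm x < \<epsilon> * norm y"
  proof -
    have "A / (X * Y) < e / X\<^sup>2 \<longleftrightarrow> A * X < e * Y" if "0 < X" "0 < Y" for A X Y e :: real
      using that by (simp add: field_simps power2_eq_square)
    then show ?thesis using pos by blast
  qed
  finally show ?thesis by (simp add: inversion_nbhd_def)
qed

lemma
  fixes x :: "'a::euclidean_space" and f :: "'a \<Rightarrow> real"
  assumes x: "x \<noteq> 0" and r: "0 < r" and \<alpha>: "0 < \<alpha>" and f [measurable]: "f \<in> borel_measurable borel"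
  shows set_integrable_kernel_inversion_iff:
      "set_integrable lborel (- inversion_nbhd x \<epsilon>)
          (\<lambda>y. (norm x / r) powr (real DIM('a) + \<alpha>) * ((r / norm y) powr (real DIM('a) - \<alpha>) * f (inversion r y)) * riesz_kernel \<alpha> x y)
       \<longleftrightarrow> set_integrable lborel (- ball (inversion r x) (r\<^sup>2 / (norm x)\<^sup>2 * \<epsilon>)) (\<lambda>z. f z * riesz_kernel \<alpha> (inversion r x) z)"
      (is "?A = ?B")
    and set_integral_kernel_inversion:
      "(LINT y:- inversion_nbhd x \<epsilon>|lborel.
          (norm x / r) powr (real DIM('a) + \<alpha>) * ((r / norm y) powr (real DIM('a) - \<alpha>) * f (inversion r y)) * riesz_kernel \<alpha> x y)
       = (LINT z:- ball (inversion r x) (r\<^sup>2 / (norm x)\<^sup>2 * \<epsilon>)|lborel. f z * riesz_kernel \<alpha> (inversion r x) z)"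
      (is "?C = ?D")
proof -
  define h where "h z = indicator (- ball (inversion r x) (r\<^sup>2 / (norm x)\<^sup>2 * \<epsilon>)) z * (f z * riesz_kernel \<alpha> (inversion r x) z)" for z
  have hm [measurable]: "h \<in> borel_measurable borel"
    unfolding h_def by measurable
  define k where "k y = indicator (- inversion_nbhd x \<epsilon>) y *
     ((norm x / r) powr (real DIM('a) + \<alpha>) * ((r / norm y) powr (real DIM('a) - \<alpha>) * f (inversion r y)) * riesz_kernel \<alpha> x y)" for y
  have km [measurable]: "k \<in> borel_measurable borel"
    unfolding k_def by measurable
  have eq: "h (inversion r y) * (r / norm y) ^ (2 * DIM('a)) = k y" if "y \<noteq> 0" for y
  proof -
    have "indicator (- ball (inversion r x) (r\<^sup>2 / (norm x)\<^sup>2 * \<epsilon>)) (inversion r y) = (indicator (- inversion_nbhd x \<epsilon>) y :: real)"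
      using inversion_in_ball_iff[OF x that r, of \<epsilon>] by (simp only: indicator_def Compl_iff)
    then have "h (inversion r y) * (r / norm y) ^ (2 * DIM('a))
      = indicator (- inversion_nbhd x \<epsilon>) y * f (inversion r y) *
        (riesz_kernel \<alpha> (inversion r x) (inversion r y) * (r / norm y) ^ (2 * DIM('a)))"
      by (simp add: h_def)
    then show ?thesis
      unfolding riesz_kernel_inversion[OF x that r \<alpha>] by (simp add: k_def)
  qed
  \<comment> \<open>At 0 the inversion has the default value 0 and the identity may fail; a single
    point is null.\<close>
  have ae: "AE y in lborel. h (inversion r y) * (r / norm y) ^ (2 * DIM('a)) = k y"
    using AE_lborel_singleton[of "0::'a"] eq by (auto elim!: eventually_mono)
  have "integrable lborel k \<longleftrightarrow> integrable lborel (\<lambda>y. h (inversion r y) * (r / norm y) ^ (2 * DIM('a)))"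
    using ae by (intro integrable_cong_AE) (auto elim!: eventually_mono)
  also have "\<dots> \<longleftrightarrow> integrable lborel h" by (rule integrable_inversion_iff[OF r hm])
  finally show "?A = ?B" by (simp add: set_integrable_def k_def[abs_def] h_def[abs_def])
  have "(LINT y|lborel. k y) = (LINT y|lborel. h (inversion r y) * (r / norm y) ^ (2 * DIM('a)))"
    using ae by (intro integral_cong_AE) (auto elim!: eventually_mono)
  also have "\<dots> = (LINT z|lborel. h z)" by (rule integral_inversion[OF r hm])
  finally show "?C = ?D" by (simp add: set_lebesgue_integral_def k_def[abs_def] h_def[abs_def])
qed

lemma inversion_nbhd_subset_ball:
  assumes "0 < \<epsilon>" "(x::'a::euclidean_space) \<noteq> 0"
  shows "\<exists>\<delta>>0. inversion_nbhd x \<delta> \<subseteq> ball x \<epsilon>"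
proof -
  define \<delta> where "\<delta> = min (norm x / 2) (\<epsilon> / 2)"
  have \<delta>: "0 < \<delta>" "\<delta> \<le> norm x / 2" "\<delta> \<le> \<epsilon> / 2" using assms by (auto simp: \<delta>_def)
  have "norm x * \<delta> \<le> norm x * (\<epsilon> / 2)" using \<delta> by (intro mult_left_mono) auto
  also have "\<dots> = \<epsilon> * (norm x / 2)" by simp
  also have "\<dots> \<le> \<epsilon> * (norm x - \<delta>)" using \<delta> assms by (intro mult_left_mono) auto
  finally have "norm x * \<delta> / (norm x - \<delta>) \<le> \<epsilon>"
    using \<delta> assms by (simp add: pos_divide_le_eq)
  then show ?thesis
    using inversion_nbhd_bounds(1)[OF \<delta>(1,2)] \<delta>(1) subset_ball[of _ \<epsilon> x] by blast
qed

lemma ball_subset_inversion_nbhd: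
  assumes "0 < \<epsilon>" "\<epsilon> \<le> norm x / 2" "(x::'a::euclidean_space) \<noteq> 0"
  shows "\<exists>\<delta>>0. ball x \<delta> \<subseteq> inversion_nbhd x \<epsilon>"
  using inversion_nbhd_bounds(2)[OF assms(1,2)] assms
  by (intro exI[of _ "norm x * \<epsilon> / (norm x + \<epsilon>)"]) (auto intro!: divide_pos_pos add_pos_pos)

section \<open>First-order bounds at a point, as required by the change of truncation\<close>

lemma differentiable_imp_locally_Lipschitz_at:
  fixes f :: "'a::real_normed_vector \<Rightarrow> 'b::real_normed_vector"
  assumes "f differentiable (at x)"
  obtains L d where "0 \<le> L" "0 < d" "\<And>y. norm (y - x) < d \<Longrightarrow> norm (f y - f x) \<le> L * norm (y - x)"
proof -
  obtain f' where f': "(f has_derivative f') (at x)" using assms by (auto simp: differentiable_def)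
  obtain K where K: "0 < K" "\<And>h. norm (f' h) \<le> norm h * K"
    using bounded_linear.pos_bounded[OF has_derivative_bounded_linear[OF f']] by blast
  obtain d where d: "0 < d" "\<And>y. norm (y - x) < d \<Longrightarrow> norm (f y - f x - f' (y - x)) \<le> 1 * norm (y - x)"
    using f'[unfolded has_derivative_within_alt] by (metis UNIV_I zero_less_one)
  show ?thesis
  proof (rule that[of "K + 1" d])
    fix y assume "norm (y - x) < d"
    then have "norm (f y - f x - f' (y - x)) \<le> norm (y - x)" using d(2) by simp
    then show "norm (f y - f x) \<le> (K + 1) * norm (y - x)"
      using K(2)[of "y - x"] norm_triangle_ineq[of "f y - f x - f' (y - x)" "f' (y - x)"]
      by (simp add: algebra_simps)
  qed (use K d in auto)
qed

lemma norm_powr_Lipschitz_at: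
  fixes x :: "'a::real_normed_vector" and a :: real
  assumes x: "x \<noteq> 0"
  obtains L d where "0 \<le> L" "0 < d"
    "\<And>y. norm (y - x) < d \<Longrightarrow> \<bar>1 - (norm x / norm y) powr a\<bar> \<le> L * norm (y - x)"
proof -
  define \<phi> where "\<phi> = (\<lambda>t::real. (norm x / t) powr a)"
  have "\<phi> differentiable (at (norm x))"
    unfolding \<phi>_def real_differentiable_def
    by (rule exI, (rule derivative_eq_intros refl | use x in simp)+)
  then obtain L d where L: "0 \<le> L" "0 < d"
    "\<And>t. norm (t - norm x) < d \<Longrightarrow> norm (\<phi> t - \<phi> (norm x)) \<le> L * norm (t - norm x)"
    using differentiable_imp_locally_Lipschitz_at by blast
  show ?thesis
  proof (rule that[OF L(1,2)])
    fix y assume y: "norm (y - x) < d"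
    have le: "\<bar>norm y - norm x\<bar> \<le> norm (y - x)" by (rule norm_triangle_ineq3)
    then have "\<bar>\<phi> (norm y) - \<phi> (norm x)\<bar> \<le> L * \<bar>norm y - norm x\<bar>" using L(3)[of "norm y"] y by simp
    also have "\<dots> \<le> L * norm (y - x)" using le L(1) by (rule mult_left_mono)
    finally show "\<bar>1 - (norm x / norm y) powr a\<bar> \<le> L * norm (y - x)"
      using x by (simp add: \<phi>_def abs_minus_commute)
  qed
qed

lemma inversion_norm_fixed: "inversion (norm x) x = x"
  by (simp add: inversion_def)

text \<open>
  The fundamental solution \<open>|y|\<^bsup>\<alpha>-n\<^esup>\<close> is \<open>\<alpha>\<close>-harmonic away from the origin: the inversion in the
  sphere through \<open>x\<close> turns the truncated integral into its own negative.
\<close>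

lemma
  fixes x :: "'a::euclidean_space" and \<alpha> :: real
  assumes x: "x \<noteq> 0" and \<alpha>: "0 < \<alpha>" "\<alpha> < 2"
  defines "F \<equiv> \<lambda>z. (1 - (norm x / norm z) powr (real DIM('a) - \<alpha>)) * riesz_kernel \<alpha> x z"
  shows set_integrable_fundamental_solution: "0 < \<epsilon> \<Longrightarrow> set_integrable lborel (- ball x \<epsilon>) F"
    and pv_fundamental_solution:
      "((\<lambda>\<epsilon>. LINT z:- inversion_nbhd x \<epsilon>|lborel. F z) \<longlongrightarrow> 0) (at_right 0)"
proof -
  define \<rho> where "\<rho> = norm x"
  have \<rho>: "0 < \<rho>" using x by (simp add: \<rho>_def)
  define a where "a = real DIM('a) - \<alpha>"
  have Fm [measurable]: "F \<in> borel_measurable borel" unfolding F_def by measurable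
  have K: "set_integrable lborel (- ball x \<epsilon>) (riesz_kernel \<alpha> x)" if "0 < \<epsilon>" for \<epsilon>
    unfolding riesz_kernel_def using set_integrable_kernel[OF \<alpha>(1) that] .
  have gK: "set_integrable lborel (- inversion_nbhd x \<epsilon>) (\<lambda>y. (\<rho> / norm y) powr a * riesz_kernel \<alpha> x y)" if "0 < \<epsilon>" for \<epsilon>
    using set_integrable_kernel_inversion_iff[OF x \<rho> \<alpha>(1), of "\<lambda>_. 1" \<epsilon>] K[OF that] \<rho>
    by (simp add: \<rho>_def a_def inversion_norm_fixed)
  have int: "set_integrable lborel (- ball x \<epsilon>) F" if \<epsilon>: "0 < \<epsilon>" for \<epsilon>
  proof -
    obtain \<delta> where \<delta>: "\<delta> > 0" "inversion_nbhd x \<delta> \<subseteq> ball x \<epsilon>"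
      using inversion_nbhd_subset_ball[OF \<epsilon> x] by blast
    have "set_integrable lborel (- ball x \<epsilon>) (\<lambda>y. (\<rho> / norm y) powr a * riesz_kernel \<alpha> x y)"
      by (rule set_integrable_subset[OF gK[OF \<delta>(1)]]) (use \<delta> in auto)
    then have "set_integrable lborel (- ball x \<epsilon>) (\<lambda>y. riesz_kernel \<alpha> x y - (\<rho> / norm y) powr a * riesz_kernel \<alpha> x y)"
      using K[OF \<epsilon>] by (rule set_integral_diff(1)[rotated])
    then show ?thesis by (simp add: F_def \<rho>_def a_def algebra_simps)
  qed
  then show "0 < \<epsilon> \<Longrightarrow> set_integrable lborel (- ball x \<epsilon>) F" .
  have neg: "(LINT z:- ball x \<epsilon>|lborel. F z) = - (LINT z:- inversion_nbhd x \<epsilon>|lborel. F z)" for \<epsilon>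
  proof -
    let ?f = "\<lambda>z. 1 - (\<rho> / norm z) powr a"
    have "(LINT z:- ball x \<epsilon>|lborel. F z)
      = (LINT y:- inversion_nbhd x \<epsilon>|lborel. (norm x / \<rho>) powr (real DIM('a) + \<alpha>) * ((\<rho> / norm y) powr (real DIM('a) - \<alpha>) * ?f (inversion \<rho> y)) * riesz_kernel \<alpha> x y)"
      using set_integral_kernel_inversion[OF x \<rho> \<alpha>(1), of ?f \<epsilon>] \<rho>
      by (simp add: \<rho>_def a_def inversion_norm_fixed F_def)
    also have "\<dots> = (LINT y|lborel. - (indicator (- inversion_nbhd x \<epsilon>) y *\<^sub>R F y))"
      unfolding set_lebesgue_integral_def
    proof (rule integral_cong_AE)
      show "AE y in lborel. indicator (- inversion_nbhd x \<epsilon>) y *\<^sub>R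
          ((norm x / \<rho>) powr (real DIM('a) + \<alpha>) * ((\<rho> / norm y) powr (real DIM('a) - \<alpha>) * ?f (inversion \<rho> y)) * riesz_kernel \<alpha> x y)
        = - (indicator (- inversion_nbhd x \<epsilon>) y *\<^sub>R F y)"
        using AE_lborel_singleton[of "0::'a"]
      proof eventually_elim
        case (elim y)
        then have y: "0 < norm y" by simp
        have "(\<rho> / norm y) powr a * (\<rho> / norm (inversion \<rho> y)) powr a = 1"
        proof -
          have "(\<rho> / norm y) powr a * (\<rho> / norm (inversion \<rho> y)) powr a = ((\<rho> / norm y) * (\<rho> / norm (inversion \<rho> y))) powr a"
            by (rule powr_mult[symmetric])
          also have "(\<rho> / norm y) * (\<rho> / norm (inversion \<rho> y)) = 1"
            using \<rho> y by (simp add: norm_inversion power2_eq_square)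
          finally show ?thesis by simp
        qed
        then have "(\<rho> / norm y) powr a * ?f (inversion \<rho> y) = - (1 - (\<rho> / norm y) powr a)"
          by (simp add: algebra_simps)
        then show ?case using \<rho> by (simp add: F_def \<rho>_def[symmetric] a_def[symmetric]) (simp add: algebra_simps)
      qed
    qed measurable
    finally show ?thesis by (simp add: set_lebesgue_integral_def)
  qed
  obtain L d where L: "0 \<le> L" "0 < d"
    "\<And>y. norm (y - x) < d \<Longrightarrow> \<bar>1 - (norm x / norm y) powr (real DIM('a) - \<alpha>)\<bar> \<le> L * norm (y - x)"
    using norm_powr_Lipschitz_at[OF x, of "real DIM('a) - \<alpha>"] by blast
  have "((\<lambda>\<epsilon>. (LINT z:- inversion_nbhd x \<epsilon>|lborel. F z) - (LINT z:- ball x \<epsilon>|lborel. F z)) \<longlongrightarrow> 0) (at_right 0)"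
  proof (rule integral_inversion_nbhd_minus_ball[OF \<alpha> x Fm int L(2,1)])
    fix z assume z: "norm (x - z) < d"
    have "\<bar>F z\<bar> = \<bar>1 - (norm x / norm z) powr (real DIM('a) - \<alpha>)\<bar> * riesz_kernel \<alpha> x z"
      by (simp add: F_def abs_mult)
    also have "\<dots> \<le> L * norm (x - z) * riesz_kernel \<alpha> x z"
      using L(3)[of z] z by (intro mult_right_mono) (auto simp: norm_minus_commute)
    finally show "\<bar>F z\<bar> \<le> L * norm (x - z) / norm (x - z) powr (real DIM('a) + \<alpha>)"
      by (simp add: riesz_kernel_def)
  qed
  \<comment> \<open>By \<open>neg\<close> the difference of the two truncations is twice the
    inverted one, so a vanishing difference forces the integral itself to vanish in the
    limit.\<close>
  then have "((\<lambda>\<epsilon>. 2 * (LINT z:- inversion_nbhd x \<epsilon>|lborel. F z)) \<longlongrightarrow> 0) (at_right 0)"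
    by (simp add: neg)
  then have "((\<lambda>\<epsilon>. (1/2) * (2 * (LINT z:- inversion_nbhd x \<epsilon>|lborel. F z))) \<longlongrightarrow> (1/2) * 0) (at_right 0)"
    by (intro tendsto_mult tendsto_const)
  then show "((\<lambda>\<epsilon>. LINT z:- inversion_nbhd x \<epsilon>|lborel. F z) \<longlongrightarrow> 0) (at_right 0)" by simp
qed

text \<open>The Kelvin identity: the operator applied to the Kelvin transform at \<open>x\<close> is
  \<open>(r / norm x) powr (n + \<alpha>)\<close> times the operator applied to \<open>u\<close> at
  the image of \<open>x\<close>. It is stated for the difference with \<open>u\<close> and for
  inverted balls, which are the exact counterparts of the balls in \<open>I2\<close>; only the part
  belonging to \<open>I1\<close> has to change its truncation.\<close>

lemma
  fixes x :: "'a::euclidean_space" and \<alpha> r :: real and u :: "'a \<Rightarrow> real"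
  assumes x: "x \<noteq> 0" and \<alpha>: "0 < \<alpha>" "\<alpha> < 2" and r: "0 < r"
    and u [measurable]: "u \<in> borel_measurable borel" and du: "u differentiable (at x)"
    and I1: "pv_lborel (\<lambda>z. (u x - u z) * riesz_kernel \<alpha> x z) x I1"
    and I2: "pv_lborel (\<lambda>z. (u (inversion r x) - u z) * riesz_kernel \<alpha> (inversion r x) z) (inversion r x) I2"
  defines "w \<equiv> \<lambda>z. u z - kelvin \<alpha> r u z"
  shows set_integrable_kelvin_difference: "\<lbrakk>0 < \<epsilon>; \<epsilon> \<le> norm x / 2\<rbrakk>
      \<Longrightarrow> set_integrable lborel (- inversion_nbhd x \<epsilon>) (\<lambda>z. (w x - w z) * riesz_kernel \<alpha> x z)"
    and pv_kelvin_difference: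
      "((\<lambda>\<epsilon>. LINT z:- inversion_nbhd x \<epsilon>|lborel. (w x - w z) * riesz_kernel \<alpha> x z)
         \<longlongrightarrow> I1 - (r / norm x) powr (real DIM('a) + \<alpha>) * I2) (at_right 0)"
proof -
  define \<rho> where "\<rho> = norm x"
  have \<rho>: "0 < \<rho>" using x by (simp add: \<rho>_def)
  define a where "a = real DIM('a) - \<alpha>"
  define N where "N = real DIM('a) + \<alpha>"
  define K where "K = riesz_kernel \<alpha> x"
  define v where "v = kelvin \<alpha> r u"
  define F1 where "F1 z = (u x - u z) * K z" for z
  define F2 where "F2 z = (\<rho> / r) powr N * ((r / norm z) powr a * (u (inversion r x) - u (inversion r z))) * K z" for z
  define F3 where "F3 z = (1 - (\<rho> / norm z) powr a) * K z" for z
  have F1m [measurable]: "F1 \<in> borel_measurable borel" unfolding F1_def K_def by measurable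
  have i1: "set_integrable lborel (- ball x \<epsilon>) F1" if "0 < \<epsilon>" for \<epsilon>
    using I1 that by (simp add: pv_lborel_def F1_def[abs_def] K_def)
  have i3: "set_integrable lborel (- ball x \<epsilon>) F3" if "0 < \<epsilon>" for \<epsilon>
    using set_integrable_fundamental_solution[OF x \<alpha> that] by (simp add: F3_def[abs_def] K_def a_def \<rho>_def)
  have i2: "set_integrable lborel (- inversion_nbhd x \<epsilon>) F2" if "0 < \<epsilon>" for \<epsilon>
  proof -
    have "0 < r\<^sup>2 / (norm x)\<^sup>2 * \<epsilon>" using r x that by simp
    then have "set_integrable lborel (- ball (inversion r x) (r\<^sup>2 / (norm x)\<^sup>2 * \<epsilon>))
        (\<lambda>z. (u (inversion r x) - u z) * riesz_kernel \<alpha> (inversion r x) z)"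
      using I2 unfolding pv_lborel_def by blast
    then show ?thesis
      using set_integrable_kernel_inversion_iff[OF x r \<alpha>(1), of "\<lambda>z. u (inversion r x) - u z" \<epsilon>]
      by (simp add: F2_def[abs_def] \<rho>_def a_def N_def K_def)
  qed
  have sub: "set_integrable lborel (- inversion_nbhd x \<epsilon>) F"
    if \<epsilon>: "0 < \<epsilon>" "\<epsilon> \<le> norm x / 2" and i: "\<And>\<epsilon>. 0 < \<epsilon> \<Longrightarrow> set_integrable lborel (- ball x \<epsilon>) F" for F :: "'a \<Rightarrow> real" and \<epsilon>
  proof -
    obtain \<delta> where \<delta>: "\<delta> > 0" "ball x \<delta> \<subseteq> inversion_nbhd x \<epsilon>"
      using ball_subset_inversion_nbhd[OF \<epsilon> x] by blast
    show ?thesis by (rule set_integrable_subset[OF i[OF \<delta>(1)]]) (use \<delta> in auto)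
  qed
  define c where "c = (r / \<rho>) powr N"
  \<comment> \<open>Between \<open>x\<close> and \<open>z\<close> both \<open>u\<close> composed
    with the inversion and the Kelvin weight vary. Freezing the weight at \<open>z\<close> gives
    \<open>F2\<close>, and the variation of the weight gives a multiple of the fundamental solution,
    \<open>F3\<close>, whose limit is 0.\<close>
  have split: "(w x - w z) * K z = F1 z - c * F2 z - v x * F3 z" for z
  proof -
    have "c * ((\<rho> / r) powr N * X) = X" for X
    proof -
      have "c * (\<rho> / r) powr N = 1"
        using \<rho> r by (simp add: c_def powr_mult[symmetric])
      then show ?thesis by (simp add: mult.assoc[symmetric])
    qed
    then have "c * F2 z = (r / norm z) powr a * (u (inversion r x) - u (inversion r z)) * K z"
      by (simp add: F2_def mult.assoc)
    also have "(r / norm z) powr a * u (inversion r x) = v x * (\<rho> / norm z) powr a"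
    proof -
      have "(r / norm z) powr a = (r / \<rho> * (\<rho> / norm z)) powr a" using \<rho> by simp
      also have "\<dots> = (r / \<rho>) powr a * (\<rho> / norm z) powr a" by (rule powr_mult)
      finally show ?thesis by (simp add: v_def kelvin_def a_def \<rho>_def)
    qed
    then have "(r / norm z) powr a * (u (inversion r x) - u (inversion r z)) = v x * (\<rho> / norm z) powr a - v z"
      by (simp add: v_def kelvin_def a_def right_diff_distrib)
    finally show ?thesis by (simp add: w_def v_def[symmetric] F1_def F3_def algebra_simps)
  qed
  have all: "set_integrable lborel (- inversion_nbhd x \<epsilon>) F1"
     "set_integrable lborel (- inversion_nbhd x \<epsilon>) (\<lambda>z. c * F2 z)"
     "set_integrable lborel (- inversion_nbhd x \<epsilon>) (\<lambda>z. v x * F3 z)"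
    if "0 < \<epsilon>" "\<epsilon> \<le> norm x / 2" for \<epsilon>
    using sub[OF that i1] sub[OF that i3] i2[OF that(1)] by (auto intro!: set_integrable_mult_right)
  show "set_integrable lborel (- inversion_nbhd x \<epsilon>) (\<lambda>z. (w x - w z) * riesz_kernel \<alpha> x z)"
    if "0 < \<epsilon>" "\<epsilon> \<le> norm x / 2"
    unfolding K_def[symmetric] split by (intro set_integral_diff(1) all that)
  have eq: "(LINT z:- inversion_nbhd x \<epsilon>|lborel. (w x - w z) * K z)
    = (LINT z:- inversion_nbhd x \<epsilon>|lborel. F1 z) - c * (LINT z:- inversion_nbhd x \<epsilon>|lborel. F2 z)
      - v x * (LINT z:- inversion_nbhd x \<epsilon>|lborel. F3 z)" if "0 < \<epsilon>" "\<epsilon> \<le> norm x / 2" for \<epsilon>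
    unfolding split using all[OF that] by (simp add: set_integral_diff set_integral_mult_right)
  obtain L d where L: "0 \<le> L" "0 < d" "\<And>y. norm (y - x) < d \<Longrightarrow> norm (u y - u x) \<le> L * norm (y - x)"
    using differentiable_imp_locally_Lipschitz_at[OF du] by blast
  have "((\<lambda>\<epsilon>. (LINT z:- inversion_nbhd x \<epsilon>|lborel. F1 z) - (LINT z:- ball x \<epsilon>|lborel. F1 z)) \<longlongrightarrow> 0) (at_right 0)"
  proof (rule integral_inversion_nbhd_minus_ball[OF \<alpha> x F1m i1 L(2,1)])
    fix z assume z: "norm (x - z) < d"
    have "\<bar>F1 z\<bar> = \<bar>u x - u z\<bar> * riesz_kernel \<alpha> x z"
      by (simp add: F1_def K_def abs_mult)
    also have "\<dots> \<le> L * norm (x - z) * riesz_kernel \<alpha> x z"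
      using L(3)[of z] z by (intro mult_right_mono) (auto simp: norm_minus_commute abs_minus_commute)
    finally show "\<bar>F1 z\<bar> \<le> L * norm (x - z) / norm (x - z) powr (real DIM('a) + \<alpha>)"
      by (simp add: riesz_kernel_def)
  qed
  moreover have "((\<lambda>\<epsilon>. LINT z:- ball x \<epsilon>|lborel. F1 z) \<longlongrightarrow> I1) (at_right 0)"
    using I1 by (simp add: pv_lborel_def F1_def[abs_def] K_def)
  ultimately have t1: "((\<lambda>\<epsilon>. LINT z:- inversion_nbhd x \<epsilon>|lborel. F1 z) \<longlongrightarrow> I1) (at_right 0)"
    using tendsto_add by fastforce
  have t2: "((\<lambda>\<epsilon>. LINT z:- inversion_nbhd x \<epsilon>|lborel. F2 z) \<longlongrightarrow> I2) (at_right 0)"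
  proof -
    define s where "s = r\<^sup>2 / (norm x)\<^sup>2"
    have s: "0 < s" using r x by (simp add: s_def)
    have "filterlim (\<lambda>\<epsilon>. s * \<epsilon>) (at_right 0) (at_right 0)"
      unfolding filterlim_at
    proof
      show "((\<lambda>\<epsilon>. s * \<epsilon>) \<longlongrightarrow> 0) (at_right 0)"
        using tendsto_mult[OF tendsto_const[of s] tendsto_ident_at[of "0::real" "{0<..}"]] by simp
      show "\<forall>\<^sub>F \<epsilon> in at_right 0. s * \<epsilon> \<in> {0<..} \<and> s * \<epsilon> \<noteq> 0"
        using eventually_at_right_less[of "0::real"] by eventually_elim (use s in simp)
    qed
    moreover have "((\<lambda>\<epsilon>. LINT z:- ball (inversion r x) \<epsilon>|lborel. (u (inversion r x) - u z) * riesz_kernel \<alpha> (inversion r x) z) \<longlongrightarrow> I2) (at_right 0)"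
      using I2 by (simp add: pv_lborel_def)
    ultimately have "((\<lambda>\<epsilon>. LINT z:- ball (inversion r x) (s * \<epsilon>)|lborel. (u (inversion r x) - u z) * riesz_kernel \<alpha> (inversion r x) z) \<longlongrightarrow> I2) (at_right 0)"
      by (rule filterlim_compose[rotated])
    then show ?thesis
      using set_integral_kernel_inversion[OF x r \<alpha>(1), of "\<lambda>z. u (inversion r x) - u z"]
      by (simp add: F2_def[abs_def] \<rho>_def a_def N_def K_def s_def)
  qed
  have t3: "((\<lambda>\<epsilon>. LINT z:- inversion_nbhd x \<epsilon>|lborel. F3 z) \<longlongrightarrow> 0) (at_right 0)"
    using pv_fundamental_solution[OF x \<alpha>] by (simp add: F3_def[abs_def] K_def a_def \<rho>_def)
  have "((\<lambda>\<epsilon>. (LINT z:- inversion_nbhd x \<epsilon>|lborel. F1 z) - c * (LINT z:- inversion_nbhd x \<epsilon>|lborel. F2 z)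
      - v x * (LINT z:- inversion_nbhd x \<epsilon>|lborel. F3 z)) \<longlongrightarrow> I1 - c * I2 - v x * 0) (at_right 0)"
    by (intro tendsto_intros t1 t2 t3)
  moreover have "\<forall>\<^sub>F \<epsilon> in at_right 0. (LINT z:- inversion_nbhd x \<epsilon>|lborel. F1 z) - c * (LINT z:- inversion_nbhd x \<epsilon>|lborel. F2 z)
      - v x * (LINT z:- inversion_nbhd x \<epsilon>|lborel. F3 z) = (LINT z:- inversion_nbhd x \<epsilon>|lborel. (w x - w z) * K z)"
    unfolding eventually_at_right_field using eq \<rho> by (intro exI[of _ "norm x / 2"]) (auto simp: \<rho>_def)
  ultimately have "((\<lambda>\<epsilon>. LINT z:- inversion_nbhd x \<epsilon>|lborel. (w x - w z) * K z) \<longlongrightarrow> I1 - c * I2 - v x * 0) (at_right 0)"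
    by (rule Lim_transform_eventually)
  then show "((\<lambda>\<epsilon>. LINT z:- inversion_nbhd x \<epsilon>|lborel. (w x - w z) * riesz_kernel \<alpha> x z)
         \<longlongrightarrow> I1 - (r / norm x) powr (real DIM('a) + \<alpha>) * I2) (at_right 0)"
    by (simp add: K_def c_def \<rho>_def N_def)
qed

subsection \<open>Reflection at a sphere\<close>

definition kelvin_gap :: "real \<Rightarrow> real \<Rightarrow> ('a::euclidean_space \<Rightarrow> real) \<Rightarrow> 'a \<Rightarrow> real" where
  "kelvin_gap \<alpha> r u z = u z - kelvin \<alpha> r u z"

text \<open>The kernel at the reflected point, with the weight that remains when the Jacobian, of
  exponent 2 n, has given n - \<alpha> to the Kelvin transform
  (\<open>riesz_kernel_inversion_jacobian\<close>).\<close>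

definition reflected_kernel :: "real \<Rightarrow> real \<Rightarrow> 'a::euclidean_space \<Rightarrow> 'a \<Rightarrow> real" where
  "reflected_kernel \<alpha> r x z = (r / norm z) powr (real DIM('a) + \<alpha>) * riesz_kernel \<alpha> x (inversion r z)"

lemma borel_measurable_kelvin_gap [measurable]:
  "u \<in> borel_measurable borel \<Longrightarrow> kelvin_gap \<alpha> r u \<in> borel_measurable borel"
  unfolding kelvin_gap_def[abs_def] by (intro borel_measurable_diff borel_measurable_kelvin)

lemma borel_measurable_reflected_kernel [measurable]: "reflected_kernel \<alpha> r x \<in> borel_measurable borel"
  unfolding reflected_kernel_def[abs_def] by measurable

lemma reflected_kernel_nonneg [simp]: "0 \<le> reflected_kernel \<alpha> r x z"
  by (simp add: reflected_kernel_def)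

lemma continuous_on_inversion: "continuous_on (- {0}) (inversion r)"
  unfolding inversion_def[abs_def] by (intro continuous_intros) auto

lemma continuous_on_kelvin:
  assumes "continuous_on UNIV u" "0 < r"
  shows "continuous_on (- {0}) (kelvin \<alpha> r u)"
  unfolding kelvin_def[abs_def]
  using assms by (intro continuous_intros continuous_on_compose2[OF assms(1) continuous_on_inversion]) auto

text \<open>The Kelvin transform is an involution, hence the difference with it is odd.\<close>

lemma kelvin_gap_inversion:
  fixes z :: "'a::euclidean_space"
  assumes "z \<noteq> 0" "0 < r"
  shows "kelvin_gap \<alpha> r u (inversion r z) = - ((norm z / r) powr (real DIM('a) - \<alpha>) * kelvin_gap \<alpha> r u z)"
proof -
  define a where "a = real DIM('a) - \<alpha>"
  have pos: "0 < norm z" using assms by simp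
  have "(norm z / r) powr a * (r / norm z) powr a = 1"
    using pos assms by (simp add: powr_mult[symmetric])
  then have "(norm z / r) powr a * kelvin \<alpha> r u z = u (inversion r z)"
    by (simp add: kelvin_def a_def mult.assoc[symmetric])
  moreover have "kelvin \<alpha> r u (inversion r z) = (norm z / r) powr a * u z"
    using assms by (simp add: kelvin_def a_def norm_inversion power2_eq_square)
  ultimately show ?thesis by (simp add: kelvin_gap_def a_def algebra_simps)
qed

text \<open>Moves the inversion from the integration variable to the fixed point \<open>x\<close>;
  both the comparison with the Riesz kernel and the lower bound near the sphere start from this
  form.\<close>

lemma reflected_kernel_eq:
  fixes x z :: "'a::euclidean_space"
  assumes "x \<noteq> 0" "z \<noteq> 0" "0 < r"
  shows "reflected_kernel \<alpha> r x z = (r / (norm x * norm (inversion r x - z))) powr (real DIM('a) + \<alpha>)"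
proof -
  define N where "N = real DIM('a) + \<alpha>"
  have pos: "0 < norm z" "0 < norm x" using assms by auto
  have "norm (x - inversion r z) = norm (inversion r (inversion r x) - inversion r z)" using assms by simp
  also have "\<dots> = norm x * norm (inversion r x - z) / norm z"
    using assms by (subst norm_inversion_diff) (auto simp: norm_inversion)
  finally have eq: "norm (x - inversion r z) = norm x * norm (inversion r x - z) / norm z" .
  have "reflected_kernel \<alpha> r x z = (r / norm z) powr N * (1 / norm (x - inversion r z)) powr N"
    by (simp add: reflected_kernel_def riesz_kernel_def N_def powr_divide)
  also have "\<dots> = (r / norm z * (1 / norm (x - inversion r z))) powr N" by (rule powr_mult[symmetric])
  also have "r / norm z * (1 / norm (x - inversion r z)) = r / (norm x * norm (inversion r x - z))"
    using pos by (simp add: eq)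
  finally show ?thesis by (simp add: N_def)
qed

text \<open>With x' the image of \<open>x\<close>, the identity |x|^2 |x' - z|^2 - r^2 |x - z|^2 =
  (|x|^2 - r^2)(|z|^2 - r^2) has a positive right-hand side outside the sphere.\<close>

lemma reflected_kernel_less:
  fixes x z :: "'a::euclidean_space"
  assumes r: "0 < r" "r < norm x" "r < norm z" and "x \<noteq> z" and \<alpha>: "0 < \<alpha>"
  shows "reflected_kernel \<alpha> r x z < riesz_kernel \<alpha> x z"
proof -
  have pos: "0 < norm x" "0 < norm z" using r by auto
  have "(norm x * norm (inversion r x - z))\<^sup>2 = (norm x)\<^sup>2 * (norm (inversion r x - z))\<^sup>2"
    by (simp add: power_mult_distrib)
  also have "(norm (inversion r x - z))\<^sup>2 = (norm (inversion r x))\<^sup>2 - 2 * (inversion r x \<bullet> z) + (norm z)\<^sup>2"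
    by (simp add: power2_norm_eq_inner algebra_simps inner_commute)
  also have "(norm (inversion r x))\<^sup>2 = (r\<^sup>2)\<^sup>2 / (norm x)\<^sup>2" by (simp add: norm_inversion power_divide)
  also have "inversion r x \<bullet> z = r\<^sup>2 / (norm x)\<^sup>2 * (x \<bullet> z)" by (simp add: inversion_def)
  also have "(norm x)\<^sup>2 * ((r\<^sup>2)\<^sup>2 / (norm x)\<^sup>2 - 2 * (r\<^sup>2 / (norm x)\<^sup>2 * (x \<bullet> z)) + (norm z)\<^sup>2)
    = (r\<^sup>2)\<^sup>2 - 2 * r\<^sup>2 * (x \<bullet> z) + (norm x)\<^sup>2 * (norm z)\<^sup>2"
    using pos by (simp add: field_simps)
  finally have 1: "(norm x * norm (inversion r x - z))\<^sup>2 = (r\<^sup>2)\<^sup>2 - 2 * r\<^sup>2 * (x \<bullet> z) + (norm x)\<^sup>2 * (norm z)\<^sup>2" .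
  have "(r * norm (x - z))\<^sup>2 = r\<^sup>2 * ((norm x)\<^sup>2 - 2 * (x \<bullet> z) + (norm z)\<^sup>2)"
    by (simp add: power_mult_distrib power2_norm_eq_inner algebra_simps inner_commute)
  then have "(norm x * norm (inversion r x - z))\<^sup>2 - (r * norm (x - z))\<^sup>2 = ((norm x)\<^sup>2 - r\<^sup>2) * ((norm z)\<^sup>2 - r\<^sup>2)"
    unfolding 1 by (simp add: algebra_simps power2_eq_square)
  moreover have "r\<^sup>2 < (norm x)\<^sup>2" "r\<^sup>2 < (norm z)\<^sup>2" using r by (auto intro: power_strict_mono)
  ultimately have "(r * norm (x - z))\<^sup>2 < (norm x * norm (inversion r x - z))\<^sup>2"
    by (smt (verit) mult_pos_pos)
  then have lt: "r * norm (x - z) < norm x * norm (inversion r x - z)"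
    by (rule power2_less_imp_less) simp
  have D: "0 < norm (x - z)" using \<open>x \<noteq> z\<close> by simp
  have "0 < r * norm (x - z)" using D r by simp
  then have "r / (norm x * norm (inversion r x - z)) < r / (r * norm (x - z))"
    using lt r by (intro divide_strict_left_mono mult_pos_pos) auto
  also have "\<dots> = 1 / norm (x - z)" using r by simp
  finally have "(r / (norm x * norm (inversion r x - z))) powr (real DIM('a) + \<alpha>) < (1 / norm (x - z)) powr (real DIM('a) + \<alpha>)"
    using r \<alpha> by (intro powr_less_mono2) (auto simp: add_pos_pos)
  then show ?thesis
    using pos r by (subst reflected_kernel_eq) (auto simp: riesz_kernel_def powr_divide)
qed

lemma riesz_kernel_inversion_jacobian:
  fixes x z :: "'a::euclidean_space"
  assumes "z \<noteq> 0" "0 < r"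
  shows "riesz_kernel \<alpha> x (inversion r z) * (r / norm z) ^ (2 * DIM('a))
    = (r / norm z) powr (real DIM('a) - \<alpha>) * reflected_kernel \<alpha> r x z"
proof -
  have "(r / norm z) ^ (2 * DIM('a)) = (r / norm z) powr ((real DIM('a) - \<alpha>) + (real DIM('a) + \<alpha>))"
    using assms by (simp add: powr_realpow[symmetric])
  also have "\<dots> = (r / norm z) powr (real DIM('a) - \<alpha>) * (r / norm z) powr (real DIM('a) + \<alpha>)"
    by (rule powr_add)
  finally show ?thesis by (simp add: reflected_kernel_def)
qed

text \<open>A nonpositive minimum of the difference outside the sphere. The equation enters only
  through \<open>D\<close>, the limit of the truncated integrals: upper bounds on \<open>D\<close>
  are proved here, lower bounds come from the equation later.\<close>

locale kelvin_minimum =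
  fixes \<alpha> r D :: real and u :: "'a::euclidean_space \<Rightarrow> real" and x :: 'a
  assumes \<alpha>: "0 < \<alpha>" "\<alpha> < 2" "\<alpha> < real DIM('a)" and r: "0 < r" "r < norm x"
    and u: "continuous_on UNIV u"
    and gap_integrable: "\<And>\<epsilon>. 0 < \<epsilon> \<Longrightarrow> \<epsilon> \<le> norm x / 2 \<Longrightarrow> set_integrable lborel (- inversion_nbhd x \<epsilon>)
        (\<lambda>z. (kelvin_gap \<alpha> r u x - kelvin_gap \<alpha> r u z) * riesz_kernel \<alpha> x z)"
    and gap_limit: "((\<lambda>\<epsilon>. LINT z:- inversion_nbhd x \<epsilon>|lborel.
        (kelvin_gap \<alpha> r u x - kelvin_gap \<alpha> r u z) * riesz_kernel \<alpha> x z) \<longlongrightarrow> D) (at_right 0)"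
    and gap_le: "\<And>z. r < norm z \<Longrightarrow> kelvin_gap \<alpha> r u x \<le> kelvin_gap \<alpha> r u z"
    and gap_nonpos: "kelvin_gap \<alpha> r u x \<le> 0"
begin

abbreviation "w \<equiv> kelvin_gap \<alpha> r u"
abbreviation "K \<equiv> riesz_kernel \<alpha> x"
abbreviation "K' \<equiv> reflected_kernel \<alpha> r x"

text \<open>
  The inversion carries the integral over the ball to the exterior, where \<open>w\<close> changes sign. In the
  resulting integrand both summands are nonpositive at a nonpositive minimum, since \<open>K' < K\<close>.
\<close>

definition folded :: "'a \<Rightarrow> real" where
  "folded z = (w x - w z) * (K z - K' z) + w x * K' z * (1 + (r / norm z) powr (real DIM('a) - \<alpha>))"

text \<open>What the integrand over the ball becomes under the inversion; see
  \<open>inner_integral\<close>.\<close>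

definition inner_part :: "'a \<Rightarrow> real" where
  "inner_part z = (w x * (r / norm z) powr (real DIM('a) - \<alpha>) + w z) * K' z"

lemma u_borel [measurable]: "u \<in> borel_measurable borel"
  using u by (rule borel_measurable_continuous_onI)

lemma folded_borel [measurable]: "folded \<in> borel_measurable borel"
  unfolding folded_def[abs_def] by measurable

lemma inner_part_borel [measurable]: "inner_part \<in> borel_measurable borel"
  unfolding inner_part_def[abs_def] by measurable

lemma folded_eq: "folded z = (w x - w z) * K z + inner_part z"
  by (simp add: folded_def inner_part_def algebra_simps)

lemma reflected_kernel_le: "r < norm z \<Longrightarrow> x \<noteq> z \<Longrightarrow> K' z \<le> K z"
  using reflected_kernel_less[of r x z \<alpha>] r \<alpha> by simp

lemma folded_le:
  assumes "r < norm z" "x \<noteq> z"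
  shows "folded z \<le> w x * K' z" "folded z \<le> 0"
proof -
  have "(w x - w z) * (K z - K' z) \<le> 0"
    using gap_le[OF assms(1)] reflected_kernel_le[OF assms] by (intro mult_nonpos_nonneg) auto
  moreover have le: "w x * K' z \<le> 0" using gap_nonpos by (intro mult_nonpos_nonneg) auto
  moreover have "w x * K' z * (r / norm z) powr (real DIM('a) - \<alpha>) \<le> 0"
    using le by (rule mult_nonpos_nonneg) simp
  ultimately show "folded z \<le> w x * K' z" "folded z \<le> 0"
    by (simp_all add: folded_def distrib_left)
qed

text \<open>Where the difference vanishes, the first two occurrences of \<open>K'\<close> cancel and
  the remaining one has a nonpositive coefficient. This gives the full kernel \<open>K\<close>,
  stronger than the \<open>K'\<close> of \<open>folded_le\<close>.\<close>

lemma folded_le_kernel: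
  assumes "r < norm z" "x \<noteq> z" "w z = 0"
  shows "folded z \<le> w x * K z"
proof -
  have le: "w x * K' z \<le> 0" using gap_nonpos by (intro mult_nonpos_nonneg) auto
  then have "w x * K' z * (r / norm z) powr (real DIM('a) - \<alpha>) \<le> 0"
    by (rule mult_nonpos_nonneg) simp
  then show ?thesis using assms by (simp add: folded_def algebra_simps)
qed

text \<open>The folding itself. Since \<open>x\<close> lies outside the ball, some truncation leaves
  the whole ball untouched, which gives integrability there; oddness of the difference and the
  Jacobian formula then produce \<open>inner_part\<close>.\<close>

lemma inner_integral:
  defines "f \<equiv> \<lambda>z. (w x - w z) * K z"
  shows "set_integrable lborel {z. r < norm z} inner_part"
    and "(LINT z:{z. norm z \<le> r}|lborel. f z) = (LINT z:{z. r < norm z}|lborel. inner_part z)"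
    and "set_integrable lborel {z. norm z \<le> r} f"
proof -
  have fm [measurable]: "f \<in> borel_measurable borel" unfolding f_def by measurable
  define h where "h z = indicator {z. norm z \<le> r} z * f z" for z
  have hm [measurable]: "h \<in> borel_measurable borel" unfolding h_def[abs_def] by measurable
  have x0: "x \<noteq> 0" using r by auto
  obtain \<delta> where \<delta>: "\<delta> > 0" "inversion_nbhd x \<delta> \<subseteq> ball x (norm x - r)"
    using inversion_nbhd_subset_ball[of "norm x - r" x] r x0 by auto
  define \<epsilon> where "\<epsilon> = min \<delta> (norm x / 2)"
  have \<epsilon>: "0 < \<epsilon>" "\<epsilon> \<le> norm x / 2" "\<epsilon> \<le> \<delta>" using \<delta> r by (auto simp: \<epsilon>_def)
  have "inversion_nbhd x \<epsilon> \<subseteq> inversion_nbhd x \<delta>"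
    using mult_right_mono[OF \<epsilon>(3) norm_ge_zero] by (auto simp: inversion_nbhd_def intro: less_le_trans)
  then have sub: "{z. norm z \<le> r} \<subseteq> - inversion_nbhd x \<epsilon>"
  proof -
    have "z \<notin> ball x (norm x - r)" if "norm z \<le> r" for z
      using that norm_triangle_ineq2[of x z] by (simp add: dist_norm)
    then show ?thesis using \<delta>(2) \<open>inversion_nbhd x \<epsilon> \<subseteq> inversion_nbhd x \<delta>\<close> by blast
  qed
  show fi: "set_integrable lborel {z. norm z \<le> r} f"
    by (rule set_integrable_subset[OF gap_integrable[OF \<epsilon>(1,2), folded f_def] _ sub]) measurable
  then have hi: "integrable lborel h" by (simp add: set_integrable_def h_def[abs_def])
  have ae: "AE z in lborel. h (inversion r z) * (r / norm z) ^ (2 * DIM('a)) = indicator {z. r < norm z} z *\<^sub>R inner_part z"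
  proof -
    \<comment> \<open>The sphere is mapped to itself, so it belongs to the closed ball but not to
      the open exterior; it has to be discarded as a null set.\<close>
    have "sphere (0::'a) r \<in> null_sets lborel"
      using negligible_sphere[of "0::'a" r] by (simp add: negligible_iff_null_sets null_sets_completion_iff)
    then have "AE z in lborel. z \<notin> sphere (0::'a) r" by (rule AE_not_in)
    then show ?thesis
      using AE_lborel_singleton[of "0::'a"]
    proof eventually_elim
      case (elim z)
      then have z: "z \<noteq> 0" "norm z \<noteq> r" by auto
      have iff: "norm (inversion r z) \<le> r \<longleftrightarrow> r < norm z"
        using z r by (auto simp: norm_inversion power2_eq_square pos_divide_le_eq)
      have "f (inversion r z) * (r / norm z) ^ (2 * DIM('a)) = inner_part z"
      proof -
        have "(norm z / r) powr (real DIM('a) - \<alpha>) * (r / norm z) powr (real DIM('a) - \<alpha>) = 1"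
          using z r by (simp add: powr_mult[symmetric])
        then have "(w x - w (inversion r z)) * (r / norm z) powr (real DIM('a) - \<alpha>)
          = w x * (r / norm z) powr (real DIM('a) - \<alpha>) + w z"
          using z r by (simp add: kelvin_gap_inversion algebra_simps)
        then show ?thesis
          using riesz_kernel_inversion_jacobian[of z r \<alpha> x] z r
          by (simp add: f_def inner_part_def mult.assoc[symmetric]) (simp add: mult.assoc)
      qed
      then show ?case using iff by (simp add: h_def indicator_def)
    qed
  qed
  have "integrable lborel (\<lambda>z. h (inversion r z) * (r / norm z) ^ (2 * DIM('a)))"
    using integrable_inversion_iff[OF r(1) hm] hi by simp
  then show "set_integrable lborel {z. r < norm z} inner_part"
    unfolding set_integrable_def using ae by (subst (asm) integrable_cong_AE[OF _ _ ae]) measurable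
  have "(LINT z|lborel. h z) = (LINT z|lborel. h (inversion r z) * (r / norm z) ^ (2 * DIM('a)))"
    using integral_inversion[OF r(1) hm] by simp
  also have "\<dots> = (LINT z|lborel. indicator {z. r < norm z} z *\<^sub>R inner_part z)"
    using ae by (intro integral_cong_AE) measurable
  finally show "(LINT z:{z. norm z \<le> r}|lborel. f z) = (LINT z:{z. r < norm z}|lborel. inner_part z)"
    by (simp add: set_lebesgue_integral_def h_def[abs_def])
qed

lemma gap_locally_bounded:
  obtains d where "0 < d" "\<And>z. z \<in> ball x d \<Longrightarrow> \<bar>w z\<bar> \<le> \<bar>w x\<bar> + 1"
proof -
  have x0: "x \<noteq> 0" using r by auto
  have "continuous_on (- {0}) w"
    unfolding kelvin_gap_def[abs_def]
    using u r by (intro continuous_intros continuous_on_kelvin) (auto intro: continuous_on_subset)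
  then have "isCont w x" using x0 continuous_on_eq_continuous_at[of "- {0}" w] by auto
  then obtain d where "0 < d" "\<And>z. dist z x < d \<Longrightarrow> dist (w z) (w x) < 1"
    unfolding continuous_at_eps_delta by (metis zero_less_one)
  then show ?thesis
    by (intro that[of d]) (auto simp: dist_real_def dist_commute, force)
qed

text \<open>A truncated integral equals the integral of \<open>folded\<close> off the removed
  neighbourhood of \<open>x\<close> plus that of \<open>inner_part\<close> over it. The latter
  vanishes in the limit as \<open>inner_part\<close> is bounded near \<open>x\<close>. Dropping the
  nonpositive \<open>folded\<close> on the rest of \<open>ball x \<delta>\<close> gives an
  inequality that asks for no integrability of \<open>folded\<close> up to \<open>x\<close>.\<close>

lemma limit_le_folded:
  assumes \<delta>: "0 < \<delta>" "\<delta> \<le> norm x - r"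
  shows "set_integrable lborel ({z. r < norm z} - ball x \<delta>) folded"
    and "D \<le> (LINT z:{z. r < norm z} - ball x \<delta>|lborel. folded z)"
proof -
  define E where "E = {z::'a. r < norm z}"
  have Em [measurable]: "E \<in> sets borel" unfolding E_def by measurable
  define f where "f z = (w x - w z) * K z" for z
  have fm [measurable]: "f \<in> borel_measurable borel" unfolding f_def[abs_def] by measurable
  define N where "N = real DIM('a) + \<alpha>"
  have N: "0 < N" using \<alpha> by (simp add: N_def add_nonneg_pos)
  obtain d where d: "0 < d" "\<And>z. z \<in> ball x d \<Longrightarrow> \<bar>w z\<bar> \<le> \<bar>w x\<bar> + 1"
    using gap_locally_bounded by blast
  \<comment> \<open>Near \<open>x\<close> the bracket of \<open>inner_part\<close> is at most |w x|
    + (|w x| + 1). The reflected kernel stays bounded because \<open>z\<close> is reflected into the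
    ball of radius \<open>r\<close>, at distance at least \<open>norm x - r\<close> from
    \<open>x\<close>.\<close>
  define M where "M = (\<bar>w x\<bar> + (\<bar>w x\<bar> + 1)) * (1 / (norm x - r) powr N)"
  have M0: "0 \<le> M" by (simp add: M_def)
  have ball_E: "ball x \<delta> \<subseteq> E"
  proof
    fix z assume "z \<in> ball x \<delta>"
    then show "z \<in> E" using \<delta> norm_triangle_ineq2[of x z] by (simp add: E_def dist_norm)
  qed
  have inner_bound: "\<bar>inner_part z\<bar> \<le> M" if z: "z \<in> E" "z \<in> ball x d" for z
  proof -
    have zr: "r < norm z" using z by (simp add: E_def)
    have q: "r / norm z \<le> 1" "0 \<le> r / norm z" using zr r by (auto simp: divide_le_eq_1)
    have "norm (inversion r z) = r * (r / norm z)" by (simp add: norm_inversion power2_eq_square)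
    also have "\<dots> \<le> r * 1" using q r by (intro mult_left_mono) auto
    finally have "norm (inversion r z) \<le> r" by simp
    then have ge: "norm x - r \<le> norm (x - inversion r z)" using norm_triangle_ineq2[of x "inversion r z"] by simp
    have pw: "(r / norm z) powr b \<le> 1" if "0 \<le> b" for b using q that by (simp add: powr_le1)
    have "K' z \<le> 1 * (1 / (norm x - r) powr N)"
      unfolding reflected_kernel_def riesz_kernel_def N_def[symmetric]
      using pw[of N] N ge r by (intro mult_mono divide_left_mono powr_mono2 mult_pos_pos) auto
    then have K': "\<bar>K' z\<bar> \<le> 1 / (norm x - r) powr N" by simp
    have "\<bar>w x * (r / norm z) powr (real DIM('a) - \<alpha>) + w z\<bar>
        \<le> \<bar>w x * (r / norm z) powr (real DIM('a) - \<alpha>)\<bar> + \<bar>w z\<bar>"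
      by (rule abs_triangle_ineq)
    also have "\<bar>w x * (r / norm z) powr (real DIM('a) - \<alpha>)\<bar> \<le> \<bar>w x\<bar> * 1"
      unfolding abs_mult using pw[of "real DIM('a) - \<alpha>"] \<alpha> by (intro mult_left_mono) auto
    finally have "\<bar>w x * (r / norm z) powr (real DIM('a) - \<alpha>) + w z\<bar> \<le> \<bar>w x\<bar> + (\<bar>w x\<bar> + 1)"
      using d(2)[OF z(2)] by simp
    then show ?thesis
      unfolding inner_part_def abs_mult M_def using K' by (intro mult_mono) auto
  qed
  have T_sub: "inversion_nbhd x \<epsilon> \<subseteq> ball x (2 * \<epsilon>)" if "0 < \<epsilon>" "\<epsilon> \<le> norm x / 2" for \<epsilon>
  proof -
    have "\<epsilon> * norm x \<le> \<epsilon> * (2 * (norm x - \<epsilon>))" using that by (intro mult_left_mono) auto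
    then have "norm x * \<epsilon> / (norm x - \<epsilon>) \<le> 2 * \<epsilon>"
      using that r by (simp add: pos_divide_le_eq algebra_simps)
    then show ?thesis using inversion_nbhd_bounds(1)[OF that] subset_ball by blast
  qed
  have inner_E: "set_integrable lborel E inner_part" using inner_integral(1) by (simp add: E_def)
  define \<epsilon>0 where "\<epsilon>0 = min (norm x / 2) (min (\<delta> / 2) (d / 2))"
  have \<epsilon>0: "0 < \<epsilon>0" using d \<delta> r by (auto simp: \<epsilon>0_def)
  have folded_T: "set_integrable lborel (E - inversion_nbhd x \<epsilon>) folded"
    and f_T: "set_integrable lborel (E - inversion_nbhd x \<epsilon>) f"
    and inner_T: "set_integrable lborel (E - inversion_nbhd x \<epsilon>) inner_part"
    and inner_T': "set_integrable lborel (inversion_nbhd x \<epsilon>) inner_part"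
    and T_delta: "inversion_nbhd x \<epsilon> \<subseteq> ball x \<delta>" and T_d: "inversion_nbhd x \<epsilon> \<subseteq> ball x d"
    if \<epsilon>: "0 < \<epsilon>" "\<epsilon> \<le> \<epsilon>0" for \<epsilon>
  proof -
    have \<epsilon>': "\<epsilon> \<le> norm x / 2" "2 * \<epsilon> \<le> \<delta>" "2 * \<epsilon> \<le> d" using \<epsilon> by (auto simp: \<epsilon>0_def)
    show T1: "inversion_nbhd x \<epsilon> \<subseteq> ball x \<delta>" "inversion_nbhd x \<epsilon> \<subseteq> ball x d"
      using T_sub[OF \<epsilon>(1) \<epsilon>'(1)] subset_ball[OF \<epsilon>'(2), of x] subset_ball[OF \<epsilon>'(3), of x] by auto
    show "set_integrable lborel (E - inversion_nbhd x \<epsilon>) f"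
      by (rule set_integrable_subset[OF gap_integrable[OF \<epsilon>(1) \<epsilon>'(1), folded f_def]]) auto
    moreover show "set_integrable lborel (E - inversion_nbhd x \<epsilon>) inner_part"
      by (rule set_integrable_subset[OF inner_E]) auto
    ultimately have "set_integrable lborel (E - inversion_nbhd x \<epsilon>) (\<lambda>z. f z + inner_part z)"
      by (rule set_integral_add(1))
    then show "set_integrable lborel (E - inversion_nbhd x \<epsilon>) folded"
      by (simp add: folded_eq[abs_def] f_def)
    show "set_integrable lborel (inversion_nbhd x \<epsilon>) inner_part"
      by (rule set_integrable_subset[OF inner_E]) (use T1 ball_E in auto)
  qed
  have folded_E: "set_integrable lborel (E - ball x \<delta>) folded"
    by (rule set_integrable_subset[OF folded_T[OF \<epsilon>0 order_refl]]) (use T_delta[OF \<epsilon>0 order_refl] in auto)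
  then show "set_integrable lborel ({z. r < norm z} - ball x \<delta>) folded" by (simp add: E_def)
  define V where "V = unit_ball_vol (real DIM('a))"
  have V: "0 \<le> V" by (simp add: V_def)
  have bound: "(LINT z:- inversion_nbhd x \<epsilon>|lborel. f z)
      \<le> (LINT z:E - ball x \<delta>|lborel. folded z) + M * (V * (2 * \<epsilon>) ^ DIM('a))"
    if \<epsilon>: "0 < \<epsilon>" "\<epsilon> \<le> \<epsilon>0" for \<epsilon>
  proof -
    let ?T = "inversion_nbhd x \<epsilon>"
    have \<epsilon>': "\<epsilon> \<le> norm x / 2" using \<epsilon> by (auto simp: \<epsilon>0_def)
    have TE: "?T \<subseteq> E" using T_delta[OF \<epsilon>] ball_E by auto
    have "- ?T = (E - ?T) \<union> {z. norm z \<le> r}" using TE by (auto simp: E_def)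
    then have "(LINT z:- ?T|lborel. f z) = (LINT z:E - ?T|lborel. f z) + (LINT z:{z. norm z \<le> r}|lborel. f z)"
      using f_T[OF \<epsilon>] inner_integral(3) by (simp only:) (subst set_integral_Un, auto simp: E_def f_def[abs_def])
    also have "(LINT z:{z. norm z \<le> r}|lborel. f z) = (LINT z:E|lborel. inner_part z)"
      using inner_integral(2) by (simp add: E_def f_def)
    also have "E = (E - ?T) \<union> ?T" using TE by auto
    then have "(LINT z:E|lborel. inner_part z) = (LINT z:(E - ?T) \<union> ?T|lborel. inner_part z)" by simp
    also have "\<dots> = (LINT z:E - ?T|lborel. inner_part z) + (LINT z:?T|lborel. inner_part z)"
      using inner_T[OF \<epsilon>] inner_T'[OF \<epsilon>] by (intro set_integral_Un) auto
    finally have "(LINT z:- ?T|lborel. f z) = (LINT z:E - ?T|lborel. f z)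
      + ((LINT z:E - ?T|lborel. inner_part z) + (LINT z:?T|lborel. inner_part z))" .
    also have "\<dots> = (LINT z:E - ?T|lborel. folded z) + (LINT z:?T|lborel. inner_part z)"
      using set_integral_add(2)[OF f_T[OF \<epsilon>] inner_T[OF \<epsilon>]] by (simp add: folded_eq[abs_def] f_def)
    also have "(LINT z:E - ?T|lborel. folded z) \<le> (LINT z:E - ball x \<delta>|lborel. folded z)"
      unfolding set_lebesgue_integral_def
    proof (rule integral_mono)
      show "integrable lborel (\<lambda>z. indicator (E - ?T) z *\<^sub>R folded z)"
        using folded_T[OF \<epsilon>] by (simp add: set_integrable_def)
      show "integrable lborel (\<lambda>z. indicator (E - ball x \<delta>) z *\<^sub>R folded z)"
        using folded_E by (simp add: set_integrable_def)
      fix z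
      \<comment> \<open>Membership of \<open>x\<close> in the removed set excludes
        \<open>z = x\<close>, where \<open>folded_le\<close> says nothing.\<close>
      have "0 < norm x" using r by linarith
      then have "x \<in> ?T" using \<epsilon>(1) by (simp add: inversion_nbhd_def)
      then show "indicator (E - ?T) z *\<^sub>R folded z \<le> indicator (E - ball x \<delta>) z *\<^sub>R folded z"
        using folded_le(2)[of z] T_delta[OF \<epsilon>] by (auto simp: indicator_def E_def)
    qed
    also have "(LINT z:?T|lborel. inner_part z) \<le> (LINT z|lborel. M * indicator (ball x (2 * \<epsilon>)) z)"
      unfolding set_lebesgue_integral_def
    proof (rule integral_mono)
      show "integrable lborel (\<lambda>z. indicator ?T z *\<^sub>R inner_part z)"
        using inner_T'[OF \<epsilon>] by (simp add: set_integrable_def)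
      show "integrable lborel (\<lambda>z. M * indicator (ball x (2 * \<epsilon>)) z)"
        using \<epsilon> by (intro integrable_mult_right integrable_real_indicator) (auto simp: emeasure_ball)
      fix z
      show "indicator ?T z *\<^sub>R inner_part z \<le> M * indicator (ball x (2 * \<epsilon>)) z"
      proof (cases "z \<in> ?T")
        case True
        then have "z \<in> E" "z \<in> ball x d" "z \<in> ball x (2 * \<epsilon>)"
          using TE T_d[OF \<epsilon>] T_sub[OF \<epsilon>(1) \<epsilon>'] by blast+
        then show ?thesis using inner_bound[of z] True by (simp add: abs_le_iff)
      qed (use M0 in simp)
    qed
    also have "\<dots> = M * (V * (2 * \<epsilon>) ^ DIM('a))"
      using \<epsilon> by (simp add: content_ball V_def)
    finally show ?thesis by simp
  qed
  have "D \<le> (LINT z:E - ball x \<delta>|lborel. folded z) + M * (V * (2 * 0) ^ DIM('a))"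
  proof (rule tendsto_le[OF _ _ gap_limit[folded f_def]])
    show "((\<lambda>\<epsilon>. (LINT z:E - ball x \<delta>|lborel. folded z) + M * (V * (2 * \<epsilon>) ^ DIM('a)))
      \<longlongrightarrow> (LINT z:E - ball x \<delta>|lborel. folded z) + M * (V * (2 * 0) ^ DIM('a))) (at_right 0)"
      by (intro tendsto_intros)
    show "\<forall>\<^sub>F \<epsilon> in at_right 0. (LINT z:- inversion_nbhd x \<epsilon>|lborel. f z)
      \<le> (LINT z:E - ball x \<delta>|lborel. folded z) + M * (V * (2 * \<epsilon>) ^ DIM('a))"
      unfolding eventually_at_right_field using \<epsilon>0 bound by (intro exI[of _ \<epsilon>0]) auto
  qed simp
  then show "D \<le> (LINT z:{z. r < norm z} - ball x \<delta>|lborel. folded z)" by (simp add: E_def power_0_left)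
qed

text \<open>Off \<open>x\<close> the integrand \<open>folded\<close> is nonpositive, so restricting
  the integral to a test set can only increase it.\<close>

lemma limit_le_on_set:
  assumes S: "S \<in> sets borel" "S \<subseteq> {z. r < norm z} - ball x \<delta>" "emeasure lborel S < \<infinity>"
    and \<delta>: "0 < \<delta>" "\<delta> \<le> norm x - r" and m: "\<And>z. z \<in> S \<Longrightarrow> folded z \<le> m"
  shows "D \<le> m * measure lborel S"
proof -
  have "D \<le> (LINT z:{z. r < norm z} - ball x \<delta>|lborel. folded z)" by (rule limit_le_folded(2)[OF \<delta>])
  also have "\<dots> \<le> (LINT z|lborel. m * indicator S z)"
    unfolding set_lebesgue_integral_def
  proof (rule integral_mono)
    show "integrable lborel (\<lambda>z. indicator ({z. r < norm z} - ball x \<delta>) z *\<^sub>R folded z)"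
      using limit_le_folded(1)[OF \<delta>] by (simp add: set_integrable_def)
    show "integrable lborel (\<lambda>z. m * indicator S z)"
      using S by (intro integrable_mult_right integrable_real_indicator) auto
    fix z
    show "indicator ({z. r < norm z} - ball x \<delta>) z *\<^sub>R folded z \<le> m * indicator S z"
    proof (cases "z \<in> S")
      case True
      then show ?thesis using m[OF True] S(2) by (auto simp: indicator_def)
    next
      case False
      then show ?thesis using folded_le(2)[of z] \<delta> by (cases "x = z") (auto simp: indicator_def)
    qed
  qed
  also have "\<dots> = m * measure lborel S" using S by simp
  finally show ?thesis .
qed

text \<open>On the test ball \<open>folded\<close> is at most \<open>w x * K\<close>, and
  \<open>K\<close> is at least of order \<open>s powr (- n - \<alpha>)\<close>; multiplying by the
  volume leaves \<open>s powr (- \<alpha>)\<close>. Distances are at most \<open>4 * s\<close>; the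
  factor 10 is that of \<open>limit_le_near_sphere\<close>, so that both bounds share one
  constant.\<close>

lemma limit_le_exterior_ball:
  assumes s: "0 < s" "2 * s \<le> norm (c - x)" "norm (c - x) \<le> 3 * s"
    and ball: "ball c s \<subseteq> {z. r < norm z}" and zero: "\<And>z. z \<in> ball c s \<Longrightarrow> w z = 0"
  shows "D \<le> w x * (unit_ball_vol (real DIM('a)) / 10 powr (real DIM('a) + \<alpha>)) * s powr (- \<alpha>)"
proof -
  define N where "N = real DIM('a) + \<alpha>"
  have N: "0 < N" using \<alpha> by (simp add: N_def add_nonneg_pos)
  define \<delta> where "\<delta> = min s (norm x - r)"
  have dist: "s < norm (x - z)" "norm (x - z) \<le> 4 * s" if "z \<in> ball c s" for z
    using that s norm_triangle_ineq[of "c - z" "z - x"] norm_triangle_ineq[of "c - x" "z - c"]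
    by (auto simp: dist_norm norm_minus_commute)
  have "D \<le> (w x * (1 / (10 * s) powr N)) * measure lborel (ball c s)"
  proof (rule limit_le_on_set[of _ \<delta>])
    show "ball c s \<subseteq> {z. r < norm z} - ball x \<delta>"
      using ball dist by (force simp: \<delta>_def dist_norm)
    show "folded z \<le> w x * (1 / (10 * s) powr N)" if z: "z \<in> ball c s" for z
    proof -
      have "x \<noteq> z" using dist(1)[OF z] s by auto
      then have "folded z \<le> w x * K z" using z zero ball by (intro folded_le_kernel) auto
      also have "\<dots> \<le> w x * (1 / (10 * s) powr N)"
        unfolding riesz_kernel_def N_def[symmetric] using dist[OF z] s N gap_nonpos
        by (intro mult_left_mono_neg divide_left_mono powr_mono2 mult_pos_pos) auto
      finally show ?thesis .
    qed
  qed (use s r in \<open>auto simp: \<delta>_def emeasure_ball\<close>)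
  also have "\<dots> = w x * (unit_ball_vol (real DIM('a)) / 10 powr N) * (s powr DIM('a) / s powr N)"
    using s by (simp add: content_ball powr_mult powr_realpow)
  also have "s powr DIM('a) / s powr N = s powr (- \<alpha>)"
    by (simp add: N_def powr_diff[symmetric])
  finally show ?thesis by (simp add: N_def)
qed

text \<open>Close to the sphere no zeros of the difference are needed: \<open>x\<close> and its
  image are within twice \<open>s = norm x - r\<close>, so \<open>K'\<close> is itself of order
  \<open>s powr (- n - \<alpha>)\<close> on a ball pushed radially outwards. The constant 10 is 2 *
  5: \<open>norm x\<close> is at most \<open>2 * r\<close>, and the image of \<open>x\<close> is
  within \<open>2 * s + 2 * s + s\<close> of the points of the ball.\<close>

lemma limit_le_near_sphere:
  assumes near: "norm x \<le> 2 * r"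
  shows "D \<le> w x * (unit_ball_vol (real DIM('a)) / 10 powr (real DIM('a) + \<alpha>)) * (norm x - r) powr (- \<alpha>)"
proof -
  define N where "N = real DIM('a) + \<alpha>"
  have N: "0 < N" using \<alpha> by (simp add: N_def add_nonneg_pos)
  define s where "s = norm x - r"
  have s: "0 < s" using r by (simp add: s_def)
  have x0: "0 < norm x" using r by linarith
  define c where "c = x + (2 * s / norm x) *\<^sub>R x"
  have cx: "norm (c - x) = 2 * s" using x0 s by (simp add: c_def)
  have ix: "norm (inversion r x - x) \<le> 2 * s"
  proof -
    have "inversion r x - x = - ((1 - r\<^sup>2 / (norm x)\<^sup>2) *\<^sub>R x)"
      by (simp add: inversion_def scaleR_diff_left)
    then have "norm (inversion r x - x) = \<bar>1 - r\<^sup>2 / (norm x)\<^sup>2\<bar> * norm x" by simp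
    also have "1 - r\<^sup>2 / (norm x)\<^sup>2 = (norm x - r) * (norm x + r) / (norm x)\<^sup>2"
      using x0 by (simp add: field_simps power2_eq_square)
    also have "\<bar>\<dots>\<bar> * norm x = s * (norm x + r) / norm x"
      using x0 s r by (simp add: s_def power2_eq_square)
    also have "\<dots> \<le> s * (2 * norm x) / norm x"
      using s r x0 by (intro divide_right_mono mult_left_mono) auto
    finally show ?thesis using x0 by simp
  qed
  have nc: "norm c = norm x + 2 * s"
  proof -
    have "c = (1 + 2 * s / norm x) *\<^sub>R x" by (simp add: c_def scaleR_add_left)
    then have "norm c = (1 + 2 * s / norm x) * norm x" using s x0 by (simp add: add_nonneg_nonneg)
    then show ?thesis using x0 by (simp add: distrib_right)
  qed
  have dist: "s < norm (x - z)" "r < norm z" if "z \<in> ball c s" for z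
    using that s cx nc norm_triangle_ineq[of "c - z" "z - x"] norm_triangle_ineq[of "c - z" z] r
    by (auto simp: dist_norm norm_minus_commute)
  have "D \<le> (w x * (1 / (10 * s) powr N)) * measure lborel (ball c s)"
  proof (rule limit_le_on_set[of _ s])
    show "ball c s \<subseteq> {z. r < norm z} - ball x s"
      using dist by (force simp: dist_norm)
    show "folded z \<le> w x * (1 / (10 * s) powr N)" if z: "z \<in> ball c s" for z
    proof -
      have "x \<noteq> z" using dist(1)[OF z] s by auto
      then have "folded z \<le> w x * K' z" using dist(2)[OF z] by (intro folded_le) auto
      also have "\<dots> \<le> w x * (1 / (10 * s)) powr N"
      proof (intro mult_left_mono_neg gap_nonpos)
        have nz: "z \<noteq> 0" "x \<noteq> 0" using dist(2)[OF z] r by auto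
        have "norm (inversion r x - z) \<le> norm (inversion r x - x) + norm (x - c) + norm (c - z)"
          using norm_triangle_ineq[of "inversion r x - x" "x - z"] norm_triangle_ineq[of "x - c" "c - z"] by simp
        then have "norm (inversion r x - z) \<le> 5 * s"
          using ix cx z by (simp add: dist_norm norm_minus_commute)
        then have "norm x * norm (inversion r x - z) \<le> (2 * r) * (5 * s)"
          using near r by (intro mult_mono) auto
        moreover have pos: "0 < norm x * norm (inversion r x - z)"
        proof -
          have "norm (inversion r x) < r" using r x0 by (simp add: norm_inversion power2_eq_square pos_divide_less_eq)
          then have "inversion r x \<noteq> z" using dist(2)[OF z] by auto
          then show ?thesis using x0 by simp
        qed
        ultimately have "r / ((2 * r) * (5 * s)) \<le> r / (norm x * norm (inversion r x - z))"
          using r s by (intro divide_left_mono) auto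
        then have "1 / (10 * s) \<le> r / (norm x * norm (inversion r x - z))"
          using r s by simp
        then show "(1 / (10 * s)) powr N \<le> K' z"
          using s N r nz by (subst reflected_kernel_eq) (auto simp: N_def[symmetric] intro!: powr_mono2)
      qed
      also have "(1 / (10 * s)) powr N = 1 / (10 * s) powr N" by (simp add: powr_divide)
      finally show ?thesis .
    qed
  qed (use s r in \<open>auto simp: s_def emeasure_ball\<close>)
  also have "\<dots> = w x * (unit_ball_vol (real DIM('a)) / 10 powr N) * (s powr DIM('a) / s powr N)"
    using s by (simp add: content_ball powr_mult powr_realpow)
  also have "s powr DIM('a) / s powr N = s powr (- \<alpha>)"
    by (simp add: N_def powr_diff[symmetric])
  finally show ?thesis by (simp add: N_def s_def)
qed

text \<open>Strong maximum principle. At a zero minimum \<open>folded z\<close> is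
  \<open>- w z * (K z - K' z)\<close>, nonpositive, while its integral is at least \<open>D\<close>,
  hence nonnegative. So it vanishes almost everywhere, which is impossible on an open set where
  \<open>w\<close> is positive, as \<open>K' < K\<close>.\<close>

lemma gap_eq_0:
  assumes D: "0 \<le> D" and wx: "w x = 0" and z: "r < norm z"
  shows "w z = 0"
proof (cases "z = x")
  case False
  show ?thesis
  proof (rule ccontr)
    assume "w z \<noteq> 0"
    then have pos: "0 < w z" using gap_le[OF z] wx by simp
    define G where "G = ({y. r < norm y} - {x}) \<inter> w -` {0<..}"
    have "open G"
    proof -
      have "continuous_on (- {0}) w"
        unfolding kelvin_gap_def[abs_def]
        using u r by (intro continuous_intros continuous_on_kelvin) (auto intro: continuous_on_subset)
      then have "continuous_on ({y. r < norm y} - {x}) w"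
        by (rule continuous_on_subset) (use r in auto)
      moreover have "open ({y. r < norm y} - {x})"
        by (intro open_Diff open_Collect_less continuous_intros)
      ultimately show ?thesis unfolding G_def by (intro continuous_open_preimage) auto
    qed
    moreover have "z \<in> G" using z False pos by (simp add: G_def)
    ultimately obtain s where s: "0 < s" "ball z s \<subseteq> G" by (meson openE)
    define \<delta> where "\<delta> = min (s / 2) (min (norm x - r) (norm (x - z) / 2))"
    have \<delta>: "0 < \<delta>" "\<delta> \<le> norm x - r" "\<delta> \<le> s / 2" "\<delta> \<le> norm (x - z) / 2"
      using s r False by (auto simp: \<delta>_def min_def)
    define t where "t = min s (norm (x - z) / 2)"
    have t: "0 < t" using s False by (simp add: t_def)
    let ?E = "{y. r < norm y} - ball x \<delta>"
    have sub: "ball z t \<subseteq> ?E"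
    proof
      fix y assume y: "y \<in> ball z t"
      then have "y \<in> G" using s by (auto simp: t_def)
      moreover have "norm (x - z) / 2 \<le> norm (x - y)"
        using y norm_triangle_ineq[of "x - y" "y - z"] by (simp add: t_def dist_norm norm_minus_commute)
      ultimately show "y \<in> ?E" using \<delta> by (auto simp: G_def dist_norm)
    qed
    have int: "integrable lborel (\<lambda>y. indicator ?E y *\<^sub>R folded y)"
      using limit_le_folded(1)[OF \<delta>(1,2)] by (simp add: set_integrable_def)
    have np: "indicator ?E y *\<^sub>R folded y \<le> 0" for y
      using folded_le(2)[of y] \<delta>(1) by (cases "x = y") (auto simp: indicator_def)
    have "(LINT y|lborel. - (indicator ?E y *\<^sub>R folded y)) = 0"
    proof -
      have "0 \<le> (LINT y:?E|lborel. folded y)" using limit_le_folded(2)[OF \<delta>(1,2)] D by simp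
      moreover have "0 \<le> (LINT y|lborel. - (indicator ?E y *\<^sub>R folded y))"
        by (rule integral_nonneg_AE) (use np in auto)
      ultimately show ?thesis by (simp add: set_lebesgue_integral_def)
    qed
    moreover have "integrable lborel (\<lambda>y. - (indicator ?E y *\<^sub>R folded y))" using int by simp
    ultimately have AE: "AE y in lborel. - (indicator ?E y *\<^sub>R folded y) = 0"
      using integral_nonneg_eq_0_iff_AE[of lborel "\<lambda>y. - (indicator ?E y *\<^sub>R folded y)"] np by simp
    have "folded y < 0" if "y \<in> ball z t" for y
    proof -
      have y: "y \<in> G" using that s by (auto simp: t_def)
      then have "K' y < K y" using r \<alpha> by (intro reflected_kernel_less) (auto simp: G_def)
      then show ?thesis using y wx by (simp add: folded_def G_def mult_neg_pos)
    qed
    note neg = this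
    have "AE y in lborel. y \<notin> ball z t"
      using AE
    proof eventually_elim
      case (elim y)
      then show ?case using neg[of y] sub by (fastforce simp: indicator_def split: if_splits)
    qed
    then have "emeasure lborel (ball z t) = 0"
      by (subst (asm) AE_iff_measurable[of "ball z t"]) auto
    then show False using t by (simp add: emeasure_ball ennreal_eq_0_iff) (metis not_less unit_ball_vol_pos mult_pos_pos zero_less_power of_nat_0_le_iff)
  qed
qed (use wx in simp)

end

subsection \<open>Moving spheres\<close>

lemma powr_diff_le_mult:
  fixes s t p :: real
  assumes "0 < s" "s \<le> t" "1 < p"
  shows "t powr p - s powr p \<le> p * t powr (p - 1) * (t - s)"
proof (cases "s = t")
  case False
  then have st: "s < t" using assms by simp
  have "\<exists>\<xi>>s. \<xi> < t \<and> t powr p - s powr p = (t - s) * (p * \<xi> powr (p - 1))"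
    using assms by (intro MVT2[OF st]) (auto intro!: derivative_eq_intros)
  then obtain \<xi> where \<xi>: "s < \<xi>" "\<xi> < t" "t powr p - s powr p = (t - s) * (p * \<xi> powr (p - 1))" by blast
  have "\<xi> powr (p - 1) \<le> t powr (p - 1)" using \<xi> assms by (intro powr_mono2) auto
  then have "(t - s) * (p * \<xi> powr (p - 1)) \<le> (t - s) * (p * t powr (p - 1))"
    using st assms by (intro mult_left_mono) auto
  then show ?thesis using \<xi>(3) by (simp add: mult_ac)
qed simp

text \<open>The base is \<open>B + 1\<close> because \<open>B\<close> may be 0, and the lower bound
  has to be positive.\<close>

lemma powr_neg_le_imp_ge:
  fixes s \<alpha> B :: real
  assumes "0 < s" "0 < \<alpha>" "0 \<le> B" "s powr (- \<alpha>) \<le> B"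
  shows "(B + 1) powr (- 1 / \<alpha>) \<le> s"
proof (rule ccontr)
  assume "\<not> ?thesis"
  then have "s < (B + 1) powr (- 1 / \<alpha>)" by simp
  then have "((B + 1) powr (- 1 / \<alpha>)) powr (- \<alpha>) \<le> s powr (- \<alpha>)"
    using assms by (intro powr_mono2') auto
  also have "((B + 1) powr (- 1 / \<alpha>)) powr (- \<alpha>) = B + 1"
    using assms by (simp add: powr_powr)
  finally show False using assms by simp
qed

text \<open>A solution positive in the half space at an arbitrary level \<open>b\<close>. This class
  is stable under translations, so the centre of every sphere can be moved to the origin. The
  normalisation constant is divided out of the equation.\<close>

locale half_space_solution =
  fixes \<alpha> p C b :: real and u :: "'a::euclidean_space \<Rightarrow> real" and e :: 'a
  assumes \<alpha>: "0 < \<alpha>" "\<alpha> < 2" "\<alpha> < real DIM('a)"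
    and p: "1 < p" "p \<le> (real DIM('a) + \<alpha>) / (real DIM('a) - \<alpha>)" and C: "0 < C"
    and e: "norm e = 1"
    and u_cont: "continuous_on UNIV u"
    and u_zero: "\<And>z. z \<bullet> e \<le> b \<Longrightarrow> u z = 0"
    and u_pos: "\<And>z. b < z \<bullet> e \<Longrightarrow> 0 < u z"
    and u_diff: "\<And>x. b < x \<bullet> e \<Longrightarrow> u differentiable (at x)"
    and u_eq: "\<And>x. b < x \<bullet> e \<Longrightarrow> pv_lborel (\<lambda>z. (u x - u z) * riesz_kernel \<alpha> x z) x (u x powr p / C)"
begin

lemma e_inner: "e \<bullet> e = 1"
  using e by (simp add: norm_eq_1)

lemma u_nonneg: "0 \<le> u z"
  using u_zero[of z] u_pos[of z] by (cases "z \<bullet> e \<le> b") auto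

lemma u_borel [measurable]: "u \<in> borel_measurable borel"
  using u_cont by (rule borel_measurable_continuous_onI)

lemma u_tendsto: "(f \<longlongrightarrow> l) F \<Longrightarrow> ((\<lambda>x. u (f x)) \<longlongrightarrow> u l) F"
  by (rule continuous_on_tendsto_compose[OF u_cont]) simp_all

lemma u_bounded: "\<exists>M. \<forall>z. norm z \<le> R \<longrightarrow> u z \<le> M"
proof -
  have "bounded (u ` cball 0 R)"
    using u_cont by (intro compact_imp_bounded compact_continuous_image) (auto intro: continuous_on_subset)
  then obtain M where M: "\<forall>y\<in>u ` cball 0 R. norm y \<le> M" unfolding bounded_iff by blast
  have "u z \<le> M" if "norm z \<le> R" for z
  proof -
    have "norm (u z) \<le> M" using M that by simp
    then show ?thesis by simp
  qed
  then show ?thesis by blast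
qed

lemma kelvin_gap_tendsto:
  assumes "(f \<longlongrightarrow> r) F" "(g \<longlongrightarrow> x) F" "0 < r" "x \<noteq> 0"
  shows "((\<lambda>t. kelvin_gap \<alpha> (f t) u (g t)) \<longlongrightarrow> kelvin_gap \<alpha> r u x) F"
  unfolding kelvin_gap_def kelvin_def inversion_def
  using assms by (intro tendsto_intros u_tendsto) auto

text \<open>The only place where the upper bound on \<open>p\<close> acts: the Kelvin transform
  solves the equation with the extra weight \<open>(r / norm x) powr \<tau>\<close>, and p \<le> (n
  + \<alpha>) / (n - \<alpha>) means that \<tau> is nonnegative, so this weight is at most 1 outside
  the sphere and may also be put in front of the term in \<open>u\<close>.\<close>

lemma limit_ge:
  assumes r: "0 < r" "r < norm x" and x: "b < x \<bullet> e"
  shows "(r / norm x) powr (real DIM('a) + \<alpha> - p * (real DIM('a) - \<alpha>)) * (u x powr p - kelvin \<alpha> r u x powr p) / C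
    \<le> u x powr p / C - (r / norm x) powr (real DIM('a) + \<alpha>) * (u (inversion r x) powr p / C)"
proof -
  define a where "a = real DIM('a) - \<alpha>"
  define \<tau> where "\<tau> = real DIM('a) + \<alpha> - p * a"
  have a: "0 < a" using \<alpha> by (simp add: a_def)
  have \<tau>: "0 \<le> \<tau>" using p(2) a by (simp add: \<tau>_def pos_le_divide_eq a_def[symmetric])
  define q where "q = r / norm x"
  have "0 < norm x" using r by linarith
  then have q: "0 < q" "q \<le> 1" using r by (auto simp: q_def)
  have "kelvin \<alpha> r u x powr p = (q powr a) powr p * u (inversion r x) powr p"
    by (simp add: kelvin_def q_def a_def powr_mult)
  then have "q powr \<tau> * kelvin \<alpha> r u x powr p = q powr (real DIM('a) + \<alpha>) * u (inversion r x) powr p"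
    by (simp add: powr_powr powr_add[symmetric] mult.assoc[symmetric] \<tau>_def mult.commute)
  moreover have "q powr \<tau> * u x powr p \<le> 1 * u x powr p"
    using q \<tau> by (intro mult_right_mono powr_le1) auto
  ultimately have "q powr \<tau> * (u x powr p - kelvin \<alpha> r u x powr p)
    \<le> u x powr p - q powr (real DIM('a) + \<alpha>) * u (inversion r x) powr p"
    by (simp add: right_diff_distrib)
  then have "q powr \<tau> * (u x powr p - kelvin \<alpha> r u x powr p) / C
    \<le> (u x powr p - q powr (real DIM('a) + \<alpha>) * u (inversion r x) powr p) / C"
    using C by (intro divide_right_mono) auto
  then show ?thesis by (simp add: q_def \<tau>_def a_def diff_divide_distrib)
qed

lemma kelvin_minimumI:
  assumes r: "0 < r" "r < norm x" and x: "b < x \<bullet> e" "b < inversion r x \<bullet> e"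
    and min: "\<And>z. r < norm z \<Longrightarrow> kelvin_gap \<alpha> r u x \<le> kelvin_gap \<alpha> r u z" "kelvin_gap \<alpha> r u x \<le> 0"
  shows "kelvin_minimum \<alpha> r (u x powr p / C - (r / norm x) powr (real DIM('a) + \<alpha>) * (u (inversion r x) powr p / C)) u x"
proof
  have x0: "x \<noteq> 0" using r by auto
  note * = x0 \<alpha>(1,2) r(1) u_borel u_diff[OF x(1)] u_eq[OF x(1)] u_eq[OF x(2)]
  show "set_integrable lborel (- inversion_nbhd x \<epsilon>)
        (\<lambda>z. (kelvin_gap \<alpha> r u x - kelvin_gap \<alpha> r u z) * riesz_kernel \<alpha> x z)"
    if "0 < \<epsilon>" "\<epsilon> \<le> norm x / 2" for \<epsilon>
    using set_integrable_kelvin_difference[OF * that] by (simp add: kelvin_gap_def)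
  show "((\<lambda>\<epsilon>. LINT z:- inversion_nbhd x \<epsilon>|lborel.
        (kelvin_gap \<alpha> r u x - kelvin_gap \<alpha> r u z) * riesz_kernel \<alpha> x z)
      \<longlongrightarrow> u x powr p / C - (r / norm x) powr (real DIM('a) + \<alpha>) * (u (inversion r x) powr p / C)) (at_right 0)"
    using pv_kelvin_difference[OF *] by (simp add: kelvin_gap_def)
qed (use assms \<alpha> u_cont in auto)

end

text \<open>The centre of the inversions, the origin, has distance \<open>b\<close> from the half
  space.\<close>

locale half_space_solution_pos = half_space_solution +
  assumes b: "0 < b"
begin

text \<open>Outside the sphere the inversion multiplies \<open>z \<bullet> e\<close> by a factor
  between 0 and 1, which cannot lift it above the positive level \<open>b\<close>. So
  \<open>u\<close> vanishes at both points.\<close>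

lemma gap_eq_0_outside:
  assumes "0 < r" "r \<le> norm z" "z \<bullet> e \<le> b"
  shows "kelvin_gap \<alpha> r u z = 0"
proof -
  have "inversion r z \<bullet> e \<le> b"
  proof (cases "0 \<le> z \<bullet> e")
    case True
    have "r\<^sup>2 \<le> (norm z)\<^sup>2" using assms by (intro power_mono) auto
    then have "r\<^sup>2 / (norm z)\<^sup>2 \<le> 1" using assms by (simp add: divide_le_eq_1)
    then have "r\<^sup>2 / (norm z)\<^sup>2 * (z \<bullet> e) \<le> 1 * (z \<bullet> e)" using True by (rule mult_right_mono)
    then show ?thesis using assms by (simp add: inversion_def)
  next
    case False
    then have "r\<^sup>2 / (norm z)\<^sup>2 * (z \<bullet> e) \<le> 0" by (intro mult_nonneg_nonpos) auto
    then show ?thesis using b by (simp add: inversion_def)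
  qed
  then show ?thesis using assms by (simp add: kelvin_gap_def kelvin_def u_zero)
qed

text \<open>Far out \<open>u\<close> is nonnegative and the Kelvin transform is small, so the
  infimum is attained in a closed annulus. A negative value excludes the sphere and the complement
  of the half space, where the difference is 0.\<close>

lemma negative_minimum_exists:
  assumes r: "0 < r" and z1: "r \<le> norm z1" "kelvin_gap \<alpha> r u z1 < 0"
  obtains x where "r < norm x" "b < x \<bullet> e" "kelvin_gap \<alpha> r u x < 0"
    "\<And>z. r < norm z \<Longrightarrow> kelvin_gap \<alpha> r u x \<le> kelvin_gap \<alpha> r u z"
proof -
  define w where "w = kelvin_gap \<alpha> r u"
  define a where "a = real DIM('a) - \<alpha>"
  have a: "0 < a" using \<alpha> by (simp add: a_def)
  define \<eta> where "\<eta> = - w z1"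
  have \<eta>: "0 < \<eta>" using z1 by (simp add: \<eta>_def w_def)
  obtain M where M: "\<And>z. norm z \<le> r \<Longrightarrow> u z \<le> M"
    using u_bounded by blast
  have M0: "0 \<le> M" using M[of 0] u_nonneg[of 0] r by simp
  \<comment> \<open>At this radius \<open>(r / R0) powr a\<close> is
    \<open>1 / (M / \<eta> + 1)\<close>, so beyond it the Kelvin transform is at most
    \<open>M / (M / \<eta> + 1)\<close>, hence at most \<eta>. The summand 1 also ensures that
    \<open>R0\<close> is at least \<open>r\<close>.\<close>
  define R0 where "R0 = r * (M / \<eta> + 1) powr (1 / a)"
  have big: "w z1 \<le> w z" if z: "R0 \<le> norm z" for z
  proof -
    have s: "1 \<le> M / \<eta> + 1" "0 < M / \<eta> + 1" using M0 \<eta> by (auto simp: add_nonneg_pos)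
    then have "1 \<le> (M / \<eta> + 1) powr (1 / a)" using a by (intro ge_one_powr_ge_zero) auto
    then have "r * 1 \<le> R0" unfolding R0_def using r by (intro mult_left_mono) auto
    then have R0: "r \<le> R0" "0 < R0" using r by auto
    have nz: "0 < norm z" using z R0 by linarith
    have "norm (inversion r z) \<le> r"
    proof -
      have "norm (inversion r z) = r * (r / norm z)" by (simp add: norm_inversion power2_eq_square)
      also have "\<dots> \<le> r * 1" using r z R0 by (intro mult_left_mono) (auto simp: divide_le_eq_1)
      finally show ?thesis by simp
    qed
    then have uM: "u (inversion r z) \<le> M" by (rule M)
    have "r / norm z \<le> r / R0" using z R0 r nz by (intro divide_left_mono) auto
    then have "(r / norm z) powr a \<le> (r / R0) powr a"
      using a r nz by (intro powr_mono2) auto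
    also have "r / R0 = 1 / (M / \<eta> + 1) powr (1 / a)" using r by (simp add: R0_def)
    also have "\<dots> powr a = 1 / (M / \<eta> + 1)" using s a by (simp add: powr_divide powr_powr)
    finally have "kelvin \<alpha> r u z \<le> 1 / (M / \<eta> + 1) * M"
      unfolding kelvin_def a_def[symmetric] using uM u_nonneg M0 s by (intro mult_mono) auto
    also have "\<dots> \<le> \<eta>" using M0 \<eta> by (simp add: field_simps)
    finally show ?thesis using u_nonneg[of z] by (simp add: w_def kelvin_gap_def \<eta>_def)
  qed
  define R where "R = max R0 (norm z1)"
  define S where "S = cball (0::'a) R - ball 0 r"
  have "compact S" unfolding S_def by (intro compact_diff) auto
  moreover have "z1 \<in> S" using z1 by (simp add: S_def R_def)
  moreover have "continuous_on S w"
    unfolding w_def kelvin_gap_def[abs_def] using u_cont r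
    by (intro continuous_intros continuous_on_subset[OF continuous_on_kelvin[OF u_cont r]])
      (auto simp: S_def intro: continuous_on_subset)
  ultimately obtain x where x: "x \<in> S" "\<And>z. z \<in> S \<Longrightarrow> w x \<le> w z"
    using continuous_attains_inf[of S w] by blast
  have wx: "w x < 0" using x(2)[OF \<open>z1 \<in> S\<close>] z1 by (simp add: w_def)
  show ?thesis
  proof (rule that[of x])
    show "kelvin_gap \<alpha> r u x < 0" using wx by (simp add: w_def)
    have rx: "r \<le> norm x" using x(1) by (simp add: S_def)
    show xe: "b < x \<bullet> e"
      using gap_eq_0_outside[OF r rx] wx by (force simp: w_def)
    show "r < norm x"
    proof (rule ccontr)
      assume "\<not> r < norm x"
      then have "norm x = r" using rx by simp
      then have "w x = 0" using r inversion_norm_fixed[of x] by (simp add: w_def kelvin_gap_def kelvin_def)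
      then show False using wx by simp
    qed
    fix z :: 'a assume z: "r < norm z"
    show "kelvin_gap \<alpha> r u x \<le> kelvin_gap \<alpha> r u z"
    proof (cases "z \<in> S")
      case True
      then show ?thesis using x(2) by (simp add: w_def)
    next
      case False
      then have "R0 \<le> norm z" using z by (auto simp: S_def R_def)
      then show ?thesis using big[of z] x(2)[OF \<open>z1 \<in> S\<close>] by (simp add: w_def)
    qed
  qed
qed

text \<open>The mean value theorem bounds the difference of the powers by the difference itself
  times \<open>p * v powr (p - 1)\<close>. The Kelvin weight in \<open>v powr (p - 1)\<close>
  combines with \<open>q powr \<tau>\<close> to the exponent
  \<open>\<tau> + a * (p - 1) = 2 * \<alpha>\<close>, the same for every \<open>p\<close>.\<close>

lemma negative_minimum_kelvin:
  assumes r: "0 < r" "r < norm x" and x: "b < x \<bullet> e" and neg: "kelvin_gap \<alpha> r u x < 0"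
    and min: "\<And>z. r < norm z \<Longrightarrow> kelvin_gap \<alpha> r u x \<le> kelvin_gap \<alpha> r u z"
    and M: "u (inversion r x) \<le> M"
  obtains D where "kelvin_minimum \<alpha> r D u x"
    "p / C * M powr (p - 1) * (r / norm x) powr (2 * \<alpha>) * kelvin_gap \<alpha> r u x \<le> D"
proof -
  define a where "a = real DIM('a) - \<alpha>"
  define \<tau> where "\<tau> = real DIM('a) + \<alpha> - p * a"
  define v where "v = kelvin \<alpha> r u x"
  define q where "q = r / norm x"
  have "0 < norm x" using r by linarith
  then have q: "0 < q" using r by (auto simp: q_def)
  have ux: "0 < u x" "u x < v" using u_pos[OF x] neg by (auto simp: v_def kelvin_gap_def)
  \<comment> \<open>Otherwise the Kelvin transform would vanish at \<open>x\<close> and could not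
    exceed \<open>u x\<close>. Hence the image of \<open>x\<close> lies in the half space, where the
    equation is available.\<close>
  have "0 < u (inversion r x)"
    using ux u_nonneg[of "inversion r x"] by (cases "u (inversion r x) = 0") (auto simp: v_def kelvin_def)
  then have ix: "b < inversion r x \<bullet> e" using u_zero[of "inversion r x"] by force
  let ?D = "u x powr p / C - (r / norm x) powr (real DIM('a) + \<alpha>) * (u (inversion r x) powr p / C)"
  have "v powr p - u x powr p \<le> p * v powr (p - 1) * (v - u x)"
    using ux p by (intro powr_diff_le_mult) auto
  then have "q powr \<tau> * (v powr p - u x powr p) \<le> q powr \<tau> * (p * v powr (p - 1) * (v - u x))"
    by (intro mult_left_mono) auto
  also have "\<dots> = (q powr \<tau> * v powr (p - 1)) * (p * (v - u x))" by (simp only: mult_ac)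
  also have "\<dots> \<le> (q powr (2 * \<alpha>) * M powr (p - 1)) * (p * (v - u x))"
  proof (rule mult_right_mono)
    have "q powr \<tau> * v powr (p - 1) = q powr \<tau> * ((q powr a) powr (p - 1) * u (inversion r x) powr (p - 1))"
      by (simp add: v_def kelvin_def q_def a_def powr_mult)
    also have "\<dots> = q powr (\<tau> + a * (p - 1)) * u (inversion r x) powr (p - 1)"
      by (simp add: powr_powr powr_add)
    also have "\<tau> + a * (p - 1) = 2 * \<alpha>" by (simp add: \<tau>_def a_def algebra_simps)
    also have "u (inversion r x) powr (p - 1) \<le> M powr (p - 1)"
      using M u_nonneg p by (intro powr_mono2) auto
    finally show "q powr \<tau> * v powr (p - 1) \<le> q powr (2 * \<alpha>) * M powr (p - 1)" by (simp add: mult_left_mono)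
    show "0 \<le> p * (v - u x)" using p ux by simp
  qed
  finally have "- ((q powr (2 * \<alpha>) * M powr (p - 1)) * (p * (v - u x))) / C \<le> - (q powr \<tau> * (v powr p - u x powr p)) / C"
    using C by (intro divide_right_mono) auto
  also have "- (q powr \<tau> * (v powr p - u x powr p)) / C = q powr \<tau> * (u x powr p - v powr p) / C"
    by (simp add: algebra_simps)
  also have "\<dots> \<le> ?D" using limit_ge[OF r x] by (simp add: q_def \<tau>_def a_def v_def)
  finally have "p / C * M powr (p - 1) * q powr (2 * \<alpha>) * (u x - v) \<le> ?D"
    by (simp add: algebra_simps)
  then show ?thesis
    using kelvin_minimumI[OF r x ix min] neg by (intro that[of ?D]) (auto simp: q_def v_def kelvin_gap_def)
qed

text \<open>Three test balls at one minimum. At scale |x| the estimate reads |x|^(-\<alpha>) \<le> B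
  r^(2 \<alpha>) |x|^(-2 \<alpha>), which bounds |x| from above because the decay exponents differ.
  At the scales of the distances to the sphere and to the boundary, s^(-\<alpha>) \<le> B bounds
  \<open>s\<close> from below. All constants are uniform in \<open>r\<close> between
  \<open>b\<close> and \<open>R0\<close>.\<close>

lemma negative_minimum_bounds:
  assumes R0: "b \<le> R0"
  shows "\<exists>R s. 0 < s \<and> (\<forall>r x. b \<le> r \<and> r \<le> R0 \<and> r < norm x \<and> b < x \<bullet> e \<and> kelvin_gap \<alpha> r u x < 0 \<and>
    (\<forall>z. r < norm z \<longrightarrow> kelvin_gap \<alpha> r u x \<le> kelvin_gap \<alpha> r u z) \<longrightarrow>
    norm x \<le> R \<and> s \<le> norm x - r \<and> s \<le> x \<bullet> e - b)"
proof -
  define \<kappa> where "\<kappa> = unit_ball_vol (real DIM('a)) / 10 powr (real DIM('a) + \<alpha>)"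
  have \<kappa>: "0 < \<kappa>" by (simp add: \<kappa>_def)
  obtain M where M: "\<And>z. norm z \<le> R0 \<Longrightarrow> u z \<le> M"
    using u_bounded by blast
  define B where "B = p / C * M powr (p - 1) / \<kappa>"
  have B: "0 \<le> B" using p C \<kappa> by (simp add: B_def)
  define s0 where "s0 = (B + 1) powr (- 1 / \<alpha>)"
  have s0: "0 < s0" using B by (simp add: s0_def)
  \<comment> \<open>\<open>s0\<close> serves radii with \<open>norm x\<close> at most
    \<open>2 * r\<close>; otherwise \<open>norm x - r\<close> exceeds \<open>r\<close>, which is at
    least \<open>b\<close>.\<close>
  define g0 where "g0 = min s0 b"
  define R where "R = (B * R0 powr (2 * \<alpha>)) powr (1 / \<alpha>)"
  have "norm x \<le> R \<and> g0 / 3 \<le> norm x - r \<and> g0 / 3 \<le> x \<bullet> e - b"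
    if r: "b \<le> r" "r \<le> R0" "r < norm x" and x: "b < x \<bullet> e" and neg: "kelvin_gap \<alpha> r u x < 0"
      and min: "\<And>z. r < norm z \<Longrightarrow> kelvin_gap \<alpha> r u x \<le> kelvin_gap \<alpha> r u z" for r x
  proof -
    have r0: "0 < r" using b r by simp
    have nx: "0 < norm x" using r0 r by linarith
    have q: "0 < r / norm x" "r / norm x \<le> 1" using r0 r nx by auto
    have "norm (inversion r x) \<le> R0"
    proof -
      have "norm (inversion r x) = r * (r / norm x)" by (simp add: norm_inversion power2_eq_square)
      also have "\<dots> \<le> r * 1" using q r0 by (intro mult_left_mono) auto
      finally show ?thesis using r by simp
    qed
    then have "u (inversion r x) \<le> M" by (rule M)
    then obtain D where D: "kelvin_minimum \<alpha> r D u x"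
      "p / C * M powr (p - 1) * (r / norm x) powr (2 * \<alpha>) * kelvin_gap \<alpha> r u x \<le> D"
      using negative_minimum_kelvin[OF r0 r(3) x neg min] by blast
    interpret K: kelvin_minimum \<alpha> r D u x by (rule D(1))
    \<comment> \<open>The lower bound \<open>D(2)\<close> and an upper bound on \<open>D\<close>
      share the negative factor \<open>kelvin_gap \<alpha> r u x\<close>; cancelling it reverses the
      inequality.\<close>
    have key: "t powr (- \<alpha>) \<le> B * (r / norm x) powr (2 * \<alpha>)"
      if "D \<le> kelvin_gap \<alpha> r u x * \<kappa> * t powr (- \<alpha>)" for t
    proof -
      have "kelvin_gap \<alpha> r u x * (p / C * M powr (p - 1) * (r / norm x) powr (2 * \<alpha>))
        \<le> kelvin_gap \<alpha> r u x * (\<kappa> * t powr (- \<alpha>))"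
        using that D(2) by (simp add: mult_ac)
      then have "\<kappa> * t powr (- \<alpha>) \<le> p / C * M powr (p - 1) * (r / norm x) powr (2 * \<alpha>)"
        using neg by (simp only: mult_le_cancel_left_neg)
      then have "t powr (- \<alpha>) \<le> p / C * M powr (p - 1) * (r / norm x) powr (2 * \<alpha>) / \<kappa>"
        using \<kappa> by (intro mult_imp_le_div_pos) (simp_all only: mult.commute)
      then show ?thesis by (simp add: B_def)
    qed
    have key': "s0 \<le> t" if "0 < t" "D \<le> kelvin_gap \<alpha> r u x * \<kappa> * t powr (- \<alpha>)" for t
    proof -
      have "(r / norm x) powr (2 * \<alpha>) \<le> 1" using q \<alpha> by (intro powr_le1) auto
      then have "B * (r / norm x) powr (2 * \<alpha>) \<le> B * 1" using B by (intro mult_left_mono) auto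
      then have "t powr (- \<alpha>) \<le> B" using key[OF that(2)] by simp
      then show ?thesis unfolding s0_def using that \<alpha> B by (intro powr_neg_le_imp_ge) auto
    qed
    have "norm x \<le> R"
    proof -
      \<comment> \<open>The test ball lies deep behind the boundary: its points have height at most
        \<open>- norm x\<close> and norm above \<open>norm x\<close>. Since
        \<open>x \<bullet> e\<close> is positive, moving against \<open>e\<close> puts
        \<open>c\<close> at distance at least \<open>2 * norm x\<close> from
        \<open>x\<close>.\<close>
      define c where "c = - (2 * norm x) *\<^sub>R e"
      have nc: "norm c = 2 * norm x" by (simp add: c_def e)
      have "(norm (c - x))\<^sup>2 = (norm c)\<^sup>2 - 2 * (c \<bullet> x) + (norm x)\<^sup>2"
        by (simp add: power2_norm_eq_inner algebra_simps inner_commute)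
      also have "c \<bullet> x = - (2 * norm x * (x \<bullet> e))" by (simp add: c_def inner_commute)
      finally have "(norm (c - x))\<^sup>2 = (2 * norm x)\<^sup>2 + 4 * norm x * (x \<bullet> e) + (norm x)\<^sup>2" by (simp add: nc)
      moreover have "0 \<le> norm x * (x \<bullet> e)" using x b by simp
      moreover have "0 \<le> (norm x)\<^sup>2" by simp
      ultimately have "(2 * norm x)\<^sup>2 \<le> (norm (c - x))\<^sup>2" by linarith
      then have far: "2 * norm x \<le> norm (c - x)" by (rule power2_le_imp_le) simp
      have near: "norm (c - x) \<le> 3 * norm x" using norm_triangle_ineq4[of c x] nc by simp
      have ball: "norm x < norm z" "z \<bullet> e \<le> b" if "z \<in> ball c (norm x)" for z
      proof -
        have d: "norm (c - z) < norm x" using that by (simp add: dist_norm)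
        show "norm x < norm z" using d nc norm_triangle_ineq2[of c z] by simp
        have "\<bar>(z - c) \<bullet> e\<bar> \<le> norm (z - c) * norm e" by (rule Cauchy_Schwarz_ineq2)
        then have "z \<bullet> e \<le> c \<bullet> e + norm x" using d by (simp add: e inner_diff_left norm_minus_commute)
        also have "c \<bullet> e = - 2 * norm x" by (simp add: c_def e_inner)
        finally show "z \<bullet> e \<le> b" using b nx by linarith
      qed
      have "D \<le> kelvin_gap \<alpha> r u x * \<kappa> * norm x powr (- \<alpha>)"
        unfolding \<kappa>_def
      proof (rule K.limit_le_exterior_ball[OF nx far near])
        show "ball c (norm x) \<subseteq> {z. r < norm z}" using ball(1) r by force
        show "kelvin_gap \<alpha> r u z = 0" if "z \<in> ball c (norm x)" for z
          using ball[OF that] r by (intro gap_eq_0_outside r0) auto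
      qed
      then have "norm x powr (- \<alpha>) \<le> B * (r / norm x) powr (2 * \<alpha>)" by (rule key)
      also have "\<dots> = B * r powr (2 * \<alpha>) * norm x powr (- (2 * \<alpha>))"
        by (simp add: powr_divide powr_minus_divide)
      finally have "norm x powr (- \<alpha>) * norm x powr (2 * \<alpha>) \<le> B * r powr (2 * \<alpha>) * norm x powr (- (2 * \<alpha>)) * norm x powr (2 * \<alpha>)"
        by (intro mult_right_mono) auto
      also have "\<dots> = B * r powr (2 * \<alpha>)" using nx by (simp add: powr_add[symmetric] mult.assoc)
      also have "\<dots> \<le> B * R0 powr (2 * \<alpha>)" using B r r0 \<alpha> by (intro mult_left_mono powr_mono2) auto
      finally have "norm x powr \<alpha> \<le> B * R0 powr (2 * \<alpha>)" by (simp add: powr_add[symmetric])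
      then have "(norm x powr \<alpha>) powr (1 / \<alpha>) \<le> R"
        unfolding R_def using \<alpha> by (intro powr_mono2) auto
      then show ?thesis using \<alpha> nx by (simp add: powr_powr)
    qed
    moreover have g: "g0 \<le> norm x - r"
    proof (cases "norm x \<le> 2 * r")
      case True
      have "s0 \<le> norm x - r"
        using K.limit_le_near_sphere[OF True] r by (intro key') (auto simp: \<kappa>_def)
      then show ?thesis by (simp add: g0_def)
    qed (use r in \<open>auto simp: g0_def\<close>)
    moreover have "g0 / 3 \<le> x \<bullet> e - b"
    proof (rule ccontr)
      assume lt: "\<not> g0 / 3 \<le> x \<bullet> e - b"
      define d where "d = x \<bullet> e - b"
      have d: "0 < d" "3 * d < g0" using x lt by (auto simp: d_def)
      \<comment> \<open>The test ball just behind the boundary reaches at most \<open>3 * d\<close>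
        from \<open>x\<close>. As \<open>3 * d < g0\<close> and \<open>g0\<close> is at most
        \<open>norm x - r\<close>, it stays outside the sphere; this is the origin of
        \<open>g0 / 3\<close>.\<close>
      define c where "c = x - (2 * d) *\<^sub>R e"
      have cx: "norm (c - x) = 2 * d" using d by (simp add: c_def e)
      have ball: "r < norm z" "z \<bullet> e \<le> b" if "z \<in> ball c d" for z
      proof -
        have dd: "norm (c - z) < d" using that by (simp add: dist_norm)
        have "norm x \<le> norm (x - c) + norm (c - z) + norm z"
          using norm_triangle_ineq[of "x - c" c] norm_triangle_ineq[of "c - z" z] by simp
        then show "r < norm z" using dd cx g d by (simp add: norm_minus_commute)
        have "\<bar>(z - c) \<bullet> e\<bar> \<le> norm (z - c) * norm e" by (rule Cauchy_Schwarz_ineq2)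
        then have "z \<bullet> e \<le> c \<bullet> e + d" using dd by (simp add: e inner_diff_left norm_minus_commute)
        also have "c \<bullet> e = x \<bullet> e - 2 * d"
          by (simp add: c_def inner_diff_left e_inner)
        finally show "z \<bullet> e \<le> b" by (simp add: d_def)
      qed
      have "D \<le> kelvin_gap \<alpha> r u x * \<kappa> * d powr (- \<alpha>)"
        unfolding \<kappa>_def
      proof (rule K.limit_le_exterior_ball[OF d(1)])
        show "ball c d \<subseteq> {z. r < norm z}" using ball(1) by force
        show "kelvin_gap \<alpha> r u z = 0" if "z \<in> ball c d" for z
          using ball[OF that] by (intro gap_eq_0_outside r0) auto
      qed (use cx d in auto)
      then have "s0 \<le> d" using d(1) by (intro key')
      then show False using d by (simp add: g0_def)
    qed
    moreover have "0 < g0" using s0 b by (simp add: g0_def)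
    ultimately show ?thesis by simp
  qed
  moreover have "0 < g0 / 3" using s0 b by (simp add: g0_def)
  ultimately show ?thesis by (intro exI[of _ R] exI[of _ "g0 / 3"]) blast
qed

lemma gap_nonneg_small:
  assumes "0 < r" "r \<le> b" "r \<le> norm z"
  shows "0 \<le> kelvin_gap \<alpha> r u z"
proof -
  have "inversion r z \<bullet> e \<le> norm (inversion r z) * norm e" by (rule norm_cauchy_schwarz)
  also have "\<dots> = r * (r / norm z)" by (simp add: norm_inversion power2_eq_square e)
  also have "\<dots> \<le> r * 1" using assms by (intro mult_left_mono) (auto simp: divide_le_eq_1)
  finally have "u (inversion r z) = 0" using assms by (intro u_zero) simp
  then show ?thesis using u_nonneg by (simp add: kelvin_gap_def kelvin_def)
qed

text \<open>
  Since \<open>b > 0\<close>, a far point of the half space is reflected into the region where \<open>u\<close> vanishes, so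
  the Kelvin transform can never coincide with \<open>u\<close>.
\<close>

lemma gap_pos:
  assumes \<mu>: "b \<le> \<mu>" and P: "\<And>z. \<mu> \<le> norm z \<Longrightarrow> 0 \<le> kelvin_gap \<alpha> \<mu> u z"
    and x: "\<mu> < norm x" "b < x \<bullet> e"
  shows "0 < kelvin_gap \<alpha> \<mu> u x"
proof (rule ccontr)
  assume "\<not> 0 < kelvin_gap \<alpha> \<mu> u x"
  then have wx: "kelvin_gap \<alpha> \<mu> u x = 0" using P[of x] x by simp
  have \<mu>0: "0 < \<mu>" using b \<mu> by simp
  have v: "kelvin \<alpha> \<mu> u x = u x" using wx by (simp add: kelvin_gap_def)
  have "0 < u (inversion \<mu> x)"
    using v u_pos[OF x(2)] u_nonneg[of "inversion \<mu> x"]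
    by (cases "u (inversion \<mu> x) = 0") (auto simp: kelvin_def)
  then have ix: "b < inversion \<mu> x \<bullet> e" using u_zero[of "inversion \<mu> x"] by force
  define D where "D = u x powr p / C - (\<mu> / norm x) powr (real DIM('a) + \<alpha>) * (u (inversion \<mu> x) powr p / C)"
  interpret K: kelvin_minimum \<alpha> \<mu> D u x
    unfolding D_def using wx P by (intro kelvin_minimumI \<mu>0 x ix) auto
  have D: "0 \<le> D" using limit_ge[OF \<mu>0 x] v by (simp add: D_def)
  \<comment> \<open>The sum exceeds \<mu> and \<open>b\<close> and is at least \<mu>^2/b. The point
    \<open>t *\<^sub>R e\<close> is thus outside the sphere and in the half space, while its image
    has height \<mu>^2/t, at most \<open>b\<close>.\<close>
  define t where "t = \<mu> + b + \<mu>\<^sup>2 / b"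
  have t: "\<mu> < t" "b < t" "\<mu>\<^sup>2 / b \<le> t" using b \<mu>0 by (auto simp: t_def add_pos_nonneg)
  have t0: "0 < t" using t b by simp
  define z where "z = t *\<^sub>R e"
  have nz: "norm z = t" using t0 e by (simp add: z_def)
  have "kelvin_gap \<alpha> \<mu> u z = 0" by (rule K.gap_eq_0[OF D wx]) (use t nz in simp)
  moreover have "u (inversion \<mu> z) = 0"
  proof (rule u_zero)
    have "inversion \<mu> z \<bullet> e = \<mu>\<^sup>2 / t"
      using t0 nz by (simp add: inversion_def) (simp add: z_def e_inner power2_eq_square)
    also have "\<dots> \<le> b" using t(3) t0 b by (simp add: pos_divide_le_eq mult.commute)
    finally show "inversion \<mu> z \<bullet> e \<le> b" .
  qed
  moreover have "0 < u z" using t by (intro u_pos) (simp add: z_def e_inner)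
  ultimately show False by (simp add: kelvin_gap_def kelvin_def)
qed

text \<open>Bad radii are at least \<open>b\<close>. Their infimum is good, as a limit of good radii
  from the left, so bad radii accumulate at it from the right. Their negative minima have a limit
  point at positive distance from the sphere and from the boundary, where the limiting difference is
  nonpositive, contrary to \<open>gap_pos\<close>.\<close>

theorem gap_nonneg:
  assumes "0 < r" "r \<le> norm z"
  shows "0 \<le> kelvin_gap \<alpha> r u z"
proof (rule ccontr)
  assume bad: "\<not> 0 \<le> kelvin_gap \<alpha> r u z"
  define S where "S = {r. 0 < r \<and> (\<exists>z. r \<le> norm z \<and> kelvin_gap \<alpha> r u z < 0)}"
  have "r \<in> S" using bad assms unfolding S_def mem_Collect_eq not_le by blast
  then have S_ne: "S \<noteq> {}" by blast
  have S_b: "b \<le> r" if "r \<in> S" for r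
    using that gap_nonneg_small[of r] by (force simp: S_def)
  then have bdd: "bdd_below S" by (rule bdd_belowI)
  define \<mu> where "\<mu> = Inf S"
  have \<mu>: "b \<le> \<mu>" unfolding \<mu>_def using S_ne S_b by (rule cInf_greatest)
  have \<mu>0: "0 < \<mu>" using \<mu> b by simp
  have below: "0 \<le> kelvin_gap \<alpha> r u z" if "0 < r" "r < \<mu>" "r \<le> norm z" for r z
    using that cInf_lower[OF _ bdd, of r] by (force simp: S_def \<mu>_def not_less)
  have P: "0 \<le> kelvin_gap \<alpha> \<mu> u z" if z: "\<mu> \<le> norm z" for z
  proof (rule tendsto_lowerbound)
    show "((\<lambda>r. kelvin_gap \<alpha> r u z) \<longlongrightarrow> kelvin_gap \<alpha> \<mu> u z) (at_left \<mu>)"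
      using z \<mu>0 by (intro kelvin_gap_tendsto tendsto_ident_at tendsto_const) auto
    show "\<forall>\<^sub>F r in at_left \<mu>. 0 \<le> kelvin_gap \<alpha> r u z"
      unfolding eventually_at_left_field using below z \<mu>0 by (intro exI[of _ 0]) auto
  qed simp
  then have "\<mu> \<notin> S" by (auto simp: S_def not_less)
  have near: "\<exists>r. r \<in> S \<and> \<mu> < r \<and> r < \<mu> + inverse (real (Suc n))" for n
  proof -
    have "Inf S < \<mu> + inverse (real (Suc n))" by (simp add: \<mu>_def)
    then obtain r where r: "r \<in> S" "r < \<mu> + inverse (real (Suc n))"
      using cInf_less_iff[OF S_ne bdd] by blast
    moreover have "\<mu> \<le> r" unfolding \<mu>_def using r bdd by (intro cInf_lower)
    moreover have "\<mu> \<noteq> r" using r \<open>\<mu> \<notin> S\<close> by auto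
    ultimately show ?thesis by (intro exI[of _ r]) auto
  qed
  obtain rr where rr: "\<And>n. rr n \<in> S" "\<And>n. \<mu> < rr n" "\<And>n. rr n < \<mu> + inverse (real (Suc n))"
    using near by metis
  have rr_lim: "rr \<longlonglongrightarrow> \<mu>"
  proof (rule tendsto_sandwich[of "\<lambda>n. \<mu>" rr _ "\<lambda>n. \<mu> + inverse (real (Suc n))"])
    show "(\<lambda>n. \<mu> + inverse (real (Suc n))) \<longlonglongrightarrow> \<mu>"
      using tendsto_add[OF tendsto_const[of \<mu>] LIMSEQ_inverse_real_of_nat] by simp
    show "(\<lambda>n. \<mu>) \<longlonglongrightarrow> \<mu>" by simp
  qed (use rr in \<open>auto intro!: always_eventually less_imp_le\<close>)
  have rr1: "rr n \<le> \<mu> + 1" for n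
  proof -
    have "inverse (real (Suc n)) \<le> 1" by (simp add: field_simps)
    then show ?thesis using rr(3)[of n] by simp
  qed
  have "\<exists>x. rr n < norm x \<and> b < x \<bullet> e \<and> kelvin_gap \<alpha> (rr n) u x < 0 \<and>
    (\<forall>z. rr n < norm z \<longrightarrow> kelvin_gap \<alpha> (rr n) u x \<le> kelvin_gap \<alpha> (rr n) u z)" for n
  proof -
    obtain z where "0 < rr n" "rr n \<le> norm z" "kelvin_gap \<alpha> (rr n) u z < 0" using rr(1)[of n] by (auto simp: S_def)
    then show ?thesis using negative_minimum_exists by metis
  qed
  then obtain xx where xx: "\<And>n. rr n < norm (xx n)" "\<And>n. b < xx n \<bullet> e" "\<And>n. kelvin_gap \<alpha> (rr n) u (xx n) < 0"
    "\<And>n z. rr n < norm z \<Longrightarrow> kelvin_gap \<alpha> (rr n) u (xx n) \<le> kelvin_gap \<alpha> (rr n) u z"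
    by metis
  have "b \<le> \<mu> + 1" using \<mu> by simp
  then obtain R s where s: "0 < s" and bd: "\<forall>r x. b \<le> r \<and> r \<le> \<mu> + 1 \<and> r < norm x \<and> b < x \<bullet> e \<and> kelvin_gap \<alpha> r u x < 0 \<and>
    (\<forall>z. r < norm z \<longrightarrow> kelvin_gap \<alpha> r u x \<le> kelvin_gap \<alpha> r u z) \<longrightarrow>
    norm x \<le> R \<and> s \<le> norm x - r \<and> s \<le> x \<bullet> e - b"
    using negative_minimum_bounds by blast
  have xb: "norm (xx n) \<le> R" "s \<le> norm (xx n) - rr n" "s \<le> xx n \<bullet> e - b" for n
  proof -
    have "b \<le> rr n" using rr(2)[of n] \<mu> by simp
    then have "norm (xx n) \<le> R \<and> s \<le> norm (xx n) - rr n \<and> s \<le> xx n \<bullet> e - b"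
      using bd rr1[of n] xx by blast
    then show "norm (xx n) \<le> R" "s \<le> norm (xx n) - rr n" "s \<le> xx n \<bullet> e - b" by auto
  qed
  have "\<forall>n. xx n \<in> cball 0 R" using xb by simp
  then obtain x0 \<phi> where sub: "strict_mono (\<phi> :: nat \<Rightarrow> nat)" "(xx \<circ> \<phi>) \<longlonglongrightarrow> x0"
    using compact_cball[of "0::'a" R] unfolding compact_def by metis
  have x_lim: "(\<lambda>n. xx (\<phi> n)) \<longlonglongrightarrow> x0" using sub(2) by (simp add: o_def)
  have r_lim: "(\<lambda>n. rr (\<phi> n)) \<longlonglongrightarrow> \<mu>"
    using LIMSEQ_subseq_LIMSEQ[OF rr_lim sub(1)] by (simp add: o_def)
  have "s \<le> norm x0 - \<mu>"
    by (rule tendsto_lowerbound[of "\<lambda>n. norm (xx (\<phi> n)) - rr (\<phi> n)" _ sequentially])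
      (use xb in \<open>auto intro!: tendsto_intros x_lim r_lim\<close>)
  then have x0_norm: "\<mu> < norm x0" using s by simp
  have "s \<le> x0 \<bullet> e - b"
    by (rule tendsto_lowerbound[of "\<lambda>n. xx (\<phi> n) \<bullet> e - b" _ sequentially])
      (use xb in \<open>auto intro!: tendsto_intros x_lim\<close>)
  then have x0_e: "b < x0 \<bullet> e" using s by simp
  have "kelvin_gap \<alpha> \<mu> u x0 \<le> 0"
  proof (rule tendsto_upperbound)
    show "(\<lambda>n. kelvin_gap \<alpha> (rr (\<phi> n)) u (xx (\<phi> n))) \<longlonglongrightarrow> kelvin_gap \<alpha> \<mu> u x0"
      using x0_norm \<mu>0 by (intro kelvin_gap_tendsto r_lim x_lim) auto
  qed (use xx(3) in \<open>auto intro!: always_eventually less_imp_le\<close>)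
  then show False using gap_pos[OF \<mu> P x0_norm x0_e] by simp
qed

end

subsection \<open>Monotonicity and growth\<close>

lemma
  fixes f :: "'a::euclidean_space \<Rightarrow> real"
  assumes [measurable]: "f \<in> borel_measurable borel"
  shows integrable_lborel_translate: "integrable lborel (\<lambda>z. f (z + c)) \<longleftrightarrow> integrable lborel f"
    and integral_lborel_translate: "(LINT z|lborel. f (z + c)) = (LINT z|lborel. f z)"
proof -
  have eq: "lborel = distr lborel borel (\<lambda>z. z + c)"
    using lborel_distr_plus[of c, symmetric] by (simp only: add.commute[of _ c])
  have "integrable lborel f \<longleftrightarrow> integrable (distr lborel borel (\<lambda>z. z + c)) f" using eq by simp
  also have "\<dots> \<longleftrightarrow> integrable lborel (\<lambda>z. f (z + c))" by (rule integrable_distr_eq) auto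
  finally show "integrable lborel (\<lambda>z. f (z + c)) \<longleftrightarrow> integrable lborel f" by simp
  have "(LINT z|lborel. f z) = (LINT z|distr lborel borel (\<lambda>z. z + c). f z)" using eq by simp
  also have "\<dots> = (LINT z|lborel. f (z + c))" by (rule integral_distr) auto
  finally show "(LINT z|lborel. f (z + c)) = (LINT z|lborel. f z)" by simp
qed

lemma integral_lborel_reflect:
  fixes f :: "'a::euclidean_space \<Rightarrow> real"
  assumes [measurable]: "f \<in> borel_measurable borel"
  shows "(LINT z|lborel. f (c - z)) = (LINT z|lborel. f z)"
proof -
  have "lborel = density (distr lborel borel (\<lambda>z::'a. c + (- 1) *\<^sub>R z)) (\<lambda>_. ennreal (\<bar>- 1\<bar> ^ DIM('a)))"
    by (rule lborel_affine) simp
  then have eq: "lborel = distr lborel borel (\<lambda>z::'a. c - z)"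
    by (simp add: density_1)
  have "(LINT z|lborel. f z) = (LINT z|distr lborel borel (\<lambda>z. c - z). f z)" using eq by simp
  also have "\<dots> = (LINT z|lborel. f (c - z))" by (rule integral_distr) auto
  finally show ?thesis by simp
qed

lemma pv_lborel_translate:
  fixes f :: "'a::euclidean_space \<Rightarrow> real"
  assumes f [measurable]: "f \<in> borel_measurable borel" and pv: "pv_lborel f (x + c) I"
  shows "pv_lborel (\<lambda>z. f (z + c)) x I"
proof -
  define h where "h \<epsilon> z = indicator (- ball (x + c) \<epsilon>) z *\<^sub>R f z" for \<epsilon> z
  have hm: "h \<epsilon> \<in> borel_measurable borel" for \<epsilon>
    unfolding h_def[abs_def] by measurable
  have eq: "indicator (- ball x \<epsilon>) z *\<^sub>R f (z + c) = h \<epsilon> (z + c)" for \<epsilon> z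
    by (simp add: h_def indicator_def dist_norm)
  show ?thesis
    using pv unfolding pv_lborel_def set_integrable_def set_lebesgue_integral_def eq
      integrable_lborel_translate[OF hm] integral_lborel_translate[OF hm]
    by (simp add: h_def[abs_def])
qed

section \<open>Translated solutions and monotonicity in the direction \<open>e\<close>\<close>

context half_space_solution
begin

lemma translate: "half_space_solution \<alpha> p C (b - c \<bullet> e) (\<lambda>z. u (z + c)) e"
proof
  show "continuous_on UNIV (\<lambda>z. u (z + c))"
    by (intro continuous_on_compose2[OF u_cont] continuous_intros) auto
  show "u (z + c) = 0" if "z \<bullet> e \<le> b - c \<bullet> e" for z
    using that by (intro u_zero) (simp add: inner_add_left)
  show "0 < u (z + c)" if "b - c \<bullet> e < z \<bullet> e" for z
    using that by (intro u_pos) (simp add: inner_add_left)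
  show "(\<lambda>z. u (z + c)) differentiable at x" if "b - c \<bullet> e < x \<bullet> e" for x
  proof -
    have "u differentiable at (x + c)" using that by (intro u_diff) (simp add: inner_add_left)
    moreover have "(\<lambda>z. z + c) differentiable at x" by simp
    ultimately show ?thesis using differentiable_compose[of u "\<lambda>z. z + c" x UNIV] by simp
  qed
  show "pv_lborel (\<lambda>z. (u (x + c) - u (z + c)) * riesz_kernel \<alpha> x z) x (u (x + c) powr p / C)"
    if "b - c \<bullet> e < x \<bullet> e" for x
  proof -
    have "pv_lborel (\<lambda>z. (u (x + c) - u z) * riesz_kernel \<alpha> (x + c) z) (x + c) (u (x + c) powr p / C)"
      using that by (intro u_eq) (simp add: inner_add_left)
    then have "pv_lborel (\<lambda>z. (u (x + c) - u (z + c)) * riesz_kernel \<alpha> (x + c) (z + c)) x (u (x + c) powr p / C)"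
      by (rule pv_lborel_translate[rotated]) measurable
    then show ?thesis by (simp add: riesz_kernel_def)
  qed
qed (use \<alpha> p C e in auto)

text \<open>
  Spheres centred at \<open>x - T (y - x)\<close> that exchange \<open>x\<close> and \<open>y\<close> converge, as \<open>T\<close> grows, to the
  hyperplane bisecting \<open>x\<close> and \<open>y\<close>; the centres eventually leave the half space.
\<close>

lemma monotone:
  assumes xy: "x \<bullet> e < y \<bullet> e"
  shows "u x \<le> u y"
proof -
  define a where "a = real DIM('a) - \<alpha>"
  define s where "s = (y - x) \<bullet> e"
  have s: "0 < s" using xy by (simp add: s_def inner_diff_left)
  have yx: "0 < norm (y - x)" using xy by auto
  have le: "sqrt (real n / real (Suc n)) powr a * u x \<le> u y" if n: "(x \<bullet> e - b) / s < real n" "0 < n" for n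
  proof -
    define c where "c = x - real n *\<^sub>R (y - x)"
    have "x \<bullet> e - b < real n * s" using n s by (simp add: pos_divide_less_eq)
    then have b': "0 < b - c \<bullet> e" by (simp add: c_def s_def inner_diff_left)
    interpret S: half_space_solution \<alpha> p C "b - c \<bullet> e" "\<lambda>z. u (z + c)" e by (rule translate)
    interpret S': half_space_solution_pos \<alpha> p C "b - c \<bullet> e" "\<lambda>z. u (z + c)" e
      by unfold_locales (rule b')
    \<comment> \<open>Seen from \<open>c\<close>, the points \<open>y\<close> and \<open>x\<close>
      are \<open>n + 1\<close> and \<open>n\<close> times \<open>y - x\<close>. The inversion
      exchanges them when \<open>r\<close> squared is the product of their norms; the Kelvin weight
      is then a power of the square root of \<open>n / (n + 1)\<close>, which tends to 1.\<close>
    define z where "z = real (Suc n) *\<^sub>R (y - x)"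
    define r where "r = sqrt (real n * real (Suc n)) * norm (y - x)"
    have nz: "norm z = real (Suc n) * norm (y - x)" by (simp add: z_def)
    have r0: "0 < r" using n yx by (simp add: r_def)
    have "sqrt (real n * real (Suc n)) \<le> sqrt (real (Suc n) * real (Suc n))"
      by (intro real_sqrt_le_mono mult_right_mono) auto
    then have "sqrt (real n * real (Suc n)) \<le> real (Suc n)" by simp
    then have rz: "r \<le> norm z" unfolding r_def nz by (intro mult_right_mono) auto
    have r2: "r\<^sup>2 = real n * real (Suc n) * (norm (y - x))\<^sup>2"
      by (simp add: r_def power_mult_distrib)
    have "inversion r z = (r\<^sup>2 / (norm z)\<^sup>2 * real (Suc n)) *\<^sub>R (y - x)"
      by (simp add: inversion_def z_def)
    also have "r\<^sup>2 / (norm z)\<^sup>2 * real (Suc n) = real n"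
      unfolding r2 nz power_mult_distrib using yx by (simp add: power2_eq_square)
    finally have inv: "inversion r z + c = x" by (simp add: c_def)
    have zc: "z + c = y" by (simp add: z_def c_def algebra_simps)
    have ratio: "r / norm z = sqrt (real n / real (Suc n))"
    proof -
      have "r / norm z = sqrt (real n * real (Suc n)) / real (Suc n)"
        unfolding r_def nz using yx by simp
      also have "\<dots> = sqrt (real n * real (Suc n)) / sqrt (real (Suc n) * real (Suc n))"
        by simp
      also have "\<dots> = sqrt (real n * real (Suc n) / (real (Suc n) * real (Suc n)))"
        by (rule real_sqrt_divide[symmetric])
      also have "real n * real (Suc n) / (real (Suc n) * real (Suc n)) = real n / real (Suc n)"
        by simp
      finally show ?thesis .
    qed
    have "0 \<le> kelvin_gap \<alpha> r (\<lambda>z. u (z + c)) z" by (rule S'.gap_nonneg[OF r0 rz])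
    then show ?thesis
      by (simp only: kelvin_gap_def kelvin_def inv zc ratio a_def[symmetric] diff_ge_0_iff_ge)
  qed
  have "(\<lambda>n. sqrt (real n / real (Suc n)) powr a * u x) \<longlonglongrightarrow> sqrt 1 powr a * u x"
    by (intro tendsto_mult tendsto_powr tendsto_real_sqrt tendsto_const LIMSEQ_n_over_Suc_n) simp
  moreover have "\<forall>\<^sub>F n in sequentially. sqrt (real n / real (Suc n)) powr a * u x \<le> u y"
    using eventually_gt_at_top[of "nat \<lceil>(x \<bullet> e - b) / s\<rceil>"] eventually_gt_at_top[of 0]
    by eventually_elim (rule le, linarith+)
  ultimately have "sqrt 1 powr a * u x \<le> u y"
    by (intro tendsto_upperbound[of "\<lambda>n. sqrt (real n / real (Suc n)) powr a * u x" _ sequentially]) auto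
  then show ?thesis by simp
qed

end

section \<open>Growth of order \<alpha> and divergence of the weighted integral\<close>

locale half_space_solution_0 = half_space_solution \<alpha> p C 0 u e
  for \<alpha> p C :: real and u :: "'a::euclidean_space \<Rightarrow> real" and e :: 'a
begin

text \<open>With \<open>t = u q\<close> and the truncated paraboloid \<phi> of height 1 on the ball
  of radius \<open>R\<close> around \<open>q\<close>, the function \<open>u - t * \<phi>\<close> is
  0 at \<open>q\<close> and nonnegative outside the ball, so it has a global minimum
  \<open>y\<close> inside. There the increments of \<open>u\<close> are controlled by those of
  \<open>t * \<phi>\<close>, so the operator is at most of order
  \<open>t * R powr (- \<alpha>)\<close>. Monotonicity keeps \<open>u y\<close> above a fixed
  \<open>c0\<close>, and the equation turns this into a lower bound for \<open>t\<close>.\<close>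

lemma power_growth:
  obtains c where "0 < c" "\<And>q. 2 \<le> q \<bullet> e \<Longrightarrow> c * (q \<bullet> e) powr \<alpha> \<le> u q"
proof -
  obtain A1 where A1: "0 \<le> A1" "\<And>(x::'a) R. 0 < R \<Longrightarrow>
      (\<integral>\<^sup>+z. ennreal (1 / norm (x - z) powr (real DIM('a) + \<alpha>)) * indicator (- ball x R) z \<partial>lborel)
        \<le> ennreal (A1 * R powr (- \<alpha>))"
    using nn_integral_kernel_tail[OF \<alpha>(1), where 'a='a] by blast
  obtain A2 where A2: "0 \<le> A2" "\<And>(x::'a) R. 0 < R \<Longrightarrow>
      (\<integral>\<^sup>+z. ennreal ((norm (x - z))\<^sup>2 / norm (x - z) powr (real DIM('a) + \<alpha>)) * indicator (ball x R) z \<partial>lborel)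
        \<le> ennreal (A2 * R powr (2 - \<alpha>))"
    using nn_integral_kernel_core[OF \<alpha>(1,2), where 'a='a] by blast
  define c0 where "c0 = u ((1/2) *\<^sub>R e)"
  have c0: "0 < c0" unfolding c0_def by (intro u_pos) (simp add: e_inner)
  have u_ge: "c0 \<le> u z" if "1 \<le> z \<bullet> e" for z
    unfolding c0_def using that by (intro monotone) (simp add: e_inner)
  have growth: "c0 powr p / C \<le> u q * ((A1 + A2) * R powr (- \<alpha>))" if q: "q \<bullet> e = 2 * R" and R: "1 \<le> R" for q R
  proof -
    define t where "t = u q"
    have t: "0 \<le> t" by (simp add: t_def u_nonneg)
    define \<phi> where "\<phi> z = max 0 (1 - (norm (z - q))\<^sup>2 / R\<^sup>2)" for z
    define F where "F z = u z - t * \<phi> z" for z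
    have "continuous_on (cball q R) F"
      unfolding F_def[abs_def] \<phi>_def using R
      by (intro continuous_intros continuous_on_subset[OF u_cont]) auto
    moreover have "q \<in> cball q R" using R by simp
    ultimately obtain y where y: "y \<in> cball q R" "\<And>z. z \<in> cball q R \<Longrightarrow> F y \<le> F z"
      using continuous_attains_inf[of "cball q R" F] by (metis compact_cball empty_iff)
    have Fy: "F y \<le> 0" using y(2)[OF \<open>q \<in> cball q R\<close>] by (simp add: F_def \<phi>_def t_def)
    have min: "F y \<le> F z" for z
    proof (cases "z \<in> cball q R")
      case False
      then have "R \<le> norm (z - q)" by (simp add: dist_norm norm_minus_commute)
      then have "R\<^sup>2 \<le> (norm (z - q))\<^sup>2" using R by (intro power_mono) auto
      then have "\<phi> z = 0" using R by (simp add: \<phi>_def)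
      then show ?thesis using Fy u_nonneg[of z] by (simp add: F_def)
    qed (rule y(2))
    have yq: "norm (y - q) \<le> R" using y(1) by (simp add: dist_norm norm_minus_commute)
    have ye: "1 \<le> y \<bullet> e"
    proof -
      have "\<bar>(q - y) \<bullet> e\<bar> \<le> norm (q - y) * norm e" by (rule Cauchy_Schwarz_ineq2)
      then have "q \<bullet> e - R \<le> y \<bullet> e" using yq by (simp add: e inner_diff_left norm_minus_commute)
      then show ?thesis using q R by simp
    qed
    have \<phi>y: "\<phi> y = 1 - (norm (y - q))\<^sup>2 / R\<^sup>2"
    proof -
      have "(norm (y - q))\<^sup>2 \<le> R\<^sup>2" using yq by (intro power_mono) auto
      then show ?thesis using R by (simp add: \<phi>_def)
    qed
    have diff: "u y - u z \<le> t * (\<phi> y - \<phi> z)" for z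
      using min[of z] by (simp add: F_def algebra_simps)
    have far: "u y - u z \<le> t * 1" for z
    proof -
      have "\<phi> y \<le> 1" "0 \<le> \<phi> z" by (simp_all add: \<phi>_def)
      then have "\<phi> y - \<phi> z \<le> 1" by linarith
      then have "t * (\<phi> y - \<phi> z) \<le> t * 1" using t by (intro mult_left_mono)
      then show ?thesis using diff[of z] by linarith
    qed
    have near: "u y - u z \<le> t * ((2 * ((y - q) \<bullet> (z - y)) + (norm (y - z))\<^sup>2) / R\<^sup>2)" for z
    proof -
      have "(norm (z - q))\<^sup>2 = (norm (y - q))\<^sup>2 + 2 * ((y - q) \<bullet> (z - y)) + (norm (y - z))\<^sup>2"
        by (simp add: power2_norm_eq_inner algebra_simps inner_commute)
      then have "2 * ((y - q) \<bullet> (z - y)) + (norm (y - z))\<^sup>2 = (norm (z - q))\<^sup>2 - (norm (y - q))\<^sup>2" by simp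
      \<comment> \<open>At \<open>y\<close> the paraboloid is not cut off, whereas at
        \<open>z\<close> the positive part only increases \<phi>.\<close>
      moreover have "\<phi> y - \<phi> z \<le> ((norm (z - q))\<^sup>2 - (norm (y - q))\<^sup>2) / R\<^sup>2"
        unfolding \<phi>y by (simp add: \<phi>_def diff_divide_distrib)
      ultimately have "\<phi> y - \<phi> z \<le> (2 * ((y - q) \<bullet> (z - y)) + (norm (y - z))\<^sup>2) / R\<^sup>2" by simp
      then show ?thesis using diff[of z] mult_left_mono[OF _ t] by (meson order_trans)
    qed
    define K where "K = riesz_kernel \<alpha> y"
    define f1 where "f1 z = indicator (- ball y R) z *\<^sub>R K z" for z
    define f2 where "f2 z = indicator (ball y R) z * ((norm (y - z))\<^sup>2 * K z)" for z
    have Km [measurable]: "K \<in> borel_measurable borel" by (simp add: K_def)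
    have n1: "(\<integral>\<^sup>+z. ennreal (f1 z) \<partial>lborel) \<le> ennreal (A1 * R powr (- \<alpha>))"
    proof -
      have "(\<integral>\<^sup>+z. ennreal (f1 z) \<partial>lborel) = (\<integral>\<^sup>+z. ennreal (1 / norm (y - z) powr (real DIM('a) + \<alpha>)) * indicator (- ball y R) z \<partial>lborel)"
        by (intro nn_integral_cong) (simp add: f1_def K_def riesz_kernel_def indicator_def)
      then show ?thesis using A1(2)[of R y] R by simp
    qed
    have n2: "(\<integral>\<^sup>+z. ennreal (f2 z) \<partial>lborel) \<le> ennreal (A2 * R powr (2 - \<alpha>))"
    proof -
      have "(\<integral>\<^sup>+z. ennreal (f2 z) \<partial>lborel) = (\<integral>\<^sup>+z. ennreal ((norm (y - z))\<^sup>2 / norm (y - z) powr (real DIM('a) + \<alpha>)) * indicator (ball y R) z \<partial>lborel)"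
        by (intro nn_integral_cong) (simp add: f2_def K_def riesz_kernel_def indicator_def)
      then show ?thesis using A2(2)[of R y] R by simp
    qed
    have f1m: "f1 \<in> borel_measurable lborel" unfolding f1_def[abs_def] by measurable
    have f2m: "f2 \<in> borel_measurable lborel"
      unfolding f2_def[abs_def] measurable_lborel1
      by (intro borel_measurable_times borel_measurable_indicator borel_measurable_power) (use Km in auto)
    have f1n: "0 \<le> f1 z" and f2n: "0 \<le> f2 z" for z by (simp_all add: f1_def f2_def K_def)
    have i1: "integrable lborel f1" "(LINT z|lborel. f1 z) \<le> A1 * R powr (- \<alpha>)"
    proof -
      show "integrable lborel f1"
        using n1 f1m f1n by (intro integrableI_bounded) (auto simp: le_less_trans)
      then show "(LINT z|lborel. f1 z) \<le> A1 * R powr (- \<alpha>)"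
        using n1 f1n A1(1) by (simp add: nn_integral_eq_integral)
    qed
    have i2: "integrable lborel f2" "(LINT z|lborel. f2 z) \<le> A2 * R powr (2 - \<alpha>)"
    proof -
      show "integrable lborel f2"
        using n2 f2m f2n by (intro integrableI_bounded) (auto simp: le_less_trans)
      then show "(LINT z|lborel. f2 z) \<le> A2 * R powr (2 - \<alpha>)"
        using n2 f2n A2(1) by (simp add: nn_integral_eq_integral)
    qed
    have pv: "pv_lborel (\<lambda>z. (u y - u z) * K z) y (u y powr p / C)"
      unfolding K_def using ye by (intro u_eq) simp
    have bound: "(LINT z:- ball y \<epsilon>|lborel. (u y - u z) * K z) \<le> t * (A1 + A2) * R powr (- \<alpha>)" if \<epsilon>: "0 < \<epsilon>" "\<epsilon> < R" for \<epsilon>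
    proof -
      \<comment> \<open>The first-order term, odd about \<open>y\<close> on a symmetric annulus. It
        is not absolutely integrable uniformly in \<epsilon> for every \<alpha> below 2, but its
        integral is 0.\<close>
      define f3 where "f3 z = indicator (ball y R - ball y \<epsilon>) z * (((y - q) \<bullet> (z - y)) * K z)" for z
      have f3m: "f3 \<in> borel_measurable borel"
        unfolding f3_def[abs_def]
        by (intro borel_measurable_times borel_measurable_indicator borel_measurable_inner borel_measurable_diff) (use Km in auto)
      have i3: "integrable lborel f3"
      proof (rule Bochner_Integration.integrable_bound)
        show "integrable lborel (\<lambda>z. (norm (y - q) * R) * (indicator (- ball y \<epsilon>) z *\<^sub>R K z))"
          using set_integrable_kernel[OF \<alpha>(1) \<epsilon>(1), of y]
          by (intro integrable_mult_right) (simp add: set_integrable_def K_def riesz_kernel_def[abs_def])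
        show "AE z in lborel. norm (f3 z) \<le> norm ((norm (y - q) * R) * (indicator (- ball y \<epsilon>) z *\<^sub>R K z))"
        proof (rule AE_I2)
          fix z
          show "norm (f3 z) \<le> norm ((norm (y - q) * R) * (indicator (- ball y \<epsilon>) z *\<^sub>R K z))"
          proof (cases "z \<in> ball y R - ball y \<epsilon>")
            case True
            have "\<bar>(y - q) \<bullet> (z - y)\<bar> \<le> norm (y - q) * norm (z - y)" by (rule Cauchy_Schwarz_ineq2)
            also have "\<dots> \<le> norm (y - q) * R"
              using True by (intro mult_left_mono) (auto simp: dist_norm norm_minus_commute)
            finally have "\<bar>(y - q) \<bullet> (z - y)\<bar> * K z \<le> norm (y - q) * R * K z"
              by (rule mult_right_mono) (simp add: K_def)
            then show ?thesis using True R by (simp add: f3_def abs_mult K_def)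
          qed (simp add: f3_def)
        qed
      qed (use f3m in simp)
      have z3: "(LINT z|lborel. f3 z) = 0"
      proof -
        have "f3 (2 *\<^sub>R y - z) = - f3 z" for z
        proof -
          have "y - (2 *\<^sub>R y - z) = - (y - z)" by (simp add: scaleR_2)
          then have nrm: "norm (y - (2 *\<^sub>R y - z)) = norm (y - z)" by (simp only: norm_minus_cancel)
          have "(y - q) \<bullet> (2 *\<^sub>R y - z - y) = - ((y - q) \<bullet> (z - y))"
            by (simp add: inner_diff_right)
          moreover have "K (2 *\<^sub>R y - z) = K z" by (simp only: K_def riesz_kernel_def nrm)
          moreover have "indicator (ball y R - ball y \<epsilon>) (2 *\<^sub>R y - z) = (indicator (ball y R - ball y \<epsilon>) z :: real)"
            by (simp only: indicator_def Diff_iff mem_ball dist_norm nrm)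
          ultimately show ?thesis by (simp only: f3_def mult_minus_left mult_minus_right)
        qed
        then have "(LINT z|lborel. f3 z) = - (LINT z|lborel. f3 z)"
          using integral_lborel_reflect[OF f3m, of "2 *\<^sub>R y"] by simp
        then show ?thesis by simp
      qed
      \<comment> \<open>A majorant of the truncated integrand: the trivial bound \<open>t\<close>
        outside \<open>ball y R\<close>, the exact quadratic expansion on the annulus, and a
        nonnegative excess on \<open>ball y \<epsilon>\<close> that makes the final bound
        independent of \<epsilon>.\<close>
      define G where "G z = t * (f1 z + (2 / R\<^sup>2) * f3 z + (1 / R\<^sup>2) * f2 z)" for z
      have iG: "integrable lborel G"
        unfolding G_def[abs_def] using i1 i2 i3 by (intro integrable_mult_right Bochner_Integration.integrable_add) auto
      have "(LINT z:- ball y \<epsilon>|lborel. (u y - u z) * K z) \<le> (LINT z|lborel. G z)"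
        unfolding set_lebesgue_integral_def
      proof (rule integral_mono[OF _ iG])
        show "integrable lborel (\<lambda>z. indicator (- ball y \<epsilon>) z *\<^sub>R ((u y - u z) * K z))"
          using pv \<epsilon> by (simp add: pv_lborel_def set_integrable_def)
        fix z
        have K0: "0 \<le> K z" by (simp add: K_def)
        consider "z \<in> ball y \<epsilon>" | "z \<in> ball y R - ball y \<epsilon>" | "z \<notin> ball y R" by blast
        then show "indicator (- ball y \<epsilon>) z *\<^sub>R ((u y - u z) * K z) \<le> G z"
        proof cases
          case 1
          then have "z \<in> ball y R" using \<epsilon> by auto
          then have "G z = t * ((1 / R\<^sup>2) * f2 z)" using 1 by (simp add: G_def f1_def f3_def)
          then show ?thesis using 1 t f2n[of z] by simp
        next
          case 2
          have "(u y - u z) * K z \<le> t * ((2 * ((y - q) \<bullet> (z - y)) + (norm (y - z))\<^sup>2) / R\<^sup>2) * K z"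
            using near K0 by (rule mult_right_mono)
          also have "\<dots> = G z"
          proof -
            have "t * ((2 * P + d) / R\<^sup>2) * k = t * (0 + (2 / R\<^sup>2) * (P * k) + (1 / R\<^sup>2) * (d * k))" for P d k :: real
              by (simp add: add_divide_distrib algebra_simps)
            moreover have "f1 z = 0" "f2 z = (norm (y - z))\<^sup>2 * K z" "f3 z = ((y - q) \<bullet> (z - y)) * K z"
              using 2 by (simp_all add: f1_def f2_def f3_def)
            ultimately show ?thesis by (simp only: G_def)
          qed
          finally show ?thesis using 2 by simp
        next
          case 3
          have "(u y - u z) * K z \<le> t * 1 * K z" using far K0 by (rule mult_right_mono)
          also have "\<dots> = G z" using 3 by (simp add: G_def f1_def f2_def f3_def)
          finally show ?thesis using 3 \<epsilon> by simp
        qed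
      qed
      also have "(LINT z|lborel. G z) = t * ((LINT z|lborel. f1 z) + (2 / R\<^sup>2) * (LINT z|lborel. f3 z) + (1 / R\<^sup>2) * (LINT z|lborel. f2 z))"
        unfolding G_def using i1 i2 i3 by simp
      also have "\<dots> = t * ((LINT z|lborel. f1 z) + (1 / R\<^sup>2) * (LINT z|lborel. f2 z))" by (simp add: z3)
      also have "\<dots> \<le> t * (A1 * R powr (- \<alpha>) + (1 / R\<^sup>2) * (A2 * R powr (2 - \<alpha>)))"
        using i1 i2 t by (intro mult_left_mono add_mono) auto
      also have "(1 / R\<^sup>2) * (A2 * R powr (2 - \<alpha>)) = A2 * R powr (- \<alpha>)"
        using R by (simp add: powr_diff powr_minus_divide)
      finally show ?thesis by (simp add: algebra_simps)
    qed
    have "u y powr p / C \<le> t * (A1 + A2) * R powr (- \<alpha>)"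
    proof (rule tendsto_upperbound)
      show "((\<lambda>\<epsilon>. LINT z:- ball y \<epsilon>|lborel. (u y - u z) * K z) \<longlongrightarrow> u y powr p / C) (at_right 0)"
        using pv by (simp add: pv_lborel_def)
      show "\<forall>\<^sub>F \<epsilon> in at_right 0. (LINT z:- ball y \<epsilon>|lborel. (u y - u z) * K z) \<le> t * (A1 + A2) * R powr (- \<alpha>)"
        unfolding eventually_at_right_field using bound R by (intro exI[of _ R]) auto
    qed simp
    moreover have "c0 powr p / C \<le> u y powr p / C"
      using u_ge[OF ye] c0 p C by (intro divide_right_mono powr_mono2) auto
    ultimately show ?thesis by (simp add: t_def mult.assoc)
  qed
  have A: "0 < A1 + A2 + 1" using A1 A2 by simp
  \<comment> \<open>\<open>2 powr \<alpha>\<close> converts \<open>R\<close> into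
    \<open>q \<bullet> e = 2 * R\<close>; the summand 1 keeps the denominator positive.\<close>
  define c where "c = c0 powr p / (C * (A1 + A2 + 1) * 2 powr \<alpha>)"
  show ?thesis
  proof (rule that[of c])
    show "0 < c" using c0 C A by (simp add: c_def)
    fix q assume q: "2 \<le> q \<bullet> e"
    define R where "R = (q \<bullet> e) / 2"
    have R: "1 \<le> R" "q \<bullet> e = 2 * R" using q by (auto simp: R_def)
    have "c0 powr p / C \<le> u q * ((A1 + A2) * R powr (- \<alpha>))" by (rule growth[OF R(2,1)])
    also have "\<dots> \<le> u q * ((A1 + A2 + 1) * R powr (- \<alpha>))"
      using u_nonneg by (intro mult_left_mono mult_right_mono) auto
    finally have "c0 powr p / C * R powr \<alpha> \<le> u q * ((A1 + A2 + 1) * R powr (- \<alpha>)) * R powr \<alpha>"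
      by (intro mult_right_mono) auto
    also have "\<dots> = u q * (A1 + A2 + 1)"
      using R by (simp add: powr_minus)
    finally have "c0 powr p / C * R powr \<alpha> \<le> u q * (A1 + A2 + 1)" .
    then have "c0 powr p / C * R powr \<alpha> / (A1 + A2 + 1) \<le> u q"
      by (rule mult_imp_div_pos_le[OF A])
    moreover have "c * (q \<bullet> e) powr \<alpha> = c0 powr p / C * R powr \<alpha> / (A1 + A2 + 1)"
      unfolding R(2) by (simp add: c_def powr_mult)
    ultimately show "c * (q \<bullet> e) powr \<alpha> \<le> u q" by simp
  qed
qed

text \<open>On a ball of radius T at height between 2 T and 4 T the growth T^\<alpha>, the weight
  T^(-n - \<alpha>) and the volume T^n multiply to a constant. Disjoint balls at infinitely many
  scales therefore make the integral infinite.\<close>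

theorem not_weighted_integrable:
  "\<not> integrable lborel (\<lambda>z. \<bar>u z\<bar> / (1 + norm z powr (real DIM('a) + \<alpha>)))"
proof
  define N where "N = real DIM('a) + \<alpha>"
  have N: "0 < N" using \<alpha> by (simp add: N_def add_nonneg_pos)
  define f where "f z = \<bar>u z\<bar> / (1 + norm z powr N)" for z
  assume "integrable lborel (\<lambda>z. \<bar>u z\<bar> / (1 + norm z powr (real DIM('a) + \<alpha>)))"
  then have int: "integrable lborel f" by (simp add: f_def[abs_def] N_def)
  have f0: "0 \<le> f z" for z by (simp add: f_def add_nonneg_pos)
  obtain c where c: "0 < c" "\<And>q. 2 \<le> q \<bullet> e \<Longrightarrow> c * (q \<bullet> e) powr \<alpha> \<le> u q"
    using power_growth by blast
  define T where "T j = (4::real) ^ j" for j :: nat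
  have T: "1 \<le> T j" for j by (simp add: T_def)
  \<comment> \<open>Centre \<open>3 * T j\<close> and radius \<open>T j\<close> give norms strictly
    between \<open>2 * T j\<close> and \<open>4 * T j\<close>, whence disjointness, and heights at
    least 2 as \<open>power_growth\<close> requires.\<close>
  define B where "B j = ball ((3 * T j) *\<^sub>R e) (T j)" for j
  have B: "2 * T j < norm z" "norm z < 4 * T j" "2 * T j \<le> z \<bullet> e" if "z \<in> B j" for z j
  proof -
    let ?q = "(3 * T j) *\<^sub>R e"
    have d: "norm (?q - z) < T j" using that by (simp add: B_def dist_norm)
    have nq: "norm ?q = 3 * T j" using e T[of j] by simp
    show "2 * T j < norm z" using d nq norm_triangle_ineq2[of ?q z] by linarith
    show "norm z < 4 * T j" using d nq norm_triangle_ineq2[of z ?q] by (simp add: norm_minus_commute)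
    have "\<bar>(?q - z) \<bullet> e\<bar> \<le> norm (?q - z) * norm e" by (rule Cauchy_Schwarz_ineq2)
    then show "2 * T j \<le> z \<bullet> e" using d by (simp add: e inner_diff_left e_inner)
  qed
  have disj: "disjoint_family B"
  proof (unfold disjoint_family_on_def, intro ballI impI)
    have less: "B i \<inter> B j = {}" if "i < j" for i j
    proof -
      have "T (Suc i) \<le> T j" unfolding T_def using that by (intro power_increasing) auto
      then have "4 * T i \<le> T j" by (simp add: T_def)
      then have "4 * T i \<le> 2 * T j" using T[of j] by linarith
      then show ?thesis using B(1)[of _ j] B(2)[of _ i] by fastforce
    qed
    fix i j :: nat assume "i \<noteq> j"
    then show "B i \<inter> B j = {}" using less[of i j] less[of j i] by (cases i j rule: linorder_cases) auto
  qed
  define V where "V = unit_ball_vol (real DIM('a))"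
  have V: "0 < V" by (simp add: V_def)
  \<comment> \<open>The denominator comes from \<open>1 + norm z powr N\<close>, which is at most
    \<open>2 * (4 * T j) powr N\<close> on \<open>B j\<close>.\<close>
  define d where "d = c / (2 * 4 powr N)"
  have d: "0 < d" using c by (simp add: d_def)
  have piece: "d * V \<le> (LINT z:B j|lborel. f z)" for j
  proof -
    have T0: "0 < T j" using T[of j] by linarith
    have "d * V = (d * T j powr (- real DIM('a))) * measure lborel (B j)"
    proof -
      have "measure lborel (B j) = V * T j powr real DIM('a)"
        using T0 by (simp add: B_def content_ball V_def powr_realpow)
      then show ?thesis using T0 by (simp add: powr_minus)
    qed
    also have "\<dots> = (LINT z|lborel. (d * T j powr (- real DIM('a))) * indicator (B j) z)"
      by (simp add: B_def)
    also have "\<dots> \<le> (LINT z:B j|lborel. f z)"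
      unfolding set_lebesgue_integral_def
    proof (rule integral_mono)
      show "integrable lborel (\<lambda>z. (d * T j powr (- real DIM('a))) * indicator (B j) z)"
        using T0 by (intro integrable_mult_right integrable_real_indicator) (auto simp: B_def emeasure_ball)
      show "integrable lborel (\<lambda>z. indicator (B j) z *\<^sub>R f z)"
        using int by (intro integrable_mult_indicator) (auto simp: B_def)
      fix z
      show "(d * T j powr (- real DIM('a))) * indicator (B j) z \<le> indicator (B j) z *\<^sub>R f z"
      proof (cases "z \<in> B j")
        case True
        note z = B[OF True]
        have "c * T j powr \<alpha> \<le> c * (z \<bullet> e) powr \<alpha>"
          using z T0 c \<alpha> by (intro mult_left_mono powr_mono2) auto
        also have "\<dots> \<le> u z" using z T[of j] by (intro c) auto
        finally have num: "c * T j powr \<alpha> \<le> \<bar>u z\<bar>" by simp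
        have "1 \<le> (4 * T j) powr N" using T[of j] N by (intro ge_one_powr_ge_zero) auto
        moreover have "norm z powr N \<le> (4 * T j) powr N" using z N by (intro powr_mono2) auto
        ultimately have den: "1 + norm z powr N \<le> 2 * (4 powr N * T j powr N)" by (simp add: powr_mult)
        have "d * T j powr (- real DIM('a)) = c * T j powr \<alpha> / (2 * (4 powr N * T j powr N))"
        proof -
          have "T j powr (- real DIM('a)) = T j powr \<alpha> / T j powr N"
            by (simp add: powr_diff[symmetric] N_def)
          then show ?thesis by (simp add: d_def)
        qed
        also have "\<dots> \<le> f z"
          unfolding f_def using num den c by (intro frac_le) (auto simp: add_pos_nonneg)
        finally show ?thesis using True by simp
      qed simp
    qed
    finally show ?thesis .
  qed
  have sum: "real m * (d * V) \<le> (LINT z|lborel. f z)" for m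
  proof -
    have i: "set_integrable lborel (B j) f" for j
      unfolding set_integrable_def using int by (intro integrable_mult_indicator) (auto simp: B_def)
    have "real m * (d * V) = (\<Sum>j<m. d * V)" by simp
    also have "\<dots> \<le> (\<Sum>j<m. LINT z:B j|lborel. f z)" by (intro sum_mono piece)
    also have "\<dots> = (LINT z|lborel. (\<Sum>j<m. indicator (B j) z *\<^sub>R f z))"
      unfolding set_lebesgue_integral_def using i by (subst Bochner_Integration.integral_sum) (auto simp: set_integrable_def)
    also have "\<dots> \<le> (LINT z|lborel. f z)"
    proof (rule integral_mono[OF _ int])
      show "integrable lborel (\<lambda>z. \<Sum>j<m. indicator (B j) z *\<^sub>R f z)"
        using i by (intro Bochner_Integration.integrable_sum) (simp add: set_integrable_def)
      fix z
      have "(\<Sum>j<m. indicator (B j) z :: real) = indicator (\<Union>j<m. B j) z"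
        using disj by (intro indicator_UN_disjoint[symmetric]) (auto simp: disjoint_family_on_def)
      then have "(\<Sum>j<m. indicator (B j) z :: real) \<le> 1" by (simp add: indicator_def)
      then have "(\<Sum>j<m. indicator (B j) z) * f z \<le> 1 * f z" using f0 by (rule mult_right_mono)
      then show "(\<Sum>j<m. indicator (B j) z *\<^sub>R f z) \<le> f z" by (simp add: sum_distrib_right)
    qed
    finally show ?thesis .
  qed
  have dV: "0 < d * V" using d V by simp
  obtain m :: nat where "(LINT z|lborel. f z) < real m * (d * V)"
    using reals_Archimedean3[OF dV] by blast
  then show False using sum[of m] by simp
qed

end

text \<open>At a zero of a nonnegative function the integrand is nonpositive, so the truncated
  integrals decrease as the removed ball shrinks. Their limit being 0, each of them is nonnegative,
  and the integrand vanishes almost everywhere away from \<open>x\<close>; continuity removes the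
  exceptional set.\<close>

lemma vanishing_of_pv:
  fixes u :: "'a::euclidean_space \<Rightarrow> real"
  assumes u: "continuous_on UNIV u" "\<And>z. 0 \<le> u z" and x: "u x = 0"
    and pv: "pv_lborel (\<lambda>z. (u x - u z) * riesz_kernel \<alpha> x z) x 0"
  shows "u z = 0"
proof (rule ccontr)
  assume "u z \<noteq> 0"
  then have uz: "0 < u z" using u(2)[of z] by simp
  have zx: "0 < norm (x - z)" using x uz by auto
  have "open (u -` {0<..})" using u(1) by (intro open_vimage) auto
  then obtain s where s: "0 < s" "ball z s \<subseteq> u -` {0<..}" using uz by (force elim: openE)
  define \<delta> where "\<delta> = min s (norm (x - z) / 2)"
  have \<delta>: "0 < \<delta>" "\<delta> \<le> s" "\<delta> \<le> norm (x - z) / 2" using s zx by (auto simp: \<delta>_def min_def)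
  define f where "f y = (u x - u y) * riesz_kernel \<alpha> x y" for y
  have f_le: "f y \<le> 0" for y using u(2)[of y] by (simp add: f_def x mult_nonpos_nonneg)
  have int: "set_integrable lborel (- ball x \<epsilon>) f" if "0 < \<epsilon>" for \<epsilon>
    using pv that by (simp add: pv_lborel_def f_def[abs_def])
  have "0 \<le> (LINT y:- ball x \<delta>|lborel. f y)"
  proof (rule tendsto_upperbound)
    show "((\<lambda>\<epsilon>. LINT y:- ball x \<epsilon>|lborel. f y) \<longlongrightarrow> 0) (at_right 0)"
      using pv by (simp add: pv_lborel_def f_def[abs_def])
    have "(LINT y:- ball x \<epsilon>|lborel. f y) \<le> (LINT y:- ball x \<delta>|lborel. f y)" if "0 < \<epsilon>" "\<epsilon> < \<delta>" for \<epsilon>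
      unfolding set_lebesgue_integral_def
      using int[OF that(1)] int[OF \<delta>(1)] f_le that
      by (intro integral_mono) (auto simp: set_integrable_def indicator_def)
    then show "\<forall>\<^sub>F \<epsilon> in at_right 0. (LINT y:- ball x \<epsilon>|lborel. f y) \<le> (LINT y:- ball x \<delta>|lborel. f y)"
      unfolding eventually_at_right_field using \<delta>(1) by blast
  qed simp
  moreover have "(LINT y|lborel. - (indicator (- ball x \<delta>) y *\<^sub>R f y)) \<ge> 0"
    by (rule integral_nonneg_AE) (use f_le in \<open>auto simp: indicator_def\<close>)
  ultimately have "(LINT y|lborel. - (indicator (- ball x \<delta>) y *\<^sub>R f y)) = 0"
    by (simp add: set_lebesgue_integral_def)
  moreover have "integrable lborel (\<lambda>y. - (indicator (- ball x \<delta>) y *\<^sub>R f y))"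
    using int[OF \<delta>(1)] by (simp add: set_integrable_def)
  ultimately have AE: "AE y in lborel. - (indicator (- ball x \<delta>) y *\<^sub>R f y) = 0"
    using integral_nonneg_eq_0_iff_AE[of lborel "\<lambda>y. - (indicator (- ball x \<delta>) y *\<^sub>R f y)"] f_le
    by (simp add: indicator_def)
  have neg: "f y < 0" "y \<notin> ball x \<delta>" if "y \<in> ball z \<delta>" for y
  proof -
    have far: "\<delta> \<le> norm (x - y)"
      using that \<delta>(3) norm_triangle_ineq[of "x - y" "y - z"] by (simp add: dist_norm norm_minus_commute)
    then show "y \<notin> ball x \<delta>" by (simp add: dist_norm)
    have "x \<noteq> y" using far \<delta>(1) by auto
    moreover have "0 < u y" using that s(2) subset_ball[OF \<delta>(2), of z] by blast
    ultimately show "f y < 0" using riesz_kernel_pos[of x y \<alpha>] by (simp add: f_def x mult_neg_pos)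
  qed
  have "AE y in lborel. y \<notin> ball z \<delta>"
    using AE
  proof eventually_elim
    case (elim y)
    then show ?case using neg[of y] by (auto simp: indicator_def)
  qed
  then have "emeasure lborel (ball z \<delta>) = 0"
    by (subst (asm) AE_iff_measurable[of "ball z \<delta>"]) auto
  then show False using \<delta>(1) by (simp add: emeasure_ball ennreal_eq_0_iff) (metis not_less unit_ball_vol_pos mult_pos_pos zero_less_power of_nat_0_le_iff)
qed

lemma has_pv_integral_iff_lborel:
  fixes f :: "'a::euclidean_space \<Rightarrow> real"
  assumes [measurable]: "f \<in> borel_measurable borel"
  shows "has_pv_integral f x I \<longleftrightarrow> pv_lborel f x I"
proof -
  have m: "(\<lambda>z. indicator (- ball x \<epsilon>) z *\<^sub>R f z) \<in> borel_measurable lborel" for \<epsilon> by measurable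
  show ?thesis
    unfolding has_pv_integral_def pv_lborel_def set_integrable_def set_lebesgue_integral_def
      integrable_completion[OF m] integral_completion[OF m] ..
qed

theorem theorem1p4:
  fixes u :: "real ^ 'n::finite \<Rightarrow> real" and k :: 'n and \<alpha> p C :: real
  assumes "0 < \<alpha>" and "\<alpha> < 2"
    and "real CARD('n) > \<alpha>"
    and "1 < p" and "p \<le> (real CARD('n) + \<alpha>) / (real CARD('n) - \<alpha>)"
    and "C > 0"
    and "u \<in> L_space \<alpha>"
    and "u \<in> C11_loc (half_space k)"
    and "continuous_on (closure (half_space k)) u"
    and "\<forall>x. u x \<ge> 0"
    and "\<forall>x \<in> half_space k. has_frac_laplacian C \<alpha> u x (u x powr p)"
    and "\<forall>x \<in> - half_space k. u x = 0"
  shows "\<forall>x \<in> half_space k. u x = 0"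
proof (rule ccontr)
  assume nonzero: "\<not> (\<forall>x \<in> half_space k. u x = 0)"
  define e :: "real ^ 'n" where "e = axis k 1"
  have half: "x \<in> half_space k \<longleftrightarrow> 0 < x \<bullet> e" for x
    by (simp add: half_space_def e_def inner_axis)
  \<comment> \<open>The closed half space and the complement of the open one are two closed sets
    covering the space, so continuity on each glues to global continuity.\<close>
  have cont: "continuous_on UNIV u"
  proof -
    have "continuous_on (- half_space k) u"
      using assms(12) by (intro continuous_on_eq[OF continuous_on_const]) auto
    moreover have "closed (- half_space k)"
    proof -
      have "half_space k = {x. 0 < x \<bullet> e}" using half by auto
      then have "open (half_space k)" by (simp only:) (intro open_Collect_less continuous_intros)
      then show ?thesis by (simp add: closed_Compl)
    qed
    ultimately have "continuous_on (closure (half_space k) \<union> - half_space k) u"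
      using assms(9) by (intro continuous_on_closed_Un) auto
    moreover have "closure (half_space k) \<union> - half_space k = UNIV"
      using closure_subset[of "half_space k"] by auto
    ultimately show ?thesis by simp
  qed
  then have meas [measurable]: "u \<in> borel_measurable borel"
    by (rule borel_measurable_continuous_onI)
  have eq: "pv_lborel (\<lambda>z. (u x - u z) * riesz_kernel \<alpha> x z) x (u x powr p / C)" if "0 < x \<bullet> e" for x
  proof -
    have "x \<in> half_space k" using that half by simp
    then obtain I where I: "has_pv_integral (\<lambda>z. (u x - u z) / norm (x - z) powr (real CARD('n) + \<alpha>)) x I"
      "u x powr p = C * I"
      using assms(11) unfolding has_frac_laplacian_def by blast
    then have "pv_lborel (\<lambda>z. (u x - u z) / norm (x - z) powr (real CARD('n) + \<alpha>)) x I"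
      by (subst (asm) has_pv_integral_iff_lborel) measurable
    then show ?thesis using I(2) assms(6) by (simp add: riesz_kernel_def)
  qed
  have pos: "0 < u x" if x: "0 < x \<bullet> e" for x
  proof (rule ccontr)
    assume "\<not> 0 < u x"
    then have ux: "u x = 0" using assms(10) by (metis less_eq_real_def)
    \<comment> \<open>Since \<open>0 powr p = 0\<close>, the equation at a zero of \<open>u\<close>
      says that the principal value is 0.\<close>
    then have "u z = 0" for z
      using eq[OF x] assms(10) by (intro vanishing_of_pv[OF cont _ ux]) auto
    then show False using nonzero by auto
  qed
  interpret half_space_solution_0 \<alpha> p C u e
  proof
    show "u z = 0" if "z \<bullet> e \<le> 0" for z
      using that half[of z] assms(12) by auto
    show "u differentiable at x" if "0 < x \<bullet> e" for x
      using that half assms(8) by (auto simp: C11_loc_def gderiv_def differentiable_def)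
  qed (use assms cont pos eq in \<open>auto simp: e_def\<close>)
  have "integrable lebesgue (\<lambda>x. \<bar>u x\<bar> / (1 + norm x powr (real CARD('n) + \<alpha>)))"
    using assms(7) by (simp add: L_space_def)
  then have "integrable lborel (\<lambda>x. \<bar>u x\<bar> / (1 + norm x powr (real CARD('n) + \<alpha>)))"
    by (subst (asm) integrable_completion) measurable
  then show False using not_weighted_integrable by simp
qed

end
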